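(* Let $T>0$, let $b:[0,T]\to\mathbb{R}^{m\times m}$ and $\sigma:[0,T]\to\mathbb{R}^{m\times d}$ be deterministic measurable functions with $\int_0^T\|b(t)\|\,dt<\infty$ and $\int_0^T\|\sigma(t)\|^2\,dt<\infty$, let $B$ be a $d$-dimensional standard Brownian motion, and let $X_0\sim p_{\mathrm{data}}$ be an $\mathbb{R}^m$-valued random initial condition independent of $B$. Let $X$ solve the linear SDE $$dX_t=b(t)X_t\,dt+\sigma(t)\,dB_t,\qquad 0\le t\le T,$$ with initial value $X_0$, let $Y_t\in\mathbb{R}^{m\times m}$ solve $dY_t=b(t)Y_t\,dt$, $Y_0=I_m$, and set $$\gamma_{X_T}=Y_T\left(\int_0^T Y_r^{-1}\sigma(r)\sigma(r)^\top (Y_r^{-1})^\top\,dr\right)Y_T^\top .$$ Assume $\gamma_{X_T}$ is invertible, and let $p$ be the density of $X_T$. Then, for almost every $y\in\mathbb{R}^m$, $$\nabla_y\log p(y)=-\gamma_{X_T}^{-1}\left(y-Y_T\,\mathbb{E}[X_0\mid X_T=y]\right).$$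
   Context: $I_m$ is the $m\times m$ identity matrix. $\mathbb{E}[X_0\mid X_T=y]$ denotes the mean of the conditional law of $X_0$ given $X_T=y$. "Almost every" is with respect to Lebesgue measure on $\mathbb{R}^m$. *)

theory Defs
  imports "HOL-Probability.Probability"
begin

text \<open>
  Standard Brownian motion in dimension \<open>CARD('d)\<close>, with time running through
  \<open>S\<close> (an interval with left end point \<open>0\<close>). The density of an increment is that of
  the normal law with mean \<open>0\<close> and covariance \<open>(t - s) I\<close>.
\<close>

definition brownian_motion_on ::
    "'a measure \<Rightarrow> real set \<Rightarrow> (real \<Rightarrow> 'a \<Rightarrow> real^'d) \<Rightarrow> bool" where
  "brownian_motion_on M S B \<longleftrightarrow>
     (\<forall>t\<in>S. B t \<in> borel_measurable M) \<and>
     (AE \<omega> in M. B 0 \<omega> = 0) \<and>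
     (\<forall>(n::nat) \<tau>. (\<forall>i\<le>n. \<tau> i \<in> S) \<and> (\<forall>i<n. \<tau> i < \<tau> (Suc i)) \<longrightarrow>
        prob_space.indep_vars M (\<lambda>_. borel) (\<lambda>i \<omega>. B (\<tau> (Suc i)) \<omega> - B (\<tau> i) \<omega>) {..<n}) \<and>
     (\<forall>s\<in>S. \<forall>t\<in>S. s < t \<longrightarrow>
        distributed M lborel (\<lambda>\<omega>. B t \<omega> - B s \<omega>)
          (\<lambda>x. ennreal (\<Prod>j\<in>UNIV. normal_density 0 (sqrt (t - s)) (x $ j)))) \<and>
     (AE \<omega> in M. continuous_on S (\<lambda>t. B t \<omega>))"

text \<open>
  Independence of a random vector and the whole process \<open>(B t)\<close>, \<open>t \<in> S\<close>. (The library's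
  \<open>indep_var\<close> requires both variables to have the same type, hence the generated
  sigma-algebras.)
\<close>

definition indep_of_process ::
    "'a measure \<Rightarrow> real set \<Rightarrow> ('a \<Rightarrow> real^'m) \<Rightarrow> (real \<Rightarrow> 'a \<Rightarrow> real^'d) \<Rightarrow> bool" where
  "indep_of_process M S X0 B \<longleftrightarrow>
     prob_space.indep_set M
       (sets (vimage_algebra (space M) X0 borel))
       (sets (vimage_algebra (space M) (\<lambda>\<omega>. \<lambda>t\<in>S. B t \<omega>) (PiM S (\<lambda>_. borel))))"

definition step_function ::
    "nat \<Rightarrow> (nat \<Rightarrow> real) \<Rightarrow> (nat \<Rightarrow> real^'d^'m) \<Rightarrow> real \<Rightarrow> real^'d^'m" where
  "step_function n \<tau> A s = (\<Sum>i<n. indicator {\<tau> i<..\<tau> (Suc i)} s *\<^sub>R A i)"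

definition step_integral ::
    "nat \<Rightarrow> (nat \<Rightarrow> real) \<Rightarrow> (nat \<Rightarrow> real^'d^'m) \<Rightarrow> (real \<Rightarrow> 'a \<Rightarrow> real^'d) \<Rightarrow> 'a \<Rightarrow> real^'m" where
  "step_integral n \<tau> A B \<omega> = (\<Sum>i<n. A i *v (B (\<tau> (Suc i)) \<omega> - B (\<tau> i) \<omega>))"

text \<open>
  The random vector \<open>I\<close> is (a version of) the stochastic integral of the deterministic
  integrand \<open>f\<close> with respect to \<open>B\<close> over \<open>[0, t]\<close>: the mean-square limit of the integrals
  of step functions approximating \<open>f\<close> in mean square. By the Ito isometry the limit does
  not depend on the approximating sequence, up to almost sure equality.
\<close>

definition has_stochastic_integral ::
    "'a measure \<Rightarrow> (real \<Rightarrow> 'a \<Rightarrow> real^'d) \<Rightarrow> (real \<Rightarrow> real^'d^'m) \<Rightarrow> real \<Rightarrow> ('a \<Rightarrow> real^'m) \<Rightarrow> bool"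
  where
  "has_stochastic_integral M B f t I \<longleftrightarrow>
     I \<in> borel_measurable M \<and>
     (\<exists>(n :: nat \<Rightarrow> nat) (\<tau> :: nat \<Rightarrow> nat \<Rightarrow> real) (A :: nat \<Rightarrow> nat \<Rightarrow> real^'d^'m).
        (\<forall>k. (\<forall>i\<le>n k. \<tau> k i \<in> {0..t}) \<and> (\<forall>i<n k. \<tau> k i < \<tau> k (Suc i))) \<and>
        (\<lambda>k. \<integral>\<^sup>+ s. ennreal ((norm (f s - step_function (n k) (\<tau> k) (A k) s))\<^sup>2)
               \<partial>lebesgue_on {0..t}) \<longlonglongrightarrow> 0 \<and>
        (\<lambda>k. \<integral>\<^sup>+ \<omega>. ennreal ((norm (I \<omega> - step_integral (n k) (\<tau> k) (A k) B \<omega>))\<^sup>2)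
               \<partial>M) \<longlonglongrightarrow> 0)"

text \<open>
  \<open>X\<close> solves \<open>dX = b X dt + \<sigma> dB\<close> on \<open>[0, T]\<close> with initial value \<open>X0\<close>. As the paths are
  continuous, requiring the integral equation almost surely for each \<open>t\<close> is the same as
  requiring it almost surely for all \<open>t\<close> simultaneously. Adaptedness need not be imposed:
  the integrand \<open>\<sigma>\<close> is deterministic, and \<open>X\<close> is determined pathwise by \<open>X0\<close> and the
  stochastic integral.
\<close>

definition solves_linear_sde ::
    "'a measure \<Rightarrow> real \<Rightarrow> (real \<Rightarrow> real^'m^'m) \<Rightarrow> (real \<Rightarrow> real^'d^'m) \<Rightarrow>
     (real \<Rightarrow> 'a \<Rightarrow> real^'d) \<Rightarrow> ('a \<Rightarrow> real^'m) \<Rightarrow> (real \<Rightarrow> 'a \<Rightarrow> real^'m) \<Rightarrow> bool" where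
  "solves_linear_sde M T b \<sigma> B X0 X \<longleftrightarrow>
     (\<forall>t\<in>{0..T}. X t \<in> borel_measurable M) \<and>
     (AE \<omega> in M. continuous_on {0..T} (\<lambda>t. X t \<omega>)) \<and>
     (AE \<omega> in M. X 0 \<omega> = X0 \<omega>) \<and>
     (AE \<omega> in M. integrable (lebesgue_on {0..T}) (\<lambda>s. b s *v X s \<omega>)) \<and>
     (\<forall>t\<in>{0..T}. \<exists>I. has_stochastic_integral M B \<sigma> t I \<and>
        (AE \<omega> in M. X t \<omega> = X0 \<omega> + (LINT s|lebesgue_on {0..t}. b s *v X s \<omega>) + I \<omega>))"

definition solves_linear_matrix_ode ::
    "real \<Rightarrow> (real \<Rightarrow> real^'m^'m) \<Rightarrow> (real \<Rightarrow> real^'m^'m) \<Rightarrow> bool" where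
  "solves_linear_matrix_ode T b Y \<longleftrightarrow>
     integrable (lebesgue_on {0..T}) (\<lambda>s. b s ** Y s) \<and>
     (\<forall>t\<in>{0..T}. Y t = mat 1 + (LINT s|lebesgue_on {0..t}. b s ** Y s))"

text \<open>\<open>\<kappa> y\<close> is a regular conditional law of \<open>Z\<close> given \<open>V = y\<close>.\<close>

definition is_conditional_law ::
    "'a measure \<Rightarrow> ('a \<Rightarrow> real^'m) \<Rightarrow> ('a \<Rightarrow> real^'m) \<Rightarrow> (real^'m \<Rightarrow> (real^'m) measure) \<Rightarrow> bool" where
  "is_conditional_law M Z V \<kappa> \<longleftrightarrow>
     \<kappa> \<in> measurable borel (prob_algebra borel) \<and>
     (\<forall>A\<in>sets borel. \<forall>C\<in>sets borel.
        emeasure M {\<omega> \<in> space M. V \<omega> \<in> A \<and> Z \<omega> \<in> C} =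
        (\<integral>\<^sup>+ y\<in>A. emeasure (\<kappa> y) C \<partial>distr M borel V))"

text \<open>
  Densities are unique only almost everywhere; the one that can be differentiated is the
  continuous version, which is unique.
\<close>

definition is_continuous_density ::
    "'a measure \<Rightarrow> ('a \<Rightarrow> real^'m) \<Rightarrow> (real^'m \<Rightarrow> real) \<Rightarrow> bool" where
  "is_continuous_density M V p \<longleftrightarrow>
     continuous_on UNIV p \<and> (\<forall>y. 0 \<le> p y) \<and> distributed M lborel V (\<lambda>y. ennreal (p y))"

end

theory Submission
  imports Defs
begin

text \<open>
  Write \<open>R = Y\<^sup>-\<^sup>1\<close>. Summation by parts along a partition of \<open>[0, T]\<close> shows, path by path, that
  \<open>R T X\<^sub>T - X\<^sub>0\<close> is the limit of the sums \<open>\<Sum> R t\<^sub>i\<^sub>+\<^sub>1 (I t\<^sub>i\<^sub>+\<^sub>1 - I t\<^sub>i)\<close>, where \<open>I\<close> is the integral of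
  \<open>\<sigma>\<close> against \<open>B\<close>. Such a sum is a mean-square limit of linear combinations of Brownian
  increments, so its characteristic function, restricted to an event \<open>X\<^sub>0 \<in> C\<close>, is explicit, and
  so is that of the limit. By uniqueness of characteristic functions \<open>X\<^sub>T = Y\<^sub>T X\<^sub>0 + Z\<close> with \<open>Z\<close>
  Gaussian of covariance \<open>\<gamma>\<close> and independent of \<open>X\<^sub>0\<close>. Hence the density is the mixture
  \<open>p y = E \<phi> (y - Y\<^sub>T X\<^sub>0)\<close> of Gaussian densities \<open>\<phi>\<close>, Bayes' formula gives the conditional law, and
  differentiating under the integral gives the claim (Tweedie's formula).
\<close>

section \<open>Matrices and the fundamental solution\<close>

text \<open>The integral against \<open>B\<close> is given only as a mean-square limit for each
  fixed time, so no Ito formula is applied to \<open>R\<close>. Everything is done with the values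
  of the integral at finitely many grid times, with the values of \<open>R\<close> as deterministic
  weights. Since \<open>b\<close> is merely integrable, \<open>R\<close> need not be Lipschitz; the
  absolute continuity of the integral of \<open>norm (b t)\<close> takes over that role.

  The matrix \<gamma> enters through a whitening matrix \<open>L\<close> with
  \<open>L ** \<gamma> ** transpose L = mat 1\<close>: then \<open>L *v Z\<close> is standard normal
  and the inverse of \<gamma> is \<open>transpose L ** L\<close>. The determinant in the density is
  never computed, because the logarithmic gradient does not see it.

  The conditional mean exists although the initial value may have no mean: given the final value,
  the Gaussian factor damps large initial values, as \<open>Y T\<close> is invertible. The
  exceptional set of \<open>y\<close> is due to the conditional law alone, which is fixed only up to
  null sets of the law of \<open>X T\<close>; as the density is positive, these are the Lebesgue
  null sets.\<close>

lemma norm_matrix_vector_le: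
  fixes A :: "real^'n^'m" and x :: "real^'n"
  shows "norm (A *v x) \<le> norm A * norm x"
proof -
  have "norm (A *v x) = L2_set (\<lambda>i. row i A \<bullet> x) UNIV"
    by (simp add: norm_vec_def L2_set_def matrix_mult_dot row_def)
  also have "\<dots> \<le> L2_set (\<lambda>i. norm (A $ i) * norm x) UNIV"
    unfolding L2_set_def
    by (intro real_sqrt_le_mono sum_mono)
      (metis Cauchy_Schwarz_ineq2 abs_ge_zero power2_abs power_mono row_def vec_nth_inverse)
  also have "\<dots> = norm A * norm x"
    by (simp add: norm_vec_def[of A] L2_set_left_distrib)
  finally show ?thesis .
qed

lemma bounded_bilinear_matrix_vector:
  "bounded_bilinear ((*v) :: real^'n^'m \<Rightarrow> real^'n \<Rightarrow> real^'m)"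
proof
  show "\<exists>K. \<forall>(a :: real^'n^'m) b. norm (a *v b) \<le> norm a * norm b * K"
    by (rule exI[of _ 1]) (simp add: norm_matrix_vector_le)
qed (simp_all add: matrix_vector_mult_def vec_eq_iff sum.distrib algebra_simps
      scaleR_sum_right sum_distrib_left)

lemma norm_transpose [simp]:
  fixes A :: "real^'n^'m"
  shows "norm (transpose A) = norm A"
  unfolding norm_vec_def L2_set_def transpose_def
  by (simp add: sum_nonneg) (rule sum.swap)

text \<open>The norm on matrices is the Frobenius norm, a sum of squares over rows. After a
  transposition the rows are the columns \<open>A *v column j C\<close>, to which the vector bound
  applies one by one.\<close>

lemma norm_matrix_matrix_le:
  fixes A :: "real^'n^'m" and C :: "real^'k^'n"
  shows "norm (A ** C) \<le> norm A * norm C"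
proof -
  have "norm (A ** C) = norm (transpose (A ** C))"
    by simp
  also have "\<dots> = L2_set (\<lambda>j. norm (A *v column j C)) UNIV"
    unfolding norm_vec_def[of "transpose _"]
    by (intro arg_cong2[where f=L2_set] ext refl)
      (simp add: transpose_def column_def matrix_matrix_mult_def matrix_vector_mult_def)
  also have "\<dots> \<le> L2_set (\<lambda>j. norm A * norm (transpose C $ j)) UNIV"
    by (intro L2_set_mono) (simp_all add: norm_matrix_vector_le transpose_def column_def
        order_trans[OF norm_matrix_vector_le])
  also have "\<dots> = norm A * norm (transpose C)"
    unfolding norm_vec_def[of "transpose C"] by (simp only: L2_set_right_distrib[OF norm_ge_zero])
  finally show ?thesis by simp
qed

lemma bounded_bilinear_matrix_matrix:
  "bounded_bilinear ((**) :: real^'n^'m \<Rightarrow> real^'k^'n \<Rightarrow> real^'k^'m)"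
proof
  show "\<exists>K. \<forall>(a :: real^'n^'m) (b :: real^'k^'n). norm (a ** b) \<le> norm a * norm b * K"
    by (rule exI[of _ 1]) (simp add: norm_matrix_matrix_le)
qed (simp_all add: matrix_matrix_mult_def vec_eq_iff sum.distrib algebra_simps
      scaleR_sum_right sum_distrib_left)

lemma bounded_linear_transpose: "bounded_linear (transpose :: real^'n^'m \<Rightarrow> real^'m^'n)"
  by (rule bounded_linear_intro[where K=1]) (simp_all, simp_all add: transpose_def vec_eq_iff)

lemmas continuous_on_matrix_vector [continuous_intros] =
  bounded_bilinear.continuous_on[OF bounded_bilinear_matrix_vector]

lemmas continuous_on_matrix_matrix [continuous_intros] =
  bounded_bilinear.continuous_on[OF bounded_bilinear_matrix_matrix]

lemmas continuous_on_transpose [continuous_intros] =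
  bounded_linear.continuous_on[OF bounded_linear_transpose]

lemma measurable_matrix_vector [measurable]:
  fixes f :: "'a \<Rightarrow> real^'n^'m"
  assumes "f \<in> borel_measurable N" "g \<in> borel_measurable N"
  shows "(\<lambda>x. f x *v g x) \<in> borel_measurable N"
  using assms by (rule borel_measurable_continuous_Pair) (intro continuous_intros)

lemma measurable_matrix_matrix [measurable]:
  fixes f :: "'a \<Rightarrow> real^'n^'m" and g :: "'a \<Rightarrow> real^'k^'n"
  assumes "f \<in> borel_measurable N" "g \<in> borel_measurable N"
  shows "(\<lambda>x. f x ** g x) \<in> borel_measurable N"
  using assms by (rule borel_measurable_continuous_Pair) (intro continuous_intros)

lemma measurable_transpose [measurable]:
  fixes f :: "'a \<Rightarrow> real^'n^'m"
  assumes "f \<in> borel_measurable N"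
  shows "(\<lambda>x. transpose (f x)) \<in> borel_measurable N"
  using assms
  by (rule measurable_compose[OF _ borel_measurable_continuous_onI])
    (intro linear_continuous_on bounded_linear_transpose)

lemma continuous_on_det:
  fixes A :: "'a::topological_space \<Rightarrow> real^'n^'n"
  assumes "continuous_on S A"
  shows "continuous_on S (\<lambda>t. det (A t))"
  unfolding det_def using assms by (intro continuous_intros) auto

lemma
  assumes "invertible A"
  shows matrix_inv_right: "A ** matrix_inv A = mat 1"
    and matrix_inv_left: "matrix_inv A ** A = mat 1"
  using assms someI_ex[of "\<lambda>A'. A ** A' = mat 1 \<and> A' ** A = mat 1"]
  by (auto simp: invertible_def matrix_inv_def)

text \<open>By Cramer's rule the entries of the inverse are quotients of determinants, hence of
  polynomials in the entries of \<open>A t\<close>.\<close>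

lemma continuous_on_matrix_inv:
  fixes A :: "'a::topological_space \<Rightarrow> real^'n^'n"
  assumes A: "continuous_on S A" and inv: "\<And>t. t \<in> S \<Longrightarrow> invertible (A t)"
  shows "continuous_on S (\<lambda>t. matrix_inv (A t))"
proof -
  let ?D = "\<lambda>t k l. det (\<chi> i j. if j = k then axis l 1 $ i else A t $ i $ j)"
  have eq: "matrix_inv (A t) = (\<chi> k l. ?D t k l / det (A t))" if "t \<in> S" for t
  proof -
    have "A t *v (matrix_inv (A t) *v axis l 1) = axis l 1" for l
      by (simp add: matrix_vector_mul_assoc matrix_inv_right inv that)
    then have "matrix_inv (A t) *v axis l 1 = (\<chi> k. ?D t k l / det (A t))" for l
      using cramer[of "A t" "matrix_inv (A t) *v axis l 1" "axis l 1"] inv[OF that]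
      by (simp add: invertible_det_nz)
    then have "(matrix_inv (A t) *v axis l 1) $ k = ?D t k l / det (A t)" for l k
      by simp
    then show ?thesis
      by (simp add: vec_eq_iff matrix_vector_mul_component inner_axis)
  qed
  have "continuous_on S (\<lambda>t. (\<chi> i j. if j = k then axis l 1 $ i else A t $ i $ j))" for k l
  proof (intro continuous_on_vec_lambda)
    show "continuous_on S (\<lambda>t. if j = k then axis l 1 $ i else A t $ i $ j)" for i j
      by (cases "j = k") (auto intro!: continuous_intros A)
  qed
  then have "continuous_on S (\<lambda>t. ?D t k l)" for k l
    by (rule continuous_on_det)
  then have "continuous_on S (\<lambda>t. (\<chi> k l. ?D t k l / det (A t)))"
    by (intro continuous_on_vec_lambda continuous_on_divide continuous_on_det[OF A])
      (use inv in \<open>auto simp: invertible_det_nz\<close>)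
  then show ?thesis
    by (rule continuous_on_cong[THEN iffD1, rotated 2]) (simp_all add: eq)
qed

section \<open>Integrals over subintervals\<close>

lemma integrable_lebesgue_on_subinterval:
  fixes f :: "real \<Rightarrow> 'b::{banach, second_countable_topology}"
  assumes "integrable (lebesgue_on {0..T}) f" "0 \<le> s" "t \<le> T"
  shows "integrable (lebesgue_on {s..t}) f"
proof -
  have "integrable lebesgue (\<lambda>x. indicator {s..t} x *\<^sub>R (indicator {0..T} x *\<^sub>R f x))"
    using assms(1) integrable_restrict_space[of "{0..T}" lebesgue f]
    by (intro integrable_mult_indicator[of "{s..t}"]) auto
  also have "(\<lambda>x. indicator {s..t} x *\<^sub>R (indicator {0..T} x *\<^sub>R f x)) = (\<lambda>x. indicator {s..t} x *\<^sub>R f x)"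
    using assms(2,3) by (auto simp: indicator_def)
  finally show ?thesis
    by (subst integrable_restrict_space) auto
qed

lemma integral_lebesgue_on_diff:
  fixes f :: "real \<Rightarrow> 'b::euclidean_space"
  assumes f: "integrable (lebesgue_on {0..T}) f" and st: "0 \<le> s" "s \<le> t" "t \<le> T"
  shows "(LINT r|lebesgue_on {0..t}. f r) - (LINT r|lebesgue_on {0..s}. f r)
    = (LINT r|lebesgue_on {s..t}. f r)"
proof -
  note i = integrable_lebesgue_on_subinterval[OF f]
  have "integral {0..s} f + integral {s..t} f = integral {0..t} f"
    using st i[of 0 t] by (intro Henstock_Kurzweil_Integration.integral_combine integrable_on_lebesgue_on) auto
  then show ?thesis
    using st by (simp add: lebesgue_integral_eq_integral i algebra_simps)
qed

lemma continuous_on_integral_lebesgue_on: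
  fixes f :: "real \<Rightarrow> 'b::euclidean_space"
  assumes f: "integrable (lebesgue_on {0..T}) f"
  shows "continuous_on {0..T} (\<lambda>t. LINT r|lebesgue_on {0..t}. f r)"
proof -
  have "continuous_on {0..T} (\<lambda>t. integral {0..t} f)"
    by (intro indefinite_integral_continuous_1 integrable_on_lebesgue_on f) simp
  then show ?thesis
    by (rule continuous_on_cong[THEN iffD1, rotated 2])
      (auto simp: lebesgue_integral_eq_integral integrable_lebesgue_on_subinterval[OF f])
qed

lemma norm_integral_mult_le:
  fixes g :: "real \<Rightarrow> 'b::euclidean_space"
  assumes a: "integrable (lebesgue_on S) a" and g: "integrable (lebesgue_on S) g"
    and le: "\<And>r. r \<in> S \<Longrightarrow> norm (g r) \<le> a r * C"
  shows "norm (LINT r|lebesgue_on S. g r) \<le> (LINT r|lebesgue_on S. a r) * C"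
proof -
  have "norm (LINT r|lebesgue_on S. g r) \<le> (LINT r|lebesgue_on S. norm (g r))"
    by (rule integral_norm_bound)
  also have "\<dots> \<le> (LINT r|lebesgue_on S. a r * C)"
    using a g le by (intro integral_mono) auto
  finally show ?thesis by simp
qed

section \<open>The fundamental solution \<open>Y\<close> and its inverse \<open>R\<close>\<close>

locale linear_ode =
  fixes T :: real and b :: "real \<Rightarrow> real^'m^'m" and Y :: "real \<Rightarrow> real^'m^'m"
  assumes T: "T > 0"
    and b [measurable]: "b \<in> borel_measurable (lebesgue_on {0..T})"
    and norm_b: "integrable (lebesgue_on {0..T}) (\<lambda>t. norm (b t))"
    and Y: "solves_linear_matrix_ode T b Y"
begin

abbreviation "R t \<equiv> matrix_inv (Y t)"

lemma integrable_bY: "integrable (lebesgue_on {0..T}) (\<lambda>s. b s ** Y s)"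
  using Y by (simp add: solves_linear_matrix_ode_def)

lemma Y_eq: "t \<in> {0..T} \<Longrightarrow> Y t = mat 1 + (LINT s|lebesgue_on {0..t}. b s ** Y s)"
  using Y by (simp add: solves_linear_matrix_ode_def)

lemma Y_0: "Y 0 = mat 1"
  using Y_eq[of 0] T integrable_lebesgue_on_subinterval[OF integrable_bY, of 0 0]
  by (simp add: lebesgue_integral_eq_integral)

lemma Y_diff:
  assumes "0 \<le> s" "s \<le> t" "t \<le> T"
  shows "Y t - Y s = (LINT r|lebesgue_on {s..t}. b r ** Y r)"
  using integral_lebesgue_on_diff[OF integrable_bY assms] assms by (simp add: Y_eq)

lemma continuous_Y: "continuous_on {0..T} Y"
proof -
  have "continuous_on {0..T} (\<lambda>t. mat 1 + (LINT s|lebesgue_on {0..t}. b s ** Y s))"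
    by (intro continuous_intros continuous_on_integral_lebesgue_on integrable_bY)
  then show ?thesis
    by (rule continuous_on_cong[THEN iffD1, rotated 2]) (simp_all flip: Y_eq)
qed

lemmas integrable_norm_b = integrable_lebesgue_on_subinterval[OF norm_b]

text \<open>The indefinite integral of \<open>norm (b t)\<close> is continuous on a compact
  interval, hence uniformly continuous. The resulting \<delta> is independent of the position of the
  interval.\<close>

lemma norm_b_small:
  assumes "\<epsilon> > 0"
  obtains \<delta> where "\<delta> > 0"
    "\<And>s t. 0 \<le> s \<Longrightarrow> s \<le> t \<Longrightarrow> t \<le> T \<Longrightarrow> t - s < \<delta> \<Longrightarrow> (LINT r|lebesgue_on {s..t}. norm (b r)) < \<epsilon>"
proof -
  have "uniformly_continuous_on {0..T} (\<lambda>t. LINT r|lebesgue_on {0..t}. norm (b r))"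
    by (intro compact_uniformly_continuous continuous_on_integral_lebesgue_on norm_b) simp
  then obtain \<delta> where \<delta>: "\<delta> > 0" "\<And>s t. s \<in> {0..T} \<Longrightarrow> t \<in> {0..T} \<Longrightarrow> dist t s < \<delta> \<Longrightarrow>
     dist (LINT r|lebesgue_on {0..t}. norm (b r)) (LINT r|lebesgue_on {0..s}. norm (b r)) < \<epsilon>"
    using assms unfolding uniformly_continuous_on_def by metis
  show thesis
  proof (rule that[OF \<delta>(1)])
    fix s t assume st: "0 \<le> s" "s \<le> t" "t \<le> T" "t - s < \<delta>"
    then show "(LINT r|lebesgue_on {s..t}. norm (b r)) < \<epsilon>"
      using \<delta>(2)[of s t] integral_lebesgue_on_diff[OF norm_b, of s t]
      by (simp add: dist_real_def)
  qed
qed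

lemma integrable_bY_mult:
  assumes "0 \<le> s" "t \<le> T"
  shows "integrable (lebesgue_on {s..t}) (\<lambda>r. b r *v (Y r *v v))"
  using integrable_bounded_linear[OF bounded_bilinear.bounded_linear_left[OF bounded_bilinear_matrix_vector]
      integrable_lebesgue_on_subinterval[OF integrable_bY assms], of v]
  by (simp add: matrix_vector_mul_assoc)

lemma Y_diff_mult:
  assumes "0 \<le> s" "s \<le> t" "t \<le> T"
  shows "Y t *v v - Y s *v v = (LINT r|lebesgue_on {s..t}. b r *v (Y r *v v))"
  using integral_bounded_linear[OF bounded_bilinear.bounded_linear_left[OF bounded_bilinear_matrix_vector]
      integrable_lebesgue_on_subinterval[OF integrable_bY assms(1,3)], of v] Y_diff[OF assms]
  by (simp add: matrix_vector_mul_assoc flip: matrix_vector_mult_diff_rdistrib)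

text \<open>Gronwall, backwards in time: a solution vanishing at \<open>t\<close> vanishes on a
  left neighbourhood of \<open>t\<close> whose length does not depend on \<open>t\<close>, hence at \<open>0\<close>.\<close>

lemma Y_mult_eq_0:
  assumes t: "t \<in> {0..T}" and Yt: "Y t *v v = 0"
  shows "v = 0"
proof -
  obtain \<delta> where \<delta>: "\<delta> > 0" "\<And>s t. 0 \<le> s \<Longrightarrow> s \<le> t \<Longrightarrow> t \<le> T \<Longrightarrow> t - s < \<delta> \<Longrightarrow>
      (LINT r|lebesgue_on {s..t}. norm (b r)) < 1/2"
    using norm_b_small[of "1/2"] by auto
  \<comment> \<open>At a maximum point \<open>u\<close> of \<open>norm (Y r *v v)\<close> on
    \<open>{s..c}\<close>, the integral equation from \<open>u\<close> to \<open>c\<close> and the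
    zero at \<open>c\<close> bound the maximum by half of itself.\<close>
  have step: "Y s *v v = 0"
    if c: "c \<in> {0..T}" "Y c *v v = 0" and s: "0 \<le> s" "s \<le> c" "c - s < \<delta>" for s c
  proof -
    have "continuous_on {s..c} (\<lambda>r. norm (Y r *v v))"
      using c s by (intro continuous_intros continuous_on_subset[OF continuous_Y]) auto
    moreover have "{s..c} \<noteq> {}"
      using s by simp
    ultimately obtain u where u: "u \<in> {s..c}" "\<And>r. r \<in> {s..c} \<Longrightarrow> norm (Y r *v v) \<le> norm (Y u *v v)"
      using continuous_attains_sup[OF compact_Icc] by blast
    have "norm (Y u *v v) = norm (LINT r|lebesgue_on {u..c}. b r *v (Y r *v v))"
      using Y_diff_mult[of u c v] c s(1) u(1) by (simp flip: norm_minus_cancel[of "Y u *v v"])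
    also have "\<dots> \<le> (LINT r|lebesgue_on {u..c}. norm (b r)) * norm (Y u *v v)"
      using u(1) c s by (intro norm_integral_mult_le integrable_norm_b integrable_bY_mult
          order_trans[OF norm_matrix_vector_le mult_left_mono[OF u(2)]]) auto
    also have "\<dots> \<le> 1/2 * norm (Y u *v v)"
      using \<delta>(2)[of u c] u c s by (intro mult_right_mono) auto
    finally have "norm (Y u *v v) \<le> 0" by simp
    then show ?thesis using u(2)[of s] s by simp
  qed
  \<comment> \<open>Steps of length \<open>\<delta>/2\<close> stay strictly below the length
    \<delta> that \<open>step\<close> allows; the maximum with \<open>0\<close> makes the walk stop
    at the left end point.\<close>
  have "Y (max 0 (t - real n * (\<delta>/2))) *v v = 0" for n
  proof (induction n)
    case 0
    then show ?case using t Yt by simp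
  next
    case (Suc n)
    show ?case
    proof (rule step[OF _ Suc])
      have "0 \<le> real n * (\<delta>/2)"
        using \<delta>(1) by simp
      then show "max 0 (t - real n * (\<delta>/2)) \<in> {0..T}"
        using t T unfolding atLeastAtMost_iff by linarith
    qed (use \<delta>(1) in \<open>auto simp: max_def algebra_simps\<close>)
  qed
  moreover obtain n where "real n * (\<delta>/2) > t"
    using reals_Archimedean3[of "\<delta>/2"] \<delta>(1) by auto
  ultimately show ?thesis
    using Y_0 by (metis diff_le_0_iff_le less_imp_le max.absorb1 matrix_vector_mul_lid)
qed

lemma invertible_Y:
  assumes "t \<in> {0..T}" shows "invertible (Y t)"
  using Y_mult_eq_0[OF assms] by (auto simp: invertible_left_inverse matrix_left_invertible_ker)

lemma continuous_R: "continuous_on {0..T} R"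
  by (intro continuous_on_matrix_inv continuous_Y invertible_Y)

lemma bounded_on:
  fixes f :: "real \<Rightarrow> 'b::real_normed_vector"
  assumes "continuous_on {0..T} f"
  obtains K where "K > 0" "\<And>t. t \<in> {0..T} \<Longrightarrow> norm (f t) \<le> K"
  using compact_imp_bounded[OF compact_continuous_image[OF assms compact_Icc]]
  unfolding bounded_pos by auto

lemma RY: "t \<in> {0..T} \<Longrightarrow> R t *v (Y t *v x) = x"
  and YR: "t \<in> {0..T} \<Longrightarrow> Y t *v (R t *v x) = x"
  by (simp_all add: matrix_vector_mul_assoc matrix_inv_left matrix_inv_right invertible_Y)

text \<open>The resolvent identity for inverses: increments of \<open>R\<close> are controlled by
  those of \<open>Y\<close>, without an equation for \<open>R\<close>.\<close>

lemma R_diff: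
  assumes "s \<in> {0..T}" "t \<in> {0..T}"
  shows "R t *v x - R s *v x = - (R t *v (Y t *v (R s *v x) - Y s *v (R s *v x)))"
  using RY[OF assms(2)] YR[OF assms(1)] by (simp add: matrix_vector_mult_diff_distrib)

abbreviation "grid n i \<equiv> T * real i / real n"

text \<open>Holds for \<open>n = 0\<close> as well, where division by zero puts the only grid point
  at \<open>0\<close>.\<close>

lemma grid_mem: "i \<le> n \<Longrightarrow> grid n i \<in> {0..T}"
  using T by (cases "n = 0") (auto simp: field_simps)

lemma grid_Suc: "grid n (Suc i) = grid n i + T / real n"
  by (simp add: field_simps add_divide_distrib)

lemma grid_le_Suc: "grid n i \<le> grid n (Suc i)"
  using T by (simp add: divide_right_mono)

text \<open>The equation is compared, on each interval of the grid, with the solution \<open>Y R x\<close> of the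
  homogeneous equation that has the same value at the left end point.\<close>

lemma discrete_variation_of_constants:
  fixes x :: "real \<Rightarrow> real^'m"
  defines "N \<equiv> \<lambda>t. x t - x 0 - (LINT s|lebesgue_on {0..t}. b s *v x s)"
  assumes x: "continuous_on {0..T} x" and bx: "integrable (lebesgue_on {0..T}) (\<lambda>s. b s *v x s)"
  shows "(\<lambda>n. \<Sum>i<n. R (grid n (Suc i)) *v (N (grid n (Suc i)) - N (grid n i)))
    \<longlonglongrightarrow> R T *v x T - x 0"
proof -
  \<comment> \<open>\<open>h (s, r)\<close> is the error at time \<open>r\<close> of the homogeneous
    solution started from \<open>x s\<close> at time \<open>s\<close>. It vanishes on the diagonal
    and is uniformly continuous on the square, so it is uniformly small on fine grids.\<close>
  define h where "h = (\<lambda>(s, r). x r - Y r *v (R s *v x s))"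
  define \<beta> where "\<beta> = (LINT r|lebesgue_on {0..T}. norm (b r))"
  obtain K where K: "K > 0" "\<And>t. t \<in> {0..T} \<Longrightarrow> norm (R t) \<le> K"
    using bounded_on[OF continuous_R] by blast
  have \<beta>: "\<beta> \<ge> 0"
    by (simp add: \<beta>_def)
  have diag: "h (s, s) = 0" if "s \<in> {0..T}" for s
    using that by (simp add: h_def YR)
  have cont: "continuous_on ({0..T} \<times> {0..T}) (\<lambda>p. f (fst p))"
    "continuous_on ({0..T} \<times> {0..T}) (\<lambda>p. f (snd p))"
    if "continuous_on {0..T} f" for f :: "real \<Rightarrow> 'b::metric_space"
    by (rule continuous_on_compose2[OF that]; auto intro!: continuous_intros)+
  have "continuous_on ({0..T} \<times> {0..T}) h"
    unfolding h_def case_prod_unfold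
    by (intro continuous_intros cont x continuous_Y continuous_R)
  then have unif: "uniformly_continuous_on ({0..T} \<times> {0..T}) h"
    by (intro compact_uniformly_continuous compact_Times) auto
  \<comment> \<open>An exact identity on one interval: an increment of \<open>R x\<close> differs
    from the weighted increment of \<open>N\<close> only by an integral of \<open>b\<close> against
    \<open>h\<close>, the product of two small quantities.\<close>
  have term_eq: "(R t *v x t - R s *v x s) - R t *v (N t - N s)
      = R t *v (LINT r|lebesgue_on {s..t}. b r *v h (s, r))"
    if st: "0 \<le> s" "s \<le> t" "t \<le> T" for s t
  proof -
    have "N t - N s = x t - x s - (LINT r|lebesgue_on {s..t}. b r *v x r)"
      using integral_lebesgue_on_diff[OF bx st] by (simp add: N_def algebra_simps)
    moreover have "R t *v x s - R s *v x s
        = - (R t *v (LINT r|lebesgue_on {s..t}. b r *v (Y r *v (R s *v x s))))"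
      using R_diff[of s t "x s"] Y_diff_mult[OF st, of "R s *v x s"] st by simp
    moreover have "(LINT r|lebesgue_on {s..t}. b r *v h (s, r)) = (LINT r|lebesgue_on {s..t}. b r *v x r)
        - (LINT r|lebesgue_on {s..t}. b r *v (Y r *v (R s *v x s)))"
      using st by (simp add: h_def matrix_vector_mult_diff_distrib integrable_bY_mult
          integrable_lebesgue_on_subinterval[OF bx])
    ultimately show ?thesis
      by (simp only: matrix_vector_mult_diff_distrib) (simp add: algebra_simps)
  qed
  show ?thesis
  proof (rule LIMSEQ_I)
    fix e :: real assume e: "e > 0"
    \<comment> \<open>The total error is at most \<open>K * \<epsilon> * \<beta>\<close>; the
      summand \<open>1\<close> keeps the quotient meaningful when \<beta> is \<open>0\<close> and
      makes the final bound strict.\<close>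
    define \<epsilon> where "\<epsilon> = e / (K * \<beta> + 1)"
    have \<epsilon>: "\<epsilon> > 0"
      using e K(1) \<beta> by (auto simp: \<epsilon>_def intro!: divide_pos_pos add_nonneg_pos)
    obtain \<delta> where \<delta>: "\<delta> > 0"
      "\<And>p q. p \<in> {0..T} \<times> {0..T} \<Longrightarrow> q \<in> {0..T} \<times> {0..T} \<Longrightarrow> dist q p < \<delta> \<Longrightarrow> dist (h q) (h p) < \<epsilon>"
      using unif \<epsilon> unfolding uniformly_continuous_on_def by metis
    obtain n0 where n0: "T / \<delta> < real n0"
      using reals_Archimedean2 by blast
    have "norm ((\<Sum>i<n. R (grid n (Suc i)) *v (N (grid n (Suc i)) - N (grid n i)))
        - (R T *v x T - x 0)) < e" if n: "n \<ge> max 1 n0" for n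
    proof -
      have "T / \<delta> < real n"
        using n0 n by (meson less_le_trans max.boundedE of_nat_mono)
      then have mesh: "T / real n < \<delta>"
        using \<delta>(1) n by (simp add: field_simps)
      have n1: "n > 0" using n by simp
      have Rt: "R T *v x T - x 0
          = (\<Sum>i<n. R (grid n (Suc i)) *v x (grid n (Suc i)) - R (grid n i) *v x (grid n i))"
        using n1 RY[of 0 "x 0"] T
        by (subst sum_lessThan_telescope) (simp add: Y_0)
      have "norm ((\<Sum>i<n. R (grid n (Suc i)) *v (N (grid n (Suc i)) - N (grid n i))) - (R T *v x T - x 0))
          = norm (\<Sum>i<n. R (grid n (Suc i)) *v
              (LINT r|lebesgue_on {grid n i..grid n (Suc i)}. b r *v h (grid n i, r)))"
        unfolding Rt
        using grid_mem[of _ n] grid_le_Suc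
        by (subst norm_minus_commute, subst sum_subtractf[symmetric])
          (intro arg_cong[where f=norm] sum.cong refl term_eq, auto simp del: of_nat_Suc)
      also have "\<dots> \<le> (\<Sum>i<n. K * ((LINT r|lebesgue_on {grid n i..grid n (Suc i)}. norm (b r)) * \<epsilon>))"
      proof (rule sum_norm_le)
        fix i assume i: "i \<in> {..<n}"
        let ?s = "grid n i" and ?t = "grid n (Suc i)"
        have st: "?s \<in> {0..T}" "?t \<in> {0..T}" "?s \<le> ?t"
          using grid_mem[of i n] grid_mem[of "Suc i" n] i grid_le_Suc by (auto simp del: of_nat_Suc)
        have "norm (LINT r|lebesgue_on {?s..?t}. b r *v h (?s, r))
            \<le> (LINT r|lebesgue_on {?s..?t}. norm (b r)) * \<epsilon>"
        proof (rule norm_integral_mult_le)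
          show "integrable (lebesgue_on {?s..?t}) (\<lambda>r. norm (b r))"
            using st by (intro integrable_norm_b) auto
          show "integrable (lebesgue_on {?s..?t}) (\<lambda>r. b r *v h (?s, r))"
            using st integrable_lebesgue_on_subinterval[OF bx, of ?s ?t] integrable_bY_mult[of ?s ?t]
            by (simp add: h_def matrix_vector_mult_diff_distrib del: of_nat_Suc)
          fix r assume r: "r \<in> {?s..?t}"
          have "\<bar>r - ?s\<bar> < \<delta>"
            using r mesh grid_Suc[of i n] unfolding atLeastAtMost_iff by linarith
          then have "dist (?s, r) (?s, ?s) < \<delta>"
            by (simp add: dist_Pair_Pair dist_real_def)
          then have "dist (h (?s, r)) (h (?s, ?s)) < \<epsilon>"
            using st r by (intro \<delta>(2)) auto
          then have "norm (h (?s, r)) \<le> \<epsilon>"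
            by (simp add: diag[OF st(1)])
          then show "norm (b r *v h (?s, r)) \<le> norm (b r) * \<epsilon>"
            by (intro order_trans[OF norm_matrix_vector_le mult_left_mono]) auto
        qed
        then show "norm (R ?t *v (LINT r|lebesgue_on {?s..?t}. b r *v h (?s, r)))
            \<le> K * ((LINT r|lebesgue_on {?s..?t}. norm (b r)) * \<epsilon>)"
          using K st by (intro order_trans[OF norm_matrix_vector_le mult_mono]) auto
      qed
      also have "\<dots> = K * \<epsilon> * (\<Sum>i<n. (LINT r|lebesgue_on {grid n i..grid n (Suc i)}. norm (b r)))"
        by (simp add: sum_distrib_left algebra_simps)
      also have "(\<Sum>i<n. (LINT r|lebesgue_on {grid n i..grid n (Suc i)}. norm (b r)))
        = (\<Sum>i<n. (LINT r|lebesgue_on {0..grid n (Suc i)}. norm (b r)) - (LINT r|lebesgue_on {0..grid n i}. norm (b r)))"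
        using grid_mem[of _ n] grid_le_Suc
        by (intro sum.cong refl integral_lebesgue_on_diff[OF norm_b, symmetric]) (auto simp del: of_nat_Suc)
      also have "\<dots> = \<beta>"
        using n1 integrable_norm_b[of 0 0] T
        by (subst sum_lessThan_telescope) (simp add: \<beta>_def lebesgue_integral_eq_integral)
      also have "K * \<epsilon> * \<beta> < e"
      proof -
        have "0 < K * \<beta> + 1"
          using K(1) \<beta> by (intro add_nonneg_pos) auto
        then show ?thesis
          using e by (simp add: \<epsilon>_def pos_divide_less_eq algebra_simps)
      qed
      finally show ?thesis .
    qed
    then show "\<exists>no. \<forall>n\<ge>no. norm ((\<Sum>i<n. R (grid n (Suc i)) *v (N (grid n (Suc i)) - N (grid n i)))
        - (R T *v x T - x 0)) < e"
      by blast
  qed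
qed

end

section \<open>Characteristic functions on Euclidean spaces\<close>

lemma integral_lborel_prod:
  fixes f :: "'a::euclidean_space \<Rightarrow> real \<Rightarrow> 'b::{real_normed_field, banach, second_countable_topology}"
  assumes f: "\<And>b. b \<in> Basis \<Longrightarrow> integrable lborel (f b)"
  shows "integrable lborel (\<lambda>x. \<Prod>b\<in>Basis. f b (x \<bullet> b))"
    and "(\<integral>x. (\<Prod>b\<in>Basis. f b (x \<bullet> b)) \<partial>lborel) = (\<Prod>b\<in>Basis. \<integral>x. f b x \<partial>lborel)"
proof -
  interpret product_sigma_finite "\<lambda>_::'a. lborel :: real measure" ..
  have [measurable]: "f b \<in> borel_measurable borel" if "b \<in> Basis" for b
    using borel_measurable_integrable[OF f[OF that]] by simp
  have [measurable]: "(\<lambda>x::'a. \<Prod>b\<in>Basis. f b (x \<bullet> b)) \<in> borel_measurable borel"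
    by (intro borel_measurable_prod) measurable
  have eq: "(\<Prod>b\<in>Basis. f b ((\<Sum>c\<in>Basis. x c *\<^sub>R c) \<bullet> b)) = (\<Prod>b\<in>Basis. f b (x b))" for x
    by (intro prod.cong refl) simp
  show "integrable lborel (\<lambda>x. \<Prod>b\<in>Basis. f b (x \<bullet> b))"
    by (subst lborel_eq, subst integrable_distr_eq) (simp_all add: eq product_integrable_prod f)
  show "(\<integral>x. (\<Prod>b\<in>Basis. f b (x \<bullet> b)) \<partial>lborel) = (\<Prod>b\<in>Basis. \<integral>x. f b x \<partial>lborel)"
    by (subst lborel_eq, subst integral_distr) (simp_all add: eq product_integral_prod f)
qed

section \<open>The standard Gaussian measure and its characteristic function\<close>

definition gauss_density :: "real \<Rightarrow> 'a::euclidean_space \<Rightarrow> real" where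
  "gauss_density s x = (\<Prod>b\<in>Basis. normal_density 0 s (x \<bullet> b))"

lemma gauss_density_nonneg [simp]: "0 \<le> gauss_density s x"
  by (simp add: gauss_density_def prod_nonneg)

lemma measurable_gauss_density [measurable]: "gauss_density s \<in> borel_measurable borel"
  unfolding gauss_density_def[abs_def] by measurable

lemma gauss_density_eq:
  "gauss_density 1 (x::'a::euclidean_space) = (1 / sqrt (2 * pi)) ^ DIM('a) * exp (- (norm x)\<^sup>2 / 2)"
proof -
  have "(norm x)\<^sup>2 = (\<Sum>b\<in>Basis. (x \<bullet> b)\<^sup>2)"
    unfolding power2_norm_eq_inner by (subst euclidean_inner) (simp add: power2_eq_square)
  then have "(\<Sum>b\<in>Basis. - (x \<bullet> b)\<^sup>2 / 2) = - (norm x)\<^sup>2 / 2"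
    by (simp only: sum_negf flip: sum_divide_distrib)
  then show ?thesis
    unfolding gauss_density_def std_normal_density_def prod.distrib
    by (simp only: prod_constant flip: exp_sum[OF finite_Basis])
qed

lemma measurable_cis [measurable]: "cis \<in> borel_measurable borel"
  by (intro borel_measurable_continuous_onI continuous_intros)

text \<open>Scaling by \<open>s\<close> reduces this to the known characteristic function of the
  standard normal distribution.\<close>

lemma integral_normal_density_cis:
  assumes s: "s > 0"
  shows "integrable lborel (\<lambda>x. complex_of_real (normal_density 0 s x) * cis (t * x))"
    and "(\<integral>x. complex_of_real (normal_density 0 s x) * cis (t * x) \<partial>lborel)
      = complex_of_real (exp (- (s * t)\<^sup>2 / 2))"
proof -
  let ?f = "\<lambda>x. complex_of_real (normal_density 0 s x) * cis (t * x)"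
  show "integrable lborel ?f"
    by (rule Bochner_Integration.integrable_bound[of _ "normal_density 0 s"])
      (use s in \<open>simp_all add: norm_mult\<close>)
  have "(\<integral>x. ?f x \<partial>lborel) = s *\<^sub>R (\<integral>x. ?f (0 + s * x) \<partial>lborel)"
    using lborel_integral_real_affine[of s ?f 0] s by simp
  also have "\<dots> = (\<integral>x. s *\<^sub>R ?f (0 + s * x) \<partial>lborel)"
    by simp
  also have "\<dots> = (\<integral>x. std_normal_density x *\<^sub>R iexp ((s * t) * x) \<partial>lborel)"
    using s by (intro Bochner_Integration.integral_cong refl)
      (simp add: normal_density_def cis_conv_exp scaleR_conv_of_real real_sqrt_mult power_mult_distrib
        mult_ac)
  also have "\<dots> = char std_normal_distribution (s * t)"
    unfolding char_def by (subst integral_density) auto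
  finally show "(\<integral>x. ?f x \<partial>lborel) = complex_of_real (exp (- (s * t)\<^sup>2 / 2))"
    by (simp add: char_std_normal_distribution)
qed

lemma cis_sum: "finite A \<Longrightarrow> cis (\<Sum>i\<in>A. f i) = (\<Prod>i\<in>A. cis (f i))"
  by (induction A rule: finite_induct) (auto simp flip: cis_mult)

lemma integral_gauss_density_cis:
  fixes \<theta> :: "'a::euclidean_space"
  assumes s: "s > 0"
  shows "integrable lborel (\<lambda>x. complex_of_real (gauss_density s x) * cis (\<theta> \<bullet> x))"
    and "(\<integral>x. complex_of_real (gauss_density s x) * cis (\<theta> \<bullet> x) \<partial>lborel)
      = complex_of_real (exp (- (s * norm \<theta>)\<^sup>2 / 2))"
proof -
  have eq: "complex_of_real (gauss_density s x) * cis (\<theta> \<bullet> x)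
      = (\<Prod>b\<in>Basis. complex_of_real (normal_density 0 s (x \<bullet> b)) * cis ((\<theta> \<bullet> b) * (x \<bullet> b)))" for x
    by (subst euclidean_inner[of \<theta>]) (simp add: gauss_density_def cis_sum prod.distrib)
  note i = integral_normal_density_cis[OF s]
  show "integrable lborel (\<lambda>x. complex_of_real (gauss_density s x) * cis (\<theta> \<bullet> x))"
    unfolding eq by (intro integral_lborel_prod(1) i)
  have "(norm \<theta>)\<^sup>2 = (\<Sum>b\<in>Basis. (\<theta> \<bullet> b)\<^sup>2)"
    unfolding power2_norm_eq_inner by (subst euclidean_inner) (simp add: power2_eq_square)
  then show "(\<integral>x. complex_of_real (gauss_density s x) * cis (\<theta> \<bullet> x) \<partial>lborel)
      = complex_of_real (exp (- (s * norm \<theta>)\<^sup>2 / 2))"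
    unfolding eq by (subst integral_lborel_prod(2)[OF i(1)])
      (simp add: i(2) power_mult_distrib sum_distrib_left sum_divide_distrib flip: of_real_prod exp_sum sum_negf)
qed

definition gauss_measure :: "'a::euclidean_space measure" where
  "gauss_measure = density lborel (\<lambda>x. ennreal (gauss_density 1 x))"

lemma sets_gauss_measure [simp, measurable_cong]: "sets gauss_measure = sets borel"
  and space_gauss_measure [simp]: "space gauss_measure = UNIV"
  by (simp_all add: gauss_measure_def)

lemma integral_gauss_measure_cis:
  "(\<integral>x. cis (\<theta> \<bullet> x) \<partial>gauss_measure) = complex_of_real (exp (- (norm \<theta>)\<^sup>2 / 2))"
  using integral_gauss_density_cis(2)[of 1 \<theta>]
  by (simp add: gauss_measure_def integral_density scaleR_conv_of_real)

lemma prob_space_gauss_measure: "prob_space (gauss_measure :: 'a::euclidean_space measure)"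
proof
  \<comment> \<open>Integrability and total mass are read off from the characteristic function at
    \<open>0\<close>.\<close>
  have i: "integrable lborel (gauss_density 1 :: 'a \<Rightarrow> real)"
    using integral_gauss_density_cis(1)[of 1 "0::'a"] by (simp add: complex_of_real_integrable_eq)
  have "complex_of_real (\<integral>x. gauss_density 1 x \<partial>(lborel :: 'a measure)) = 1"
    using integral_gauss_density_cis(2)[of 1 "0::'a"] by simp
  then have "(\<integral>x. gauss_density 1 x \<partial>(lborel :: 'a measure)) = 1"
    by (simp only: of_real_eq_1_iff)
  then show "emeasure gauss_measure (space gauss_measure :: 'a set) = 1"
    using i by (simp add: gauss_measure_def emeasure_density nn_integral_eq_integral)
qed

section \<open>Gaussian smoothing and uniqueness of characteristic functions\<close>

lemma nn_integral_gauss_shift: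
  fixes f :: "'a::euclidean_space \<Rightarrow> ennreal"
  assumes [measurable]: "f \<in> borel_measurable borel" and s: "s > 0"
  shows "(\<integral>\<^sup>+z. f (x + s *\<^sub>R z) \<partial>gauss_measure)
    = (\<integral>\<^sup>+w. ennreal ((1 / (s * sqrt (2 * pi))) ^ DIM('a)) * f w
        * ennreal (exp (- (norm ((w - x) /\<^sub>R s))\<^sup>2 / 2)) \<partial>lborel)"
proof -
  let ?F = "\<lambda>w. ennreal ((1 / (s * sqrt (2 * pi))) ^ DIM('a)) * f w * ennreal (exp (- (norm ((w - x) /\<^sub>R s))\<^sup>2 / 2))"
  have [simp]: "inverse s * (s * r) = r" for r
    using s by simp
  \<comment> \<open>Substitution of \<open>w = x + s *\<^sub>R z\<close>. In the new form
    \<open>f\<close> is evaluated at \<open>w\<close> alone and the base point \<open>x\<close>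
    survives only in the exponential, which can later be integrated over \<open>x\<close>
    separately.\<close>
  have "(\<integral>\<^sup>+w. ?F w \<partial>lborel) = (\<integral>\<^sup>+z. ennreal (s ^ DIM('a)) * ?F (x + s *\<^sub>R z) \<partial>lborel)"
    using s by (subst lborel_affine[of s x]) (simp_all add: nn_integral_density nn_integral_distr)
  also have "\<dots> = (\<integral>\<^sup>+z. ennreal (gauss_density 1 z) * f (x + s *\<^sub>R z) \<partial>lborel)"
  proof (intro nn_integral_cong)
    fix z :: 'a
    have "ennreal (s ^ DIM('a)) * ?F (x + s *\<^sub>R z)
        = ennreal (s ^ DIM('a) * (1 / (s * sqrt (2 * pi))) ^ DIM('a) * exp (- (norm z)\<^sup>2 / 2)) * f (x + s *\<^sub>R z)"
      using s by (simp add: ennreal_mult mult_ac)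
    also have "s ^ DIM('a) * (1 / (s * sqrt (2 * pi))) ^ DIM('a) = (1 / sqrt (2 * pi)) ^ DIM('a)"
      using s by (simp flip: power_mult_distrib)
    finally show "ennreal (s ^ DIM('a)) * ?F (x + s *\<^sub>R z) = ennreal (gauss_density 1 z) * f (x + s *\<^sub>R z)"
      by (simp add: gauss_density_eq)
  qed
  finally show ?thesis
    by (simp add: gauss_measure_def nn_integral_density)
qed

text \<open>Convolution with a Gaussian turns a measure into a density that can be read off its
  characteristic function, because the Gaussian density is itself the characteristic function of a
  Gaussian measure.\<close>

lemma nn_integral_exp_eq_char:
  fixes \<mu> :: "'a::euclidean_space measure"
  assumes "finite_measure \<mu>" and sets [simp, measurable_cong]: "sets \<mu> = sets borel"
  shows "(\<integral>\<^sup>+x. ennreal (exp (- (norm ((w - x) /\<^sub>R s))\<^sup>2 / 2)) \<partial>\<mu>)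
    = ennreal (Re (\<integral>\<eta>. cis ((w /\<^sub>R s) \<bullet> \<eta>) * (\<integral>x. cis ((- \<eta> /\<^sub>R s) \<bullet> x) \<partial>\<mu>) \<partial>gauss_measure))"
proof -
  interpret \<mu>: finite_measure \<mu> by fact
  interpret G: prob_space "gauss_measure :: 'a measure" by (rule prob_space_gauss_measure)
  interpret pair_sigma_finite \<mu> "gauss_measure :: 'a measure" ..
  interpret P: finite_measure "\<mu> \<Otimes>\<^sub>M (gauss_measure :: 'a measure)"
    by (intro finite_measure_pair_measure \<mu>.finite_measure_axioms G.finite_measure_axioms)
  let ?c = "\<lambda>x \<eta>. cis (((w - x) /\<^sub>R s) \<bullet> \<eta>)"
  have "integrable (\<mu> \<Otimes>\<^sub>M gauss_measure) (case_prod ?c)"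
    by (rule P.integrable_const_bound[where B=1]) (auto simp: case_prod_unfold)
  \<comment> \<open>Integrating over \<eta> first gives the Gaussian exponential at
    \<open>(w - x) /\<^sub>R s\<close>; integrating over \<open>x\<close> first gives the
    characteristic function of \<mu>. As the first value is real, taking \<open>Re\<close> loses
    nothing.\<close>
  from Fubini_integral[OF this]
  have "(\<integral>x. complex_of_real (exp (- (norm ((w - x) /\<^sub>R s))\<^sup>2 / 2)) \<partial>\<mu>)
      = (\<integral>\<eta>. (\<integral>x. ?c x \<eta> \<partial>\<mu>) \<partial>gauss_measure)"
    by (simp only: integral_gauss_measure_cis)
  also have "(\<integral>\<eta>. (\<integral>x. ?c x \<eta> \<partial>\<mu>) \<partial>gauss_measure)
      = (\<integral>\<eta>. cis ((w /\<^sub>R s) \<bullet> \<eta>) * (\<integral>x. cis ((- \<eta> /\<^sub>R s) \<bullet> x) \<partial>\<mu>) \<partial>gauss_measure)"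
    by (intro Bochner_Integration.integral_cong refl)
      (simp add: algebra_simps cis_mult inner_commute flip: integral_mult_right_zero)
  finally have "(\<integral>x. exp (- (norm ((w - x) /\<^sub>R s))\<^sup>2 / 2) \<partial>\<mu>)
      = Re (\<integral>\<eta>. cis ((w /\<^sub>R s) \<bullet> \<eta>) * (\<integral>x. cis ((- \<eta> /\<^sub>R s) \<bullet> x) \<partial>\<mu>) \<partial>gauss_measure)"
    unfolding integral_complex_of_real by (metis Re_complex_of_real)
  moreover have "integrable \<mu> (\<lambda>x. exp (- (norm ((w - x) /\<^sub>R s))\<^sup>2 / 2))"
    by (rule \<mu>.integrable_const_bound[where B=1]) auto
  ultimately show ?thesis
    by (simp add: nn_integral_eq_integral)
qed

text \<open>Dominated convergence is applied twice, for the Gaussian average and for the integral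
  over \<mu>. Both measures are finite, so the constant \<open>1\<close> dominates each
  time.\<close>

lemma nn_integral_smoothing_limit:
  fixes \<mu> :: "'a::euclidean_space measure" and f :: "'a \<Rightarrow> real"
  assumes "finite_measure \<mu>" and sets [simp, measurable_cong]: "sets \<mu> = sets borel"
    and cont: "continuous_on UNIV f" and f01: "\<And>x. 0 \<le> f x" "\<And>x. f x \<le> 1"
  shows "(\<lambda>n. \<integral>\<^sup>+x. (\<integral>\<^sup>+z. ennreal (f (x + (1 / real (Suc n)) *\<^sub>R z)) \<partial>gauss_measure) \<partial>\<mu>)
    \<longlonglongrightarrow> (\<integral>\<^sup>+x. ennreal (f x) \<partial>\<mu>)"
proof -
  interpret \<mu>: finite_measure \<mu> by fact
  interpret G: prob_space "gauss_measure :: 'a measure" by (rule prob_space_gauss_measure)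
  have [measurable]: "f \<in> borel_measurable borel"
    using cont by (rule borel_measurable_continuous_onI)
  have lim: "(\<lambda>n. f (x + (1 / real (Suc n)) *\<^sub>R z)) \<longlonglongrightarrow> f x" for x z
  proof -
    have "(\<lambda>n. x + (1 / real (Suc n)) *\<^sub>R z) \<longlonglongrightarrow> x + 0 *\<^sub>R z"
      by (intro tendsto_intros LIMSEQ_Suc[OF lim_1_over_n])
    then show ?thesis
      using cont by (intro continuous_on_tendsto_compose[OF cont]) auto
  qed
  have "(\<lambda>n. \<integral>\<^sup>+z. ennreal (f (x + (1 / real (Suc n)) *\<^sub>R z)) \<partial>gauss_measure) \<longlonglongrightarrow> (\<integral>\<^sup>+z. ennreal (f x) \<partial>(gauss_measure :: 'a measure))" for x
    by (rule nn_integral_dominated_convergence[where w="\<lambda>_. 1"])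
      (use f01 lim in \<open>auto simp: G.emeasure_space_1[simplified] intro!: tendsto_ennrealI\<close>)
  then have lim2: "(\<lambda>n. \<integral>\<^sup>+z. ennreal (f (x + (1 / real (Suc n)) *\<^sub>R z)) \<partial>gauss_measure) \<longlonglongrightarrow> ennreal (f x)" for x
    by (simp add: G.emeasure_space_1[simplified])
  have le1: "(\<integral>\<^sup>+z. ennreal (f (x + c *\<^sub>R z)) \<partial>(gauss_measure :: 'a measure)) \<le> 1" for x c
  proof -
    have "(\<integral>\<^sup>+z. ennreal (f (x + c *\<^sub>R z)) \<partial>(gauss_measure :: 'a measure)) \<le> (\<integral>\<^sup>+z. 1 \<partial>(gauss_measure :: 'a measure))"
      by (intro nn_integral_mono) (use f01 in auto)
    then show ?thesis by (simp add: G.emeasure_space_1[simplified])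
  qed
  show ?thesis
    by (rule nn_integral_dominated_convergence[where w="\<lambda>_. 1"])
      (use lim2 le1 \<mu>.emeasure_finite[of "space \<mu>"] in \<open>auto simp flip: less_top\<close>)
qed

text \<open>The closed sets are an intersection-stable generator, and the indicator of a nonempty
  closed set is the pointwise limit of the tent functions
  \<open>max 0 (1 - k * infdist x F)\<close>.\<close>

lemma measure_eqI_continuous:
  fixes \<mu> \<nu> :: "'a::metric_space measure"
  assumes fin: "finite_measure \<mu>" "finite_measure \<nu>"
    and sets [simp, measurable_cong]: "sets \<mu> = sets borel" "sets \<nu> = sets borel"
    and eq: "\<And>f :: 'a \<Rightarrow> real. continuous_on UNIV f \<Longrightarrow> (\<And>x. 0 \<le> f x) \<Longrightarrow> (\<And>x. f x \<le> 1) \<Longrightarrow>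
      (\<integral>\<^sup>+x. ennreal (f x) \<partial>\<mu>) = (\<integral>\<^sup>+x. ennreal (f x) \<partial>\<nu>)"
  shows "\<mu> = \<nu>"
proof (rule measure_eqI_generator_eq[where E="Collect closed" and A="\<lambda>_. UNIV" and \<Omega>=UNIV])
  interpret \<mu>: finite_measure \<mu> by fact
  interpret \<nu>: finite_measure \<nu> by fact
  show "sets \<mu> = sigma_sets UNIV (Collect closed)" "sets \<nu> = sigma_sets UNIV (Collect closed)"
    by (simp_all add: borel_eq_closed)
  show "emeasure \<mu> UNIV \<noteq> \<infinity>" by simp
  fix F :: "'a set" assume "F \<in> Collect closed"
  then have F: "closed F" by simp
  then have [measurable]: "F \<in> sets borel" by simp
  show "emeasure \<mu> F = emeasure \<nu> F"
  \<comment> \<open>The empty set is separated because \<open>infdist x {}\<close> is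
    \<open>0\<close> by convention, which would turn the tent functions into the constant
    \<open>1\<close>.\<close>
  proof (cases "F = {}")
    case False
    define f where "f = (\<lambda>k x. max 0 (1 - real k * infdist x F))"
    have cont: "continuous_on UNIV (f k)" for k
      unfolding f_def by (intro continuous_intros)
    then have [measurable]: "f k \<in> borel_measurable borel" for k
      by (intro borel_measurable_continuous_onI)
    have f01: "0 \<le> f k x" "f k x \<le> 1" for k x
      by (auto simp: f_def infdist_nonneg)
    have lim: "(\<lambda>k. f k x) \<longlonglongrightarrow> indicator F x" for x
    proof (cases "x \<in> F")
      case True
      then show ?thesis by (simp add: f_def)
    next
      case out: False
      then have pos: "infdist x F > 0"
        using F False in_closed_iff_infdist_zero[of F x] infdist_nonneg[of x F] by force
      then obtain k0 where "1 < real k0 * infdist x F"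
        using reals_Archimedean3 by blast
      then have "f k x = 0" if "k \<ge> k0" for k
      proof -
        have "real k0 * infdist x F \<le> real k * infdist x F"
          using that pos by (intro mult_right_mono) auto
        with \<open>1 < real k0 * infdist x F\<close> show ?thesis
          by (simp add: f_def)
      qed
      then have "eventually (\<lambda>k. f k x = 0) sequentially"
        by (auto simp: eventually_sequentially)
      then show ?thesis using out by (simp add: tendsto_eventually)
    qed
    have *: "(\<lambda>k. \<integral>\<^sup>+x. ennreal (f k x) \<partial>N) \<longlonglongrightarrow> emeasure N F"
      if "finite_measure N" and [simp, measurable_cong]: "sets N = sets borel" for N
    proof -
      interpret N: finite_measure N by fact
      have "(\<lambda>k. \<integral>\<^sup>+x. ennreal (f k x) \<partial>N) \<longlonglongrightarrow> (\<integral>\<^sup>+x. ennreal (indicator F x) \<partial>N)"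
        by (rule nn_integral_dominated_convergence[where w="\<lambda>_. 1"])
          (use F f01 lim N.emeasure_finite[of "space N"] in \<open>auto simp flip: less_top intro!: tendsto_ennrealI\<close>)
      then show ?thesis
        using F by (simp add: ennreal_indicator)
    qed
    have "(\<lambda>k. \<integral>\<^sup>+x. ennreal (f k x) \<partial>\<mu>) = (\<lambda>k. \<integral>\<^sup>+x. ennreal (f k x) \<partial>\<nu>)"
      by (intro ext eq cont f01)
    then show ?thesis
      using *[OF fin(1) sets(1)] *[OF fin(2) sets(2)] LIMSEQ_unique by simp
  qed simp
qed (auto simp: Int_stable_def)

text \<open>After smoothing at scale \<open>s\<close>, the integral of \<open>f\<close> depends on
  the measure only through its characteristic function. Letting the scale tend to \<open>0\<close>
  recovers the integral itself.\<close>

lemma char_uniqueness: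
  fixes \<mu> \<nu> :: "'a::euclidean_space measure"
  assumes fin: "finite_measure \<mu>" "finite_measure \<nu>"
    and sets [simp, measurable_cong]: "sets \<mu> = sets borel" "sets \<nu> = sets borel"
    and eq: "\<And>\<theta>. (\<integral>x. cis (\<theta> \<bullet> x) \<partial>\<mu>) = (\<integral>x. cis (\<theta> \<bullet> x) \<partial>\<nu>)"
  shows "\<mu> = \<nu>"
proof (rule measure_eqI_continuous[OF fin sets])
  fix f :: "'a \<Rightarrow> real"
  assume f: "continuous_on UNIV f" "\<And>x. 0 \<le> f x" "\<And>x. f x \<le> 1"
  have [measurable]: "f \<in> borel_measurable borel"
    using f(1) by (rule borel_measurable_continuous_onI)
  have *: "(\<integral>\<^sup>+x. (\<integral>\<^sup>+z. ennreal (f (x + s *\<^sub>R z)) \<partial>gauss_measure) \<partial>N)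
      = (\<integral>\<^sup>+w. ennreal ((1 / (s * sqrt (2 * pi))) ^ DIM('a)) * ennreal (f w)
        * ennreal (Re (\<integral>\<eta>. cis ((w /\<^sub>R s) \<bullet> \<eta>) * (\<integral>x. cis ((- \<eta> /\<^sub>R s) \<bullet> x) \<partial>N) \<partial>gauss_measure)) \<partial>lborel)"
    if N: "finite_measure N" and [simp, measurable_cong]: "sets N = sets borel" and s: "s > 0" for N s
  proof -
    interpret N: finite_measure N by fact
    interpret pair_sigma_finite N "lborel :: 'a measure" ..
    show ?thesis
      unfolding nn_integral_exp_eq_char[OF N that(2), symmetric]
      using Fubini'[of "\<lambda>x w. ennreal ((1 / (s * sqrt (2 * pi))) ^ DIM('a)) * ennreal (f w)
        * ennreal (exp (- (norm ((w - x) /\<^sub>R s))\<^sup>2 / 2))"]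
      by (subst nn_integral_gauss_shift[OF _ s], measurable) (simp only: case_prod_unfold, simp add: nn_integral_cmult)
  qed
  have "(\<lambda>n. \<integral>\<^sup>+x. (\<integral>\<^sup>+z. ennreal (f (x + (1 / real (Suc n)) *\<^sub>R z)) \<partial>gauss_measure) \<partial>\<mu>)
      = (\<lambda>n. \<integral>\<^sup>+x. (\<integral>\<^sup>+z. ennreal (f (x + (1 / real (Suc n)) *\<^sub>R z)) \<partial>gauss_measure) \<partial>\<nu>)"
  proof
    fix n :: nat
    have pos: "1 / real (Suc n) > 0" by simp
    show "(\<integral>\<^sup>+x. (\<integral>\<^sup>+z. ennreal (f (x + (1 / real (Suc n)) *\<^sub>R z)) \<partial>gauss_measure) \<partial>\<mu>)
      = (\<integral>\<^sup>+x. (\<integral>\<^sup>+z. ennreal (f (x + (1 / real (Suc n)) *\<^sub>R z)) \<partial>gauss_measure) \<partial>\<nu>)"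
      unfolding *[OF fin(1) sets(1) pos] *[OF fin(2) sets(2) pos] eq ..
  qed
  with nn_integral_smoothing_limit[OF fin(1) sets(1) f] nn_integral_smoothing_limit[OF fin(2) sets(2) f]
  show "(\<integral>\<^sup>+x. ennreal (f x) \<partial>\<mu>) = (\<integral>\<^sup>+x. ennreal (f x) \<partial>\<nu>)"
    using LIMSEQ_unique by simp
qed

section \<open>Brownian increments\<close>

lemma gauss_density_vec:
  "gauss_density s (x :: real^'n) = (\<Prod>j\<in>UNIV. normal_density 0 s (x $ j))"
proof -
  have Basis: "(Basis :: (real^'n) set) = (\<lambda>j. axis j 1) ` UNIV"
    by (auto simp: Basis_vec_def)
  have inj: "inj (\<lambda>j::'n. axis j (1::real))"
    by (auto simp: inj_on_def axis_eq_axis)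
  show ?thesis
    unfolding gauss_density_def Basis by (subst prod.reindex[OF inj]) (simp add: inner_axis)
qed

lemma measurable_borel_lebesgue_on:
  "f \<in> borel_measurable borel \<Longrightarrow> f \<in> borel_measurable (lebesgue_on S)"
  by (intro measurable_restrict_space1 measurable_completion) simp

lemma integral_lebesgue_on_indicator_Ioc:
  fixes c :: "'b::euclidean_space"
  assumes "0 \<le> p" "p \<le> q" "q \<le> T"
  shows "integrable (lebesgue_on {0..T}) (\<lambda>s. indicator {p<..q} s *\<^sub>R c)"
    and "(LINT s|lebesgue_on {0..T}. indicator {p<..q} s *\<^sub>R c) = (q - p) *\<^sub>R c"
proof -
  have sets: "{p<..q} \<in> sets (lebesgue_on {0..T})"
    using assms by (auto simp: sets_restrict_space_iff)
  have Int: "{p<..q} \<inter> {0..T} = {p<..q}"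
    using assms by auto
  have "emeasure (lebesgue_on {0..T}) {p<..q} = ennreal (q - p)"
    using assms by (subst emeasure_restrict_space) auto
  then show "integrable (lebesgue_on {0..T}) (\<lambda>s. indicator {p<..q} s *\<^sub>R c)"
    "(LINT s|lebesgue_on {0..T}. indicator {p<..q} s *\<^sub>R c) = (q - p) *\<^sub>R c"
    using sets assms Int by (auto simp: measure_def)
qed

text \<open>Telescoping up to \<open>k\<close>, written as a sum over all \<open>l < n\<close> with
  a cut-off factor. In this form increments over different intervals become combinations of the same
  elementary increments.\<close>

lemma sum_increments_le:
  fixes g :: "real \<Rightarrow> 'b::real_vector" and \<tau> :: "nat \<Rightarrow> real"
  assumes mono: "\<And>i j. i < j \<Longrightarrow> j \<le> n \<Longrightarrow> \<tau> i < \<tau> j" and k: "k \<le> n"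
  shows "g (\<tau> k) - g (\<tau> 0) = (\<Sum>l<n. of_bool (\<tau> (Suc l) \<le> \<tau> k) *\<^sub>R (g (\<tau> (Suc l)) - g (\<tau> l)))"
proof -
  have iff: "\<tau> (Suc l) \<le> \<tau> k \<longleftrightarrow> l < k" if "l < n" for l
    using mono[of k "Suc l"] mono[of "Suc l" k] that k
    by (metis Suc_leI not_less not_less_eq order_le_less order_less_imp_not_less)
  have "(\<Sum>l<n. of_bool (\<tau> (Suc l) \<le> \<tau> k) *\<^sub>R (g (\<tau> (Suc l)) - g (\<tau> l)))
      = (\<Sum>l<k. g (\<tau> (Suc l)) - g (\<tau> l))"
    using k iff by (intro sum.mono_neutral_cong_right) auto
  then show ?thesis
    by (simp add: sum_lessThan_telescope[of "\<lambda>l. g (\<tau> l)"])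
qed

text \<open>The half-open intervals are disjoint, so the mixed inner products drop out.\<close>

lemma norm_sum_disjoint:
  fixes c :: "nat \<Rightarrow> 'b::real_inner" and \<tau> :: "nat \<Rightarrow> real"
  assumes mono: "\<And>i j. i < j \<Longrightarrow> j \<le> n \<Longrightarrow> \<tau> i < \<tau> j"
  shows "(norm (\<Sum>l<n. indicator {\<tau> l<..\<tau> (Suc l)} s *\<^sub>R c l))\<^sup>2
    = (\<Sum>l<n. indicator {\<tau> l<..\<tau> (Suc l)} s *\<^sub>R (norm (c l))\<^sup>2)"
proof -
  let ?i = "\<lambda>l. indicator {\<tau> l<..\<tau> (Suc l)} s :: real"
  have mono': "\<tau> i \<le> \<tau> j" if "i \<le> j" "j \<le> n" for i j
    using mono[of i j] that by (cases "i = j") auto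
  have 0: "?i l * ?i k = 0" if "l < k" "k < n" for k l
    using mono'[of "Suc l" k] that by (auto simp: indicator_def)
  have disj: "?i l * ?i k = (if k = l then ?i l else 0)" if "l < n" "k < n" for k l
    using 0[of l k] 0[of k l] that by (cases k l rule: linorder_cases) (auto simp: mult.commute indicator_def)
  have expand: "(norm (\<Sum>l<n. e l *\<^sub>R c l))\<^sup>2 = (\<Sum>l<n. \<Sum>k<n. (e l * e k) * (c l \<bullet> c k))"
    for e :: "nat \<Rightarrow> real"
    unfolding power2_norm_eq_inner
    by (subst inner_sum_left, subst inner_sum_right) (simp add: mult_ac)
  have "(norm (\<Sum>l<n. ?i l *\<^sub>R c l))\<^sup>2 = (\<Sum>l<n. \<Sum>k<n. (?i l * ?i k) * (c l \<bullet> c k))"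
    by (rule expand)
  also have "\<dots> = (\<Sum>l<n. \<Sum>k<n. if k = l then ?i l * (c l \<bullet> c l) else 0)"
    by (intro sum.cong refl) (auto simp: disj)
  finally show ?thesis
    by (simp add: power2_norm_eq_inner)
qed

section \<open>Characteristic functions of Brownian increments, jointly with the initial
  value\<close>

locale brownian_with_initial = prob_space M for M :: "'a measure" +
  fixes T :: real and B :: "real \<Rightarrow> 'a \<Rightarrow> real^'d" and X0 :: "'a \<Rightarrow> real^'m"
  assumes T: "T > 0"
    and BM: "brownian_motion_on M {0..T} B"
    and X0 [measurable]: "X0 \<in> borel_measurable M"
    and indep_X0: "indep_of_process M {0..T} X0 B"
begin

lemma measurable_B [measurable]: "t \<in> {0..T} \<Longrightarrow> B t \<in> borel_measurable M"
  using BM by (simp add: brownian_motion_on_def)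

lemma char_increment:
  assumes "s \<in> {0..T}" "t \<in> {0..T}" "s < t"
  shows "expectation (\<lambda>\<omega>. cis (c \<bullet> (B t \<omega> - B s \<omega>))) = complex_of_real (exp (- ((t - s) * (norm c)\<^sup>2) / 2))"
proof -
  have D: "distributed M lborel (\<lambda>\<omega>. B t \<omega> - B s \<omega>) (\<lambda>x. ennreal (gauss_density (sqrt (t - s)) x))"
    using BM assms by (simp add: brownian_motion_on_def gauss_density_vec)
  have "expectation (\<lambda>\<omega>. cis (c \<bullet> (B t \<omega> - B s \<omega>)))
      = (\<integral>x. cis (c \<bullet> x) \<partial>distr M lborel (\<lambda>\<omega>. B t \<omega> - B s \<omega>))"
    using assms by (subst integral_distr) (auto intro: distributed_measurable[OF D])
  also have "\<dots> = (\<integral>x. gauss_density (sqrt (t - s)) x *\<^sub>R cis (c \<bullet> x) \<partial>lborel)"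
    unfolding distributed_distr_eq_density[OF D] by (subst integral_density) auto
  also have "\<dots> = complex_of_real (exp (- (sqrt (t - s) * norm c)\<^sup>2 / 2))"
    using integral_gauss_density_cis(2)[of "sqrt (t - s)" c] assms by (simp add: scaleR_conv_of_real)
  finally show ?thesis
    using assms by (simp add: power_mult_distrib)
qed

lemma char_sum_increments:
  assumes \<tau>: "\<And>i. i \<le> n \<Longrightarrow> \<tau> i \<in> {0..T}" and mono: "\<And>i. i < n \<Longrightarrow> \<tau> i < \<tau> (Suc i)"
  shows "expectation (\<lambda>\<omega>. cis (\<Sum>l<n. c l \<bullet> (B (\<tau> (Suc l)) \<omega> - B (\<tau> l) \<omega>)))
    = complex_of_real (exp (- (\<Sum>l<n. (\<tau> (Suc l) - \<tau> l) * (norm (c l))\<^sup>2) / 2))"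
proof -
  have [measurable]: "B (\<tau> i) \<in> borel_measurable M" if "i \<le> n" for i
    using \<tau>[OF that] by simp
  have "indep_vars (\<lambda>_. borel) (\<lambda>l \<omega>. B (\<tau> (Suc l)) \<omega> - B (\<tau> l) \<omega>) {..<n}"
    using BM \<tau> mono unfolding brownian_motion_on_def by blast
  then have ind: "indep_vars (\<lambda>_. borel) (\<lambda>l \<omega>. cis (c l \<bullet> (B (\<tau> (Suc l)) \<omega> - B (\<tau> l) \<omega>))) {..<n}"
    by (rule indep_vars_compose2) auto
  have "expectation (\<lambda>\<omega>. cis (\<Sum>l<n. c l \<bullet> (B (\<tau> (Suc l)) \<omega> - B (\<tau> l) \<omega>)))
      = expectation (\<lambda>\<omega>. \<Prod>l<n. cis (c l \<bullet> (B (\<tau> (Suc l)) \<omega> - B (\<tau> l) \<omega>)))"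
    by (simp add: cis_sum)
  also have "\<dots> = (\<Prod>l<n. expectation (\<lambda>\<omega>. cis (c l \<bullet> (B (\<tau> (Suc l)) \<omega> - B (\<tau> l) \<omega>))))"
    by (rule indep_vars_lebesgue_integral[OF _ ind]) (auto intro!: integrable_const_bound[where B=1])
  also have "\<dots> = (\<Prod>l<n. complex_of_real (exp (- ((\<tau> (Suc l) - \<tau> l) * (norm (c l))\<^sup>2) / 2)))"
    using \<tau> mono by (intro prod.cong refl char_increment) auto
  finally show ?thesis
    by (simp add: sum_divide_distrib flip: of_real_prod exp_sum sum_negf)
qed

text \<open>The intervals from \<open>p i\<close> to \<open>q i\<close> may overlap, so their
  increments need not be independent. All end points are merged into one partition, whose increments
  are independent. Writing the exponent as the integral of a squared step function makes it
  independent of the partition and ready for the limit.\<close>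

lemma char_step_sum:
  assumes I: "finite I" and pq: "\<And>i. i \<in> I \<Longrightarrow> 0 \<le> p i \<and> p i \<le> q i \<and> q i \<le> T"
  shows "expectation (\<lambda>\<omega>. cis (\<Sum>i\<in>I. u i \<bullet> (B (q i) \<omega> - B (p i) \<omega>)))
    = complex_of_real (exp (- (LINT s|lebesgue_on {0..T}. (norm (\<Sum>i\<in>I. indicator {p i<..q i} s *\<^sub>R u i))\<^sup>2) / 2))"
proof -
  \<comment> \<open>Including \<open>0\<close> keeps \<open>P\<close> nonempty when \<open>I\<close>
    is empty, so the sorted list has at least one entry and \<open>n\<close> counts its
    gaps.\<close>
  define P where "P = insert 0 (p ` I \<union> q ` I)"
  have P: "finite P" "P \<subseteq> {0..T}"
    using I T unfolding P_def by (auto dest!: pq)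
  define xs where "xs = sorted_list_of_set P"
  define n where "n = length xs - 1"
  define \<tau> where "\<tau> = (\<lambda>i. xs ! i)"
  have set_xs: "set xs = P" and "sorted_wrt (<) xs"
    using P by (simp_all add: xs_def)
  moreover have "length xs = Suc n"
    using set_xs by (cases xs) (auto simp: n_def P_def)
  ultimately have mono: "\<tau> i < \<tau> j" if "i < j" "j \<le> n" for i j
    using that sorted_wrt_nth_less[of "(<)" xs i j] by (simp add: \<tau>_def)
  have \<tau>: "\<tau> i \<in> {0..T}" if "i \<le> n" for i
    using P set_xs nth_mem[of i xs] that \<open>length xs = Suc n\<close> by (auto simp: \<tau>_def)
  have ex: "\<exists>k\<le>n. \<tau> k = r" if "r \<in> P" for r
    using that set_xs \<open>length xs = Suc n\<close> by (auto simp: \<tau>_def in_set_conv_nth less_Suc_eq_le)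
  \<comment> \<open>\<open>a i l\<close> is \<open>1\<close> if the \<open>l\<close>-th elementary
    interval lies between \<open>p i\<close> and \<open>q i\<close>, and \<open>0\<close>
    otherwise.\<close>
  define a where "a = (\<lambda>i l. of_bool (\<tau> (Suc l) \<le> q i) - of_bool (\<tau> (Suc l) \<le> p i) :: real)"
  \<comment> \<open>Kept general in \<open>g\<close>: with the Brownian path it regroups the random
    sum, with \<open>indicator {0<..t} s\<close> the step function, so both receive the same
    coefficients \<open>c l\<close>.\<close>
  have incr: "g (q i) - g (p i) = (\<Sum>l<n. a i l *\<^sub>R (g (\<tau> (Suc l)) - g (\<tau> l)))"
    if "i \<in> I" for i and g :: "real \<Rightarrow> 'v::real_vector"
  proof -
    have "g r - g (\<tau> 0) = (\<Sum>l<n. of_bool (\<tau> (Suc l) \<le> r) *\<^sub>R (g (\<tau> (Suc l)) - g (\<tau> l)))" if "r \<in> P" for r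
      using ex[OF that] sum_increments_le[of n \<tau> _ g, OF mono] by blast
    from this[of "q i"] this[of "p i"] have "(g (q i) - g (\<tau> 0)) - (g (p i) - g (\<tau> 0))
        = (\<Sum>l<n. a i l *\<^sub>R (g (\<tau> (Suc l)) - g (\<tau> l)))"
      using that by (simp only: P_def a_def scaleR_diff_left sum_subtractf) simp
    then show ?thesis by simp
  qed
  define c where "c = (\<lambda>l. \<Sum>i\<in>I. a i l *\<^sub>R u i)"
  have W: "(\<Sum>i\<in>I. u i \<bullet> (B (q i) \<omega> - B (p i) \<omega>)) = (\<Sum>l<n. c l \<bullet> (B (\<tau> (Suc l)) \<omega> - B (\<tau> l) \<omega>))" for \<omega>
  proof -
    have "(\<Sum>i\<in>I. u i \<bullet> (B (q i) \<omega> - B (p i) \<omega>))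
        = (\<Sum>i\<in>I. u i \<bullet> (\<Sum>l<n. a i l *\<^sub>R (B (\<tau> (Suc l)) \<omega> - B (\<tau> l) \<omega>)))"
      by (intro sum.cong refl arg_cong2[where f="(\<bullet>)"] incr[of _ "\<lambda>t. B t \<omega>"])
    also have "\<dots> = (\<Sum>i\<in>I. \<Sum>l<n. (a i l *\<^sub>R u i) \<bullet> (B (\<tau> (Suc l)) \<omega> - B (\<tau> l) \<omega>))"
      by (simp add: inner_sum_right)
    also have "\<dots> = (\<Sum>l<n. \<Sum>i\<in>I. (a i l *\<^sub>R u i) \<bullet> (B (\<tau> (Suc l)) \<omega> - B (\<tau> l) \<omega>))"
      by (rule sum.swap)
    finally show ?thesis
      by (simp only: c_def inner_sum_left)
  qed
  have F: "(\<Sum>i\<in>I. indicator {p i<..q i} s *\<^sub>R u i) = (\<Sum>l<n. indicator {\<tau> l<..\<tau> (Suc l)} s *\<^sub>R c l)" for s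
  proof -
    have ind: "indicator {p<..q} s = indicator {0<..q} s - (indicator {0<..p} s :: real)"
      if "0 \<le> p" "p \<le> q" for p q :: real
      using that by (auto simp: indicator_def)
    have "(\<Sum>i\<in>I. indicator {p i<..q i} s *\<^sub>R u i)
        = (\<Sum>i\<in>I. (indicator {0<..q i} s - indicator {0<..p i} s) *\<^sub>R u i)"
      using pq by (intro sum.cong refl arg_cong2[where f="(*\<^sub>R)"] ind) auto
    also have "\<dots> = (\<Sum>i\<in>I. (\<Sum>l<n. a i l *\<^sub>R (indicator {0<..\<tau> (Suc l)} s - indicator {0<..\<tau> l} s)) *\<^sub>R u i)"
      by (intro sum.cong refl arg_cong2[where f="(*\<^sub>R)"] incr[of _ "\<lambda>t. indicator {0<..t} s"])
    also have "\<dots> = (\<Sum>i\<in>I. (\<Sum>l<n. a i l *\<^sub>R indicator {\<tau> l<..\<tau> (Suc l)} s) *\<^sub>R u i)"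
      using \<tau> mono
      by (intro sum.cong refl arg_cong2[where f="(*\<^sub>R)"] ind[symmetric]) (auto intro!: less_imp_le)
    also have "\<dots> = (\<Sum>i\<in>I. \<Sum>l<n. indicator {\<tau> l<..\<tau> (Suc l)} s *\<^sub>R (a i l *\<^sub>R u i))"
      by (simp only: scaleR_sum_left scaleR_scaleR real_scaleR_def mult.commute)
    also have "\<dots> = (\<Sum>l<n. \<Sum>i\<in>I. indicator {\<tau> l<..\<tau> (Suc l)} s *\<^sub>R (a i l *\<^sub>R u i))"
      by (rule sum.swap)
    finally show ?thesis
      by (simp add: c_def scaleR_sum_right)
  qed
  have \<tau>l: "0 \<le> \<tau> l" "\<tau> l \<le> \<tau> (Suc l)" "\<tau> (Suc l) \<le> T" if "l < n" for l
    using \<tau>[of l] \<tau>[of "Suc l"] mono[of l "Suc l"] that by auto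
  have sq: "(norm (\<Sum>l<n. indicator {\<tau> l<..\<tau> (Suc l)} s *\<^sub>R c l))\<^sup>2
      = (\<Sum>l<n. indicator {\<tau> l<..\<tau> (Suc l)} s *\<^sub>R (norm (c l))\<^sup>2)" for s
    by (rule norm_sum_disjoint) (rule mono)
  have "(LINT s|lebesgue_on {0..T}. (norm (\<Sum>i\<in>I. indicator {p i<..q i} s *\<^sub>R u i))\<^sup>2)
      = (\<Sum>l<n. (\<tau> (Suc l) - \<tau> l) * (norm (c l))\<^sup>2)"
  proof -
    have i: "integrable (lebesgue_on {0..T}) (\<lambda>s. indicator {\<tau> l<..\<tau> (Suc l)} s *\<^sub>R (norm (c l))\<^sup>2)"
      "(LINT s|lebesgue_on {0..T}. indicator {\<tau> l<..\<tau> (Suc l)} s *\<^sub>R (norm (c l))\<^sup>2)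
        = (\<tau> (Suc l) - \<tau> l) *\<^sub>R (norm (c l))\<^sup>2" if "l < n" for l
      using integral_lebesgue_on_indicator_Ioc[OF \<tau>l(1)[OF that] \<tau>l(2)[OF that] \<tau>l(3)[OF that]] by blast+
    have "(LINT s|lebesgue_on {0..T}. (norm (\<Sum>i\<in>I. indicator {p i<..q i} s *\<^sub>R u i))\<^sup>2)
        = (\<Sum>l<n. LINT s|lebesgue_on {0..T}. indicator {\<tau> l<..\<tau> (Suc l)} s *\<^sub>R (norm (c l))\<^sup>2)"
      unfolding F sq by (rule Bochner_Integration.integral_sum) (use i(1) in blast)
    also have "\<dots> = (\<Sum>l<n. (\<tau> (Suc l) - \<tau> l) *\<^sub>R (norm (c l))\<^sup>2)"
      by (intro sum.cong refl i(2)) simp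
    finally show ?thesis by simp
  qed
  then show ?thesis
    unfolding W using char_sum_increments[of n \<tau> c] \<tau> mono by simp
qed

text \<open>The factors are measurable for the sigma-algebras generated by \<open>X0\<close> and by
  the process. Both are real-valued before \<open>cis\<close> is applied, so their independence can
  be expressed by \<open>indep_var\<close>.\<close>

lemma expectation_indep:
  assumes I: "finite I" and pq: "\<And>i. i \<in> I \<Longrightarrow> p i \<in> {0..T} \<and> q i \<in> {0..T}" and C [measurable]: "C \<in> sets borel"
  shows "expectation (\<lambda>\<omega>. indicator C (X0 \<omega>) *\<^sub>R cis (\<Sum>i\<in>I. u i \<bullet> (B (q i) \<omega> - B (p i) \<omega>)))
    = prob (X0 -` C \<inter> space M) *\<^sub>R expectation (\<lambda>\<omega>. cis (\<Sum>i\<in>I. u i \<bullet> (B (q i) \<omega> - B (p i) \<omega>)))"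
proof -
  define W where "W = (\<lambda>\<omega>. \<Sum>i\<in>I. u i \<bullet> (B (q i) \<omega> - B (p i) \<omega>))"
  let ?V = "\<lambda>\<omega>. \<lambda>t\<in>{0..T}. B t \<omega>"
  let ?SX = "sets (vimage_algebra (space M) X0 borel)"
  let ?SV = "sets (vimage_algebra (space M) ?V (PiM {0..T} (\<lambda>_. borel)))"
  have ind: "indep_set ?SX ?SV"
    using indep_X0 by (simp add: indep_of_process_def)
  have [measurable]: "W \<in> borel_measurable M"
    unfolding W_def using pq by (intro borel_measurable_sum) measurable
  \<comment> \<open>\<open>W\<close> is a finite combination of coordinates of the path restricted
    to \<open>{0..T}\<close>, hence measurable for the sigma-algebra that the path
    generates.\<close>
  have W: "W \<in> borel_measurable (vimage_algebra (space M) ?V (PiM {0..T} (\<lambda>_. borel)))"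
  proof -
    have "(\<lambda>v. \<Sum>i\<in>I. u i \<bullet> (v (q i) - v (p i))) \<in> borel_measurable (PiM {0..T} (\<lambda>_. borel :: (real^'d) measure))"
      using pq by (intro borel_measurable_sum borel_measurable_inner borel_measurable_const borel_measurable_diff
          measurable_component_singleton) auto
    then have "(\<lambda>\<omega>. \<Sum>i\<in>I. u i \<bullet> (?V \<omega> (q i) - ?V \<omega> (p i))) \<in> borel_measurable (vimage_algebra (space M) ?V (PiM {0..T} (\<lambda>_. borel)))"
      by (rule measurable_compose[OF measurable_vimage_algebra1, rotated]) (auto simp: space_PiM)
    also have "(\<lambda>\<omega>. \<Sum>i\<in>I. u i \<bullet> (?V \<omega> (q i) - ?V \<omega> (p i))) = W"
      using pq by (auto simp: W_def intro!: sum.cong)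
    finally show ?thesis .
  qed
  then have SW: "W -` A \<inter> space M \<in> ?SV" if "A \<in> sets borel" for A
    using measurable_sets[OF W that] by simp
  let ?X = "\<lambda>\<omega>. indicator C (X0 \<omega>) :: real"
  have X: "?X \<in> borel_measurable (vimage_algebra (space M) X0 borel)"
    by (rule measurable_compose[OF measurable_vimage_algebra1]) auto
  then have SX: "?X -` A \<inter> space M \<in> ?SX" if "A \<in> sets borel" for A
    using measurable_sets[OF X that] by simp
  have "indep_set (sigma_sets (space M) {?X -` A \<inter> space M |A. A \<in> sets borel})
     (sigma_sets (space M) {W -` A \<inter> space M |A. A \<in> sets borel})"
    unfolding indep_set_def
  proof (rule indep_sets_mono_sets[OF ind[unfolded indep_set_def]])
    have "{?X -` A \<inter> space M |A. A \<in> sets borel} \<subseteq> ?SX"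
      using SX by blast
    from sets.sigma_sets_subset[OF this]
    have "sigma_sets (space M) {?X -` A \<inter> space M |A. A \<in> sets borel} \<subseteq> ?SX"
      by simp
    moreover have "{W -` A \<inter> space M |A. A \<in> sets borel} \<subseteq> ?SV"
      using SW by blast
    from sets.sigma_sets_subset[OF this]
    have "sigma_sets (space M) {W -` A \<inter> space M |A. A \<in> sets borel} \<subseteq> ?SV"
      by simp
    ultimately show "(case i of True \<Rightarrow> sigma_sets (space M) {?X -` A \<inter> space M |A. A \<in> sets borel}
       | False \<Rightarrow> sigma_sets (space M) {W -` A \<inter> space M |A. A \<in> sets borel})
       \<subseteq> (case i of True \<Rightarrow> ?SX | False \<Rightarrow> ?SV)" for i
      by (cases i) auto
  qed
  then have "indep_var borel ?X borel W"
    unfolding indep_var_eq by auto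
  then have "indep_var borel (complex_of_real \<circ> ?X) borel (cis \<circ> W)"
    by (rule indep_var_compose) auto
  then have "expectation (\<lambda>\<omega>. complex_of_real (?X \<omega>) * cis (W \<omega>))
      = expectation (\<lambda>\<omega>. complex_of_real (?X \<omega>)) * expectation (\<lambda>\<omega>. cis (W \<omega>))"
    by (subst indep_var_lebesgue_integral[symmetric])
      (auto simp: comp_def indicator_def intro!: integrable_const_bound[where B=1])
  moreover have "expectation ?X = prob (X0 -` C \<inter> space M)"
  proof -
    have "expectation ?X = expectation (indicator (X0 -` C \<inter> space M))"
      by (intro Bochner_Integration.integral_cong) (auto simp: indicator_def)
    then show ?thesis by simp
  qed
  ultimately show ?thesis
    by (simp add: scaleR_conv_of_real W_def)
qed

text \<open>The weight \<open>indicator C (X0 \<omega>)\<close> is carried through all later limits.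
  In the end it yields the normal law of the noise and its independence of \<open>X0\<close>
  together.\<close>

lemma char_step_sum_initial:
  assumes I: "finite I" and pq: "\<And>i. i \<in> I \<Longrightarrow> 0 \<le> p i \<and> p i \<le> q i \<and> q i \<le> T"
    and C: "C \<in> sets borel"
  shows "expectation (\<lambda>\<omega>. indicator C (X0 \<omega>) *\<^sub>R cis (\<Sum>i\<in>I. u i \<bullet> (B (q i) \<omega> - B (p i) \<omega>)))
    = prob (X0 -` C \<inter> space M) *\<^sub>R complex_of_real
      (exp (- (LINT s|lebesgue_on {0..T}. (norm (\<Sum>i\<in>I. indicator {p i<..q i} s *\<^sub>R u i))\<^sup>2) / 2))"
proof -
  have "p i \<in> {0..T} \<and> q i \<in> {0..T}" if "i \<in> I" for i
    using pq[OF that] by auto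
  then show ?thesis
    by (simp only: expectation_indep[OF I _ C] char_step_sum[OF I pq])
qed

end

section \<open>Convergence in mean square\<close>

lemma tendsto_integral_zero:
  fixes f :: "nat \<Rightarrow> 'a \<Rightarrow> real"
  assumes [measurable]: "\<And>k. f k \<in> borel_measurable N" and nn: "\<And>k x. 0 \<le> f k x"
    and lim: "(\<lambda>k. \<integral>\<^sup>+x. ennreal (f k x) \<partial>N) \<longlonglongrightarrow> 0"
  shows "eventually (\<lambda>k. integrable N (f k)) sequentially" and "(\<lambda>k. \<integral>x. f k x \<partial>N) \<longlonglongrightarrow> 0"
proof -
  \<comment> \<open>Early members of the sequence may have an infinite integral, so integrability
    can hold only from some index on.\<close>
  have "eventually (\<lambda>k. (\<integral>\<^sup>+x. ennreal (f k x) \<partial>N) < 1) sequentially"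
    using order_tendstoD(2)[OF lim] by simp
  then show "eventually (\<lambda>k. integrable N (f k)) sequentially"
    by eventually_elim (use nn in \<open>auto intro!: integrableI_bounded elim: order.strict_trans[OF _ ennreal_one_less_top]\<close>)
  have "(\<lambda>k. enn2real (\<integral>\<^sup>+x. ennreal (f k x) \<partial>N)) \<longlonglongrightarrow> 0"
    using lim by (intro tendsto_enn2real) simp_all
  then show "(\<lambda>k. \<integral>x. f k x \<partial>N) \<longlonglongrightarrow> 0"
    using nn by (simp add: integral_eq_nn_integral)
qed

text \<open>First \<epsilon> is fixed, then \<open>k\<close> grows, so \<open>K \<epsilon>\<close>
  may blow up as \<epsilon> tends to \<open>0\<close>. This is the shape that Young's inequality
  produces below.\<close>

lemma tendsto_of_le_eps:
  fixes a :: "nat \<Rightarrow> 'b::metric_space"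
  assumes D: "D \<longlonglongrightarrow> (0::real)" and A: "A \<ge> 0"
    and le: "\<And>\<epsilon>. \<epsilon> > 0 \<Longrightarrow> eventually (\<lambda>k. dist (a k) l \<le> \<epsilon> * A + K \<epsilon> * D k) sequentially"
  shows "a \<longlonglongrightarrow> l"
proof (rule tendstoI)
  fix e :: real assume e: "e > 0"
  define \<epsilon> where "\<epsilon> = e / (2 * (A + 1))"
  have \<epsilon>: "\<epsilon> > 0" "\<epsilon> * A < e / 2"
    using e A by (auto simp: \<epsilon>_def field_simps)
  have "(\<lambda>k. K \<epsilon> * D k) \<longlonglongrightarrow> K \<epsilon> * 0"
    by (intro tendsto_intros D)
  then have "eventually (\<lambda>k. K \<epsilon> * D k < e / 2) sequentially"
    using e by (intro order_tendstoD(2)) auto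
  with le[OF \<epsilon>(1)] show "eventually (\<lambda>k. dist (a k) l < e) sequentially"
    by eventually_elim (use \<epsilon>(2) in linarith)
qed

text \<open>Expansion of the square around \<open>y\<close>, with the mixed term split by Young's
  inequality \<open>2 * a * b <= \<epsilon> * a^2 + b^2 / \<epsilon>\<close>. Convergence of second
  moments then needs no triangle inequality in the space of square-integrable functions.\<close>

lemma power2_norm_diff_le:
  fixes x y :: "'b::real_inner"
  assumes "\<epsilon> > 0"
  shows "\<bar>(norm x)\<^sup>2 - (norm y)\<^sup>2\<bar> \<le> \<epsilon> * (norm y)\<^sup>2 + (1 + 1 / \<epsilon>) * (norm (x - y))\<^sup>2"
proof -
  define d where "d = norm (x - y)"
  have "(norm x)\<^sup>2 - (norm y)\<^sup>2 = (norm (x - y))\<^sup>2 + 2 * ((x - y) \<bullet> y)"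
    by (simp add: power2_norm_eq_inner algebra_simps inner_commute)
  then have "\<bar>(norm x)\<^sup>2 - (norm y)\<^sup>2\<bar> \<le> d\<^sup>2 + 2 * (d * norm y)"
    using Cauchy_Schwarz_ineq2[of "x - y" y] zero_le_power2[of d] unfolding d_def by linarith
  moreover have "0 \<le> (sqrt \<epsilon> * norm y - d / sqrt \<epsilon>)\<^sup>2"
    by simp
  then have "2 * (d * norm y) \<le> \<epsilon> * (norm y)\<^sup>2 + d\<^sup>2 / \<epsilon>"
    using assms by (simp add: power2_diff power_mult_distrib power_divide mult_ac)
  ultimately show ?thesis
    by (simp add: d_def algebra_simps)
qed

lemma tendsto_integral_power2_norm:
  fixes f :: "nat \<Rightarrow> 'a \<Rightarrow> 'b::euclidean_space"
  assumes [measurable]: "\<And>k. f k \<in> borel_measurable N" "F \<in> borel_measurable N"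
    and F: "integrable N (\<lambda>x. (norm (F x))\<^sup>2)"
    and lim: "(\<lambda>k. \<integral>\<^sup>+x. ennreal ((norm (f k x - F x))\<^sup>2) \<partial>N) \<longlonglongrightarrow> 0"
  shows "(\<lambda>k. \<integral>x. (norm (f k x))\<^sup>2 \<partial>N) \<longlonglongrightarrow> (\<integral>x. (norm (F x))\<^sup>2 \<partial>N)"
proof -
  define D where "D = (\<lambda>k. \<integral>x. (norm (f k x - F x))\<^sup>2 \<partial>N)"
  have ev: "eventually (\<lambda>k. integrable N (\<lambda>x. (norm (f k x - F x))\<^sup>2)) sequentially" and D: "D \<longlonglongrightarrow> 0"
    unfolding D_def by (rule tendsto_integral_zero[OF _ _ lim]; simp)+
  show ?thesis
  proof (rule tendsto_of_le_eps[OF D, where A="\<integral>x. (norm (F x))\<^sup>2 \<partial>N" and K="\<lambda>\<epsilon>. 1 + 1 / \<epsilon>"])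
    fix \<epsilon> :: real assume \<epsilon>: "\<epsilon> > 0"
    show "eventually (\<lambda>k. dist (\<integral>x. (norm (f k x))\<^sup>2 \<partial>N) (\<integral>x. (norm (F x))\<^sup>2 \<partial>N)
        \<le> \<epsilon> * (\<integral>x. (norm (F x))\<^sup>2 \<partial>N) + (1 + 1 / \<epsilon>) * D k) sequentially"
      using ev
    proof eventually_elim
      case (elim k)
      let ?g = "\<lambda>x. \<epsilon> * (norm (F x))\<^sup>2 + (1 + 1 / \<epsilon>) * (norm (f k x - F x))\<^sup>2"
      have g: "integrable N ?g"
        using F elim by simp
      \<comment> \<open>Square integrability of \<open>f k\<close> is not among the assumptions; it
        is derived from that of \<open>F\<close> and of the difference.\<close>
      have diff: "integrable N (\<lambda>x. (norm (f k x))\<^sup>2 - (norm (F x))\<^sup>2)"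
        by (rule Bochner_Integration.integrable_bound[OF g])
          (auto intro!: AE_I2 order_trans[OF power2_norm_diff_le[OF \<epsilon>]])
      have fk: "integrable N (\<lambda>x. (norm (f k x))\<^sup>2)"
        using Bochner_Integration.integrable_add[OF diff F] by simp
      have "dist (\<integral>x. (norm (f k x))\<^sup>2 \<partial>N) (\<integral>x. (norm (F x))\<^sup>2 \<partial>N)
          = norm (\<integral>x. (norm (f k x))\<^sup>2 - (norm (F x))\<^sup>2 \<partial>N)"
        using fk F by (simp add: dist_norm)
      also have "\<dots> \<le> (\<integral>x. norm ((norm (f k x))\<^sup>2 - (norm (F x))\<^sup>2) \<partial>N)"
        by (rule integral_norm_bound)
      also have "\<dots> \<le> (\<integral>x. ?g x \<partial>N)"
        using diff g power2_norm_diff_le[OF \<epsilon>] by (intro integral_mono) auto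
      also have "\<dots> = \<epsilon> * (\<integral>x. (norm (F x))\<^sup>2 \<partial>N) + (1 + 1 / \<epsilon>) * D k"
        using F elim by (simp add: D_def)
      finally show ?case .
    qed
  qed simp
qed

lemma norm_cis_diff_le: "norm (cis x - cis y) \<le> \<bar>x - y\<bar>"
proof -
  have "cis x - cis y = cis y * (cis (x - y) - 1)"
    by (simp add: algebra_simps cis_mult)
  moreover have "norm (cis (x - y) - 1) \<le> \<bar>x - y\<bar>"
    using iexp_approx1[of "x - y" 0] by (simp add: cis_conv_exp)
  ultimately show ?thesis
    by (simp add: norm_mult)
qed

text \<open>Since \<open>cis\<close> is Lipschitz with constant \<open>1\<close>, a first absolute
  moment of the error suffices, and \<open>amgm\<close> bounds it by the second moment.\<close>

lemma (in prob_space) tendsto_expectation_cis: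
  fixes W :: "'a \<Rightarrow> real"
  assumes [measurable]: "\<And>k. Wk k \<in> borel_measurable M" "W \<in> borel_measurable M" "g \<in> borel_measurable M"
    and g: "\<And>\<omega>. \<bar>g \<omega>\<bar> \<le> 1"
    and lim: "(\<lambda>k. \<integral>\<^sup>+\<omega>. ennreal ((Wk k \<omega> - W \<omega>)\<^sup>2) \<partial>M) \<longlonglongrightarrow> 0"
  shows "(\<lambda>k. expectation (\<lambda>\<omega>. g \<omega> *\<^sub>R cis (Wk k \<omega>))) \<longlonglongrightarrow> expectation (\<lambda>\<omega>. g \<omega> *\<^sub>R cis (W \<omega>))"
proof -
  define D where "D = (\<lambda>k. expectation (\<lambda>\<omega>. (Wk k \<omega> - W \<omega>)\<^sup>2))"
  have ev: "eventually (\<lambda>k. integrable M (\<lambda>\<omega>. (Wk k \<omega> - W \<omega>)\<^sup>2)) sequentially" and D: "D \<longlonglongrightarrow> 0"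
    unfolding D_def by (rule tendsto_integral_zero[OF _ _ lim]; simp)+
  have i: "integrable M (\<lambda>\<omega>. g \<omega> *\<^sub>R cis (V \<omega>))" if [measurable]: "V \<in> borel_measurable M" for V
    by (rule integrable_const_bound[where B=1]) (auto simp: g)
  show ?thesis
  proof (rule tendsto_of_le_eps[OF D, where A=1 and K="\<lambda>\<epsilon>. 1 / \<epsilon>"])
    fix \<epsilon> :: real assume \<epsilon>: "\<epsilon> > 0"
    have amgm: "\<bar>r\<bar> \<le> \<epsilon> + (1 / \<epsilon>) * r\<^sup>2" for r :: real
    proof -
      have "0 \<le> (\<bar>r\<bar> - \<epsilon>)\<^sup>2" by simp
      then have "\<bar>r\<bar> * \<epsilon> * 2 \<le> \<epsilon>\<^sup>2 + r\<^sup>2"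
        by (simp add: power2_diff)
      moreover have "\<bar>r\<bar> * \<epsilon> \<ge> 0" using \<epsilon> by simp
      ultimately have "\<bar>r\<bar> * \<epsilon> \<le> \<epsilon>\<^sup>2 + r\<^sup>2" by linarith
      then show ?thesis
        using \<epsilon> by (simp add: field_simps power2_eq_square)
    qed
    show "eventually (\<lambda>k. dist (expectation (\<lambda>\<omega>. g \<omega> *\<^sub>R cis (Wk k \<omega>))) (expectation (\<lambda>\<omega>. g \<omega> *\<^sub>R cis (W \<omega>)))
        \<le> \<epsilon> * 1 + 1 / \<epsilon> * D k) sequentially"
      using ev
    proof eventually_elim
      case (elim k)
      have "dist (expectation (\<lambda>\<omega>. g \<omega> *\<^sub>R cis (Wk k \<omega>))) (expectation (\<lambda>\<omega>. g \<omega> *\<^sub>R cis (W \<omega>)))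
          = norm (expectation (\<lambda>\<omega>. g \<omega> *\<^sub>R cis (Wk k \<omega>) - g \<omega> *\<^sub>R cis (W \<omega>)))"
        by (simp add: dist_norm i)
      also have "\<dots> \<le> expectation (\<lambda>\<omega>. norm (g \<omega> *\<^sub>R cis (Wk k \<omega>) - g \<omega> *\<^sub>R cis (W \<omega>)))"
        by (rule integral_norm_bound)
      also have "\<dots> \<le> expectation (\<lambda>\<omega>. \<epsilon> + (1 / \<epsilon>) * (Wk k \<omega> - W \<omega>)\<^sup>2)"
      proof (rule integral_mono)
        fix \<omega>
        have "norm (g \<omega> *\<^sub>R cis (Wk k \<omega>) - g \<omega> *\<^sub>R cis (W \<omega>)) \<le> 1 * \<bar>Wk k \<omega> - W \<omega>\<bar>"
          unfolding scaleR_diff_right[symmetric] norm_scaleR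
          by (intro mult_mono norm_cis_diff_le g) auto
        then show "norm (g \<omega> *\<^sub>R cis (Wk k \<omega>) - g \<omega> *\<^sub>R cis (W \<omega>)) \<le> \<epsilon> + (1 / \<epsilon>) * (Wk k \<omega> - W \<omega>)\<^sup>2"
          unfolding mult_1_left by (rule order_trans[OF _ amgm])
      qed (use elim i in auto)
      also have "\<dots> = \<epsilon> * 1 + 1 / \<epsilon> * D k"
        using elim by (simp add: D_def prob_space)
      finally show ?case .
    qed
  qed simp
qed

lemma nn_integral_tendsto_0:
  fixes G :: "nat \<Rightarrow> 'a \<Rightarrow> real"
  assumes meas [measurable]: "\<And>j k. j \<in> J \<Longrightarrow> H j k \<in> borel_measurable N"
    and c: "\<And>j. j \<in> J \<Longrightarrow> 0 \<le> c j" and nn: "\<And>j k x. j \<in> J \<Longrightarrow> 0 \<le> H j k x"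
    and lim: "\<And>j. j \<in> J \<Longrightarrow> (\<lambda>k. \<integral>\<^sup>+x. ennreal (H j k x) \<partial>N) \<longlonglongrightarrow> 0"
    and le: "\<And>k x. x \<in> space N \<Longrightarrow> G k x \<le> (\<Sum>j\<in>J. c j * H j k x)"
  shows "(\<lambda>k. \<integral>\<^sup>+x. ennreal (G k x) \<partial>N) \<longlonglongrightarrow> 0"
proof (rule tendsto_sandwich[OF _ _ tendsto_const])
  have "(\<lambda>k. \<Sum>j\<in>J. ennreal (c j) * (\<integral>\<^sup>+x. ennreal (H j k x) \<partial>N)) \<longlonglongrightarrow> (\<Sum>j\<in>J. ennreal (c j) * 0)"
    by (intro tendsto_sum ennreal_tendsto_cmult lim) auto
  then show "(\<lambda>k. \<Sum>j\<in>J. ennreal (c j) * (\<integral>\<^sup>+x. ennreal (H j k x) \<partial>N)) \<longlonglongrightarrow> 0"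
    by simp
  have "(\<integral>\<^sup>+x. ennreal (G k x) \<partial>N) \<le> (\<Sum>j\<in>J. ennreal (c j) * (\<integral>\<^sup>+x. ennreal (H j k x) \<partial>N))" for k
  proof -
    have "(\<integral>\<^sup>+x. ennreal (G k x) \<partial>N) \<le> (\<integral>\<^sup>+x. (\<Sum>j\<in>J. ennreal (c j) * ennreal (H j k x)) \<partial>N)"
    proof (rule nn_integral_mono)
      fix x assume "x \<in> space N"
      then have "ennreal (G k x) \<le> ennreal (\<Sum>j\<in>J. c j * H j k x)"
        using le by (intro ennreal_leI)
      also have "\<dots> = (\<Sum>j\<in>J. ennreal (c j) * ennreal (H j k x))"
        using c nn by (subst sum_ennreal[symmetric]) (auto simp: ennreal_mult intro!: sum.cong)
      finally show "ennreal (G k x) \<le> (\<Sum>j\<in>J. ennreal (c j) * ennreal (H j k x))" .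
    qed
    also have "\<dots> = (\<Sum>j\<in>J. ennreal (c j) * (\<integral>\<^sup>+x. ennreal (H j k x) \<partial>N))"
      by (subst nn_integral_sum) (auto simp: nn_integral_cmult intro!: sum.cong)
    finally show ?thesis .
  qed
  then show "eventually (\<lambda>k. (\<integral>\<^sup>+x. ennreal (G k x) \<partial>N) \<le> (\<Sum>j\<in>J. ennreal (c j) * (\<integral>\<^sup>+x. ennreal (H j k x) \<partial>N))) sequentially"
    by simp
qed simp

section \<open>Joint law of the stochastic integrals at finitely many times\<close>

lemma measurable_step_function [measurable]: "step_function n \<tau> A \<in> borel_measurable borel"
  unfolding step_function_def[abs_def] by measurable

text \<open>Lets the approximation of \<sigma> on \<open>{0..t}\<close> be read on all of
  \<open>{0..T}\<close>, as an approximation of \<sigma> cut off after \<open>t\<close>.\<close>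

lemma step_function_outside:
  assumes "\<And>i. i \<le> n \<Longrightarrow> \<tau> i \<in> {0..t}" "s \<notin> {0..t}"
  shows "step_function n \<tau> A s = 0"
  unfolding step_function_def
proof (intro sum.neutral ballI)
  fix i assume "i \<in> {..<n}"
  then have "s \<notin> {\<tau> i<..\<tau> (Suc i)}"
    using assms(1)[of i] assms(1)[of "Suc i"] assms(2) by auto
  then show "indicator {\<tau> i<..\<tau> (Suc i)} s *\<^sub>R A i = 0"
    by simp
qed

lemma inner_matrix_vector: "x \<bullet> (A *v y) = (transpose A *v x) \<bullet> y" for A :: "real^'n^'m"
  by (metis dot_lmul_matrix vector_transpose_matrix transpose_transpose)

text \<open>Shaped as the bound that \<open>nn_integral_tendsto_0\<close> asks for, with the squared
  errors \<open>(a j)\<^sup>2\<close> as \<open>H\<close>.\<close>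

lemma power2_sum_mult_le:
  fixes a b :: "'j \<Rightarrow> real"
  shows "(\<Sum>j\<in>J. a j * b j)\<^sup>2 \<le> (\<Sum>j\<in>J. (real (card J) * (b j)\<^sup>2) * (a j)\<^sup>2)"
  using sum_squared_le_sum_of_squares[of "\<lambda>j. a j * b j" J]
  by (simp add: power_mult_distrib sum_distrib_left sum_distrib_right mult_ac)

context brownian_with_initial
begin

text \<open>Each time \<open>t j\<close> brings its own approximating step functions on its own
  partitions, unrelated to the others; for this reason \<open>char_step_sum\<close> admits
  overlapping intervals. The left side converges by mean-square convergence over the probability
  space, the exponent by mean-square convergence over \<open>{0..T}\<close>.\<close>

lemma char_stochastic_integrals:
  fixes \<sigma> :: "real \<Rightarrow> real^'d^'n" and I :: "'j \<Rightarrow> 'a \<Rightarrow> real^'n"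
  assumes J: "finite J" and t: "\<And>j. j \<in> J \<Longrightarrow> t j \<in> {0..T}"
    and I: "\<And>j. j \<in> J \<Longrightarrow> has_stochastic_integral M B \<sigma> (t j) (I j)"
    and \<sigma> [measurable]: "\<sigma> \<in> borel_measurable (lebesgue_on {0..T})"
    and \<sigma>2: "integrable (lebesgue_on {0..T}) (\<lambda>t. (norm (\<sigma> t))\<^sup>2)"
    and C [measurable]: "C \<in> sets borel"
  shows "expectation (\<lambda>\<omega>. indicator C (X0 \<omega>) *\<^sub>R cis (\<Sum>j\<in>J. \<eta> j \<bullet> I j \<omega>))
    = prob (X0 -` C \<inter> space M) *\<^sub>R complex_of_real
      (exp (- (LINT s|lebesgue_on {0..T}.
        (norm (\<Sum>j\<in>J. indicator {0..t j} s *\<^sub>R (transpose (\<sigma> s) *v \<eta> j)))\<^sup>2) / 2))"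
proof -
  define Q where "Q j n \<tau> A \<longleftrightarrow> (\<forall>k. (\<forall>i\<le>n k. \<tau> k i \<in> {0..t j}) \<and> (\<forall>i<n k. \<tau> k i < \<tau> k (Suc i))) \<and>
        (\<lambda>k. \<integral>\<^sup>+ s. ennreal ((norm (\<sigma> s - step_function (n k) (\<tau> k) (A k) s))\<^sup>2)
               \<partial>lebesgue_on {0..t j}) \<longlonglongrightarrow> 0 \<and>
        (\<lambda>k. \<integral>\<^sup>+ \<omega>. ennreal ((norm (I j \<omega> - step_integral (n k) (\<tau> k) (A k) B \<omega>))\<^sup>2)
               \<partial>M) \<longlonglongrightarrow> 0" for j n \<tau> and A :: "nat \<Rightarrow> nat \<Rightarrow> real^'d^'n"
  have "\<forall>j\<in>J. \<exists>n \<tau> A. Q j n \<tau> A"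
    using I unfolding has_stochastic_integral_def Q_def by blast
  then obtain n \<tau> A where Q: "\<And>j. j \<in> J \<Longrightarrow> Q j (n j) (\<tau> j) (A j)"
    by metis
  have \<tau>: "\<tau> j k i \<in> {0..t j}" if "j \<in> J" "i \<le> n j k" for j k i
    using Q[OF that(1)] that(2) by (simp add: Q_def)
  have mono: "\<tau> j k i < \<tau> j k (Suc i)" if "j \<in> J" "i < n j k" for j k i
    using Q[OF that(1)] that(2) by (simp add: Q_def)
  have \<tau>T: "\<tau> j k i \<in> {0..T}" if "j \<in> J" "i \<le> n j k" for j k i
    using \<tau>[OF that] t[OF that(1)] by auto
  have I_meas [measurable]: "I j \<in> borel_measurable M" if "j \<in> J" for j
    using I[OF that] by (simp add: has_stochastic_integral_def)

  let ?step = "\<lambda>j k. step_function (n j k) (\<tau> j k) (A j k)"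
  let ?S = "\<lambda>j k. step_integral (n j k) (\<tau> j k) (A j k) B"
  define W where "W = (\<lambda>\<omega>. \<Sum>j\<in>J. \<eta> j \<bullet> I j \<omega>)"
  define Wk where "Wk = (\<lambda>k \<omega>. \<Sum>j\<in>J. \<eta> j \<bullet> ?S j k \<omega>)"
  define F where "F = (\<lambda>s. \<Sum>j\<in>J. indicator {0..t j} s *\<^sub>R (transpose (\<sigma> s) *v \<eta> j))"
  define Fk where "Fk = (\<lambda>k s. \<Sum>j\<in>J. transpose (?step j k s) *v \<eta> j)"

  have S_meas [measurable]: "?S j k \<in> borel_measurable M" if "j \<in> J" for j k
    unfolding step_integral_def[abs_def] using \<tau>T[OF that]
    by (intro borel_measurable_sum measurable_matrix_vector borel_measurable_diff measurable_B) auto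
  have [measurable]: "W \<in> borel_measurable M" "Wk k \<in> borel_measurable M" for k
    unfolding W_def Wk_def by (intro borel_measurable_sum; measurable)+
  have [measurable]: "?step j k \<in> borel_measurable (lebesgue_on {0..T})" for j k
    by (intro measurable_borel_lebesgue_on) measurable
  have [measurable]: "(\<lambda>s. indicator {0..r} s :: real) \<in> borel_measurable (lebesgue_on {0..T})" for r
    by (intro measurable_borel_lebesgue_on) measurable
  have F_meas [measurable]: "F \<in> borel_measurable (lebesgue_on {0..T})"
    unfolding F_def by (intro borel_measurable_sum) measurable
  have Fk_meas [measurable]: "Fk k \<in> borel_measurable (lebesgue_on {0..T})" for k
    unfolding Fk_def by (intro borel_measurable_sum) measurable

  have Wk_char: "expectation (\<lambda>\<omega>. indicator C (X0 \<omega>) *\<^sub>R cis (Wk k \<omega>))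
      = prob (X0 -` C \<inter> space M) *\<^sub>R complex_of_real (exp (- (LINT s|lebesgue_on {0..T}. (norm (Fk k s))\<^sup>2) / 2))" for k
  proof -
    \<comment> \<open>Pairs of a time \<open>j\<close> and an interval \<open>i\<close> of its
      partition: all step integrals together form a single sum of increments.\<close>
    define K where "K = (SIGMA j:J. {..<n j k})"
    define p q u where "p = (\<lambda>(j, i). \<tau> j k i)" and "q = (\<lambda>(j, i). \<tau> j k (Suc i))"
      and "u = (\<lambda>(j, i). transpose (A j k i) *v \<eta> j)"
    have "finite K"
      unfolding K_def using J by auto
    have sum_K: "(\<Sum>x\<in>K. f x) = (\<Sum>j\<in>J. \<Sum>i<n j k. f (j, i))" for f :: "'j \<times> nat \<Rightarrow> 'v::comm_monoid_add"
      unfolding K_def using sum.Sigma[OF J, of "\<lambda>j. {..<n j k}" "\<lambda>j i. f (j, i)"] by simp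
    note \<open>finite K\<close>
    moreover have "0 \<le> p x \<and> p x \<le> q x \<and> q x \<le> T" if "x \<in> K" for x
      using that \<tau>T[of "fst x" "snd x" k] \<tau>T[of "fst x" "Suc (snd x)" k] mono[of "fst x" "snd x" k]
      by (auto simp: K_def p_def q_def)
    ultimately have "expectation (\<lambda>\<omega>. indicator C (X0 \<omega>) *\<^sub>R cis (\<Sum>i\<in>K. u i \<bullet> (B (q i) \<omega> - B (p i) \<omega>)))
      = prob (X0 -` C \<inter> space M) *\<^sub>R complex_of_real
        (exp (- (LINT s|lebesgue_on {0..T}. (norm (\<Sum>i\<in>K. indicator {p i<..q i} s *\<^sub>R u i))\<^sup>2) / 2))"
      using C by (rule char_step_sum_initial)
    also have "(\<lambda>\<omega>. \<Sum>i\<in>K. u i \<bullet> (B (q i) \<omega> - B (p i) \<omega>)) = Wk k"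
      unfolding sum_K Wk_def
      by (simp add: u_def p_def q_def step_integral_def inner_sum_right inner_matrix_vector)
    also have "(\<lambda>s. \<Sum>i\<in>K. indicator {p i<..q i} s *\<^sub>R u i) = Fk k"
    proof
      fix s
      have "transpose (?step j k s) *v \<eta> j
          = (\<Sum>i<n j k. indicator {\<tau> j k i<..\<tau> j k (Suc i)} s *\<^sub>R (transpose (A j k i) *v \<eta> j))" for j
      proof -
        interpret bounded_linear "\<lambda>A :: real^'d^'n. transpose A *v \<eta> j"
          by (rule bounded_linear_compose[OF bounded_bilinear.bounded_linear_left[OF bounded_bilinear_matrix_vector]
                bounded_linear_transpose])
        show ?thesis
          by (simp only: step_function_def sum scaleR)
      qed
      then show "(\<Sum>i\<in>K. indicator {p i<..q i} s *\<^sub>R u i) = Fk k s"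
        unfolding sum_K Fk_def by (simp add: u_def p_def q_def)
    qed
    finally show ?thesis .
  qed
  have lim1: "(\<lambda>k. expectation (\<lambda>\<omega>. indicator C (X0 \<omega>) *\<^sub>R cis (Wk k \<omega>)))
      \<longlonglongrightarrow> expectation (\<lambda>\<omega>. indicator C (X0 \<omega>) *\<^sub>R cis (W \<omega>))"
  proof (rule tendsto_expectation_cis)
    show "(\<lambda>k. \<integral>\<^sup>+\<omega>. ennreal ((Wk k \<omega> - W \<omega>)\<^sup>2) \<partial>M) \<longlonglongrightarrow> 0"
    proof (rule nn_integral_tendsto_0[where J=J and c="\<lambda>j. real (card J) * (norm (\<eta> j))\<^sup>2"
          and H="\<lambda>j k \<omega>. (norm (I j \<omega> - ?S j k \<omega>))\<^sup>2"])
      show "(\<lambda>k. \<integral>\<^sup>+\<omega>. ennreal ((norm (I j \<omega> - ?S j k \<omega>))\<^sup>2) \<partial>M) \<longlonglongrightarrow> 0" if "j \<in> J" for j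
        using Q[OF that] by (simp add: Q_def)
      fix k \<omega>
      have "\<bar>Wk k \<omega> - W \<omega>\<bar> \<le> (\<Sum>j\<in>J. norm (I j \<omega> - ?S j k \<omega>) * norm (\<eta> j))"
        unfolding Wk_def W_def sum_subtractf[symmetric] inner_diff_right[symmetric]
      proof (intro order_trans[OF sum_abs] sum_mono)
        show "\<bar>\<eta> j \<bullet> (?S j k \<omega> - I j \<omega>)\<bar> \<le> norm (I j \<omega> - ?S j k \<omega>) * norm (\<eta> j)" for j
          using Cauchy_Schwarz_ineq2[of "\<eta> j" "?S j k \<omega> - I j \<omega>"]
          by (simp only: norm_minus_commute mult.commute)
      qed
      then have "(Wk k \<omega> - W \<omega>)\<^sup>2 \<le> (\<Sum>j\<in>J. norm (I j \<omega> - ?S j k \<omega>) * norm (\<eta> j))\<^sup>2"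
        by (intro power2_le_iff_abs_le[THEN iffD2] sum_nonneg) auto
      also note power2_sum_mult_le
      finally show "(Wk k \<omega> - W \<omega>)\<^sup>2 \<le> (\<Sum>j\<in>J. real (card J) * (norm (\<eta> j))\<^sup>2 * (norm (I j \<omega> - ?S j k \<omega>))\<^sup>2)" .
    qed auto
  qed (auto simp: indicator_def)
  have "(\<lambda>k. LINT s|lebesgue_on {0..T}. (norm (Fk k s))\<^sup>2) \<longlonglongrightarrow> (LINT s|lebesgue_on {0..T}. (norm (F s))\<^sup>2)"
  proof (rule tendsto_integral_power2_norm[OF Fk_meas F_meas])
    have F_le: "(norm (F s))\<^sup>2 \<le> (\<Sum>j\<in>J. norm (\<eta> j))\<^sup>2 * (norm (\<sigma> s))\<^sup>2" for s
    proof -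
      have "norm (F s) \<le> (\<Sum>j\<in>J. norm (\<sigma> s) * norm (\<eta> j))"
        unfolding F_def
      proof (intro sum_norm_le)
        fix j assume "j \<in> J"
        have "norm (indicator {0..t j} s *\<^sub>R (transpose (\<sigma> s) *v \<eta> j)) \<le> norm (transpose (\<sigma> s) *v \<eta> j)"
          by (simp add: indicator_def)
        also have "\<dots> \<le> norm (\<sigma> s) * norm (\<eta> j)"
          using norm_matrix_vector_le[of "transpose (\<sigma> s)" "\<eta> j"] by simp
        finally show "norm (indicator {0..t j} s *\<^sub>R (transpose (\<sigma> s) *v \<eta> j)) \<le> norm (\<sigma> s) * norm (\<eta> j)" .
      qed
      then have "norm (F s) \<le> (\<Sum>j\<in>J. norm (\<eta> j)) * norm (\<sigma> s)"
        by (simp add: sum_distrib_left sum_distrib_right mult.commute)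
      from power_mono[OF this norm_ge_zero, of 2] show ?thesis
        by (simp only: power_mult_distrib)
    qed
    show "integrable (lebesgue_on {0..T}) (\<lambda>s. (norm (F s))\<^sup>2)"
      by (rule Bochner_Integration.integrable_bound[OF integrable_mult_right[OF \<sigma>2, of "(\<Sum>j\<in>J. norm (\<eta> j))\<^sup>2"]])
        (auto intro!: AE_I2 F_le)
    show "(\<lambda>k. \<integral>\<^sup>+s. ennreal ((norm (Fk k s - F s))\<^sup>2) \<partial>lebesgue_on {0..T}) \<longlonglongrightarrow> 0"
    proof (rule nn_integral_tendsto_0[where J=J and c="\<lambda>j. real (card J) * (norm (\<eta> j))\<^sup>2"
          and H="\<lambda>j k s. (norm (?step j k s - indicator {0..t j} s *\<^sub>R \<sigma> s))\<^sup>2"])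
      fix j assume j: "j \<in> J"
      have "(\<integral>\<^sup>+s. ennreal ((norm (?step j k s - indicator {0..t j} s *\<^sub>R \<sigma> s))\<^sup>2) \<partial>lebesgue_on {0..T})
          = (\<integral>\<^sup>+s. ennreal ((norm (\<sigma> s - ?step j k s))\<^sup>2) \<partial>lebesgue_on {0..t j})" for k
      proof -
        have "?step j k s = 0" if "s \<notin> {0..t j}" for s
          by (rule step_function_outside[OF \<tau>[OF j] that])
        then show ?thesis
          using t[OF j] by (subst (1 2) nn_integral_restrict_space)
            (auto intro!: nn_integral_cong simp: indicator_def norm_minus_commute)
      qed
      then show "(\<lambda>k. \<integral>\<^sup>+s. ennreal ((norm (?step j k s - indicator {0..t j} s *\<^sub>R \<sigma> s))\<^sup>2) \<partial>lebesgue_on {0..T}) \<longlonglongrightarrow> 0"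
        using Q[OF j] by (simp add: Q_def)
    next
      fix k s
      have "norm (Fk k s - F s) \<le> (\<Sum>j\<in>J. norm (?step j k s - indicator {0..t j} s *\<^sub>R \<sigma> s) * norm (\<eta> j))"
        unfolding Fk_def F_def sum_subtractf[symmetric]
      proof (intro sum_norm_le)
        fix j assume "j \<in> J"
        have "transpose (?step j k s) *v \<eta> j - indicator {0..t j} s *\<^sub>R (transpose (\<sigma> s) *v \<eta> j)
          = transpose (?step j k s - indicator {0..t j} s *\<^sub>R \<sigma> s) *v \<eta> j"
          by (simp add: vec_eq_iff matrix_vector_mult_def transpose_def sum_subtractf sum_distrib_left algebra_simps)
        then show "norm (transpose (?step j k s) *v \<eta> j - indicator {0..t j} s *\<^sub>R (transpose (\<sigma> s) *v \<eta> j))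
            \<le> norm (?step j k s - indicator {0..t j} s *\<^sub>R \<sigma> s) * norm (\<eta> j)"
          using norm_matrix_vector_le[of "transpose (?step j k s - indicator {0..t j} s *\<^sub>R \<sigma> s)" "\<eta> j"]
          by (simp only: norm_transpose)
      qed
      then have "(norm (Fk k s - F s))\<^sup>2 \<le> (\<Sum>j\<in>J. norm (?step j k s - indicator {0..t j} s *\<^sub>R \<sigma> s) * norm (\<eta> j))\<^sup>2"
        by (intro power_mono) auto
      also note power2_sum_mult_le
      finally show "(norm (Fk k s - F s))\<^sup>2
          \<le> (\<Sum>j\<in>J. real (card J) * (norm (\<eta> j))\<^sup>2 * (norm (?step j k s - indicator {0..t j} s *\<^sub>R \<sigma> s))\<^sup>2)" .
    qed auto
  qed
  then have lim2: "(\<lambda>k. prob (X0 -` C \<inter> space M) *\<^sub>R complex_of_real (exp (- (LINT s|lebesgue_on {0..T}. (norm (Fk k s))\<^sup>2) / 2)))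
      \<longlonglongrightarrow> prob (X0 -` C \<inter> space M) *\<^sub>R complex_of_real (exp (- (LINT s|lebesgue_on {0..T}. (norm (F s))\<^sup>2) / 2))"
    by (intro tendsto_intros) auto
  from LIMSEQ_unique[OF lim1[unfolded Wk_char] lim2] show ?thesis
    unfolding W_def F_def .
qed

end

section \<open>Linear substitution and whitening\<close>

text \<open>The library's change of variables for linear maps needs a well-ordered index type. Here only
  the existence of the constant matters, so uniqueness of translation-invariant measures suffices.\<close>

lemma translation_invariant_nn_integral:
  fixes \<mu> :: "'a::euclidean_space measure"
  assumes "sigma_finite_measure \<mu>" and sets [simp, measurable_cong]: "sets \<mu> = sets borel"
    and inv: "\<And>c. distr \<mu> borel (\<lambda>x. x + c) = \<mu>"
    and f [measurable]: "f \<in> borel_measurable borel" and g [measurable]: "g \<in> borel_measurable borel"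
  shows "(\<integral>\<^sup>+x. f x \<partial>\<mu>) * (\<integral>\<^sup>+y. g y \<partial>lborel) = (\<integral>\<^sup>+y. f y \<partial>lborel) * (\<integral>\<^sup>+x. g (- x) \<partial>\<mu>)"
proof -
  interpret \<mu>: sigma_finite_measure \<mu> by fact
  interpret pair_sigma_finite \<mu> "lborel :: 'a measure" ..
  have shift: "(\<integral>\<^sup>+x. h (x + c) \<partial>\<mu>) = (\<integral>\<^sup>+x. h x \<partial>\<mu>)" if [measurable]: "h \<in> borel_measurable borel" for h :: "'a \<Rightarrow> ennreal" and c
    by (subst (2) inv[of c, symmetric]) (simp add: nn_integral_distr)
  have shift': "(\<integral>\<^sup>+y. h (y - x) \<partial>lborel) = (\<integral>\<^sup>+y. h y \<partial>lborel)" if [measurable]: "h \<in> borel_measurable borel" for h :: "'a \<Rightarrow> ennreal" and x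
    by (subst (2) lborel_distr_plus[of "- x", symmetric]) (simp add: nn_integral_distr)
  \<comment> \<open>Three shifts alternate with Fubini: \<open>x\<close> by \<open>y\<close> under
    \<mu>, then \<open>y\<close> by \<open>- x\<close> under Lebesgue measure, then \<open>x\<close>
    by \<open>y\<close> under \<mu> again. They detach \<open>f\<close> from \<mu> and
    \<open>g\<close> from Lebesgue measure.\<close>
  have "(\<integral>\<^sup>+x. f x \<partial>\<mu>) * (\<integral>\<^sup>+y. g y \<partial>lborel) = (\<integral>\<^sup>+y. (\<integral>\<^sup>+x. f x \<partial>\<mu>) * g y \<partial>lborel)"
    by (simp add: nn_integral_cmult)
  also have "\<dots> = (\<integral>\<^sup>+y. (\<integral>\<^sup>+x. f (x + y) * g y \<partial>\<mu>) \<partial>lborel)"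
    by (simp add: nn_integral_multc shift)
  also have "\<dots> = (\<integral>\<^sup>+x. (\<integral>\<^sup>+y. f (x + y) * g y \<partial>lborel) \<partial>\<mu>)"
    by (rule Fubini') measurable
  also have "\<dots> = (\<integral>\<^sup>+x. (\<integral>\<^sup>+y. f y * g (y - x) \<partial>lborel) \<partial>\<mu>)"
    using shift'[of "\<lambda>y. f (x + y) * g y" x for x] by (intro nn_integral_cong[of \<mu>]) simp
  also have "\<dots> = (\<integral>\<^sup>+y. (\<integral>\<^sup>+x. f y * g (y - x) \<partial>\<mu>) \<partial>lborel)"
    by (rule Fubini'[symmetric]) measurable
  also have "\<dots> = (\<integral>\<^sup>+y. f y * (\<integral>\<^sup>+x. g (- x) \<partial>\<mu>) \<partial>lborel)"
    using shift[of "\<lambda>x. g (y - x)" y for y] by (intro nn_integral_cong[of lborel]) (simp add: nn_integral_cmult)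
  also have "\<dots> = (\<integral>\<^sup>+y. f y \<partial>lborel) * (\<integral>\<^sup>+x. g (- x) \<partial>\<mu>)"
    by (simp add: nn_integral_multc)
  finally show ?thesis .
qed

lemma lborel_linear_substitution:
  fixes L L' :: "'a::euclidean_space \<Rightarrow> 'a"
  assumes "linear L" "linear L'" and LL': "\<And>x. L (L' x) = x" "\<And>x. L' (L x) = x"
  obtains k :: real where "k > 0"
    "\<And>f. f \<in> borel_measurable borel \<Longrightarrow> (\<integral>\<^sup>+z. f z \<partial>lborel) = ennreal k * (\<integral>\<^sup>+y. f (L y) \<partial>lborel)"
proof -
  have cont: "continuous_on UNIV L" "continuous_on UNIV L'"
    using assms by (auto intro: linear_continuous_on linear_linear[THEN iffD1] simp: linear_conv_bounded_linear)
  then have [measurable]: "L \<in> borel_measurable borel" "L' \<in> borel_measurable borel"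
    by (auto intro: borel_measurable_continuous_onI)
  define \<mu> where "\<mu> = distr lborel borel L"
  have sets [simp, measurable_cong]: "sets \<mu> = sets borel"
    by (simp add: \<mu>_def)
  have preim: "L -` S = L' ` S" for S
    using LL' by (auto intro!: image_eqI[of _ _ "L _"])
  have bounded_fin: "emeasure lborel (L -` S) < \<infinity>" if "bounded S" for S
  proof -
    have "bounded (L' ` S)"
      using that assms(2) by (intro bounded_linear_image) (auto simp: linear_conv_bounded_linear)
    then show ?thesis
      unfolding preim by (rule emeasure_bounded_finite)
  qed
  have "sigma_finite_measure \<mu>"
  proof
    let ?A = "range (\<lambda>n::nat. ball 0 (real n) :: 'a set)"
    show "\<exists>A. countable A \<and> A \<subseteq> sets \<mu> \<and> \<Union>A = space \<mu> \<and> (\<forall>a\<in>A. emeasure \<mu> a \<noteq> \<infinity>)"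
    proof (intro exI[of _ ?A] conjI ballI)
      show "\<Union>?A = space \<mu>"
        using reals_Archimedean2 by (auto simp: \<mu>_def)
      show "emeasure \<mu> a \<noteq> \<infinity>" if "a \<in> ?A" for a
        using that bounded_fin[of a] by (auto simp: \<mu>_def emeasure_distr)
    qed auto
  qed
  moreover have "distr \<mu> borel (\<lambda>x. x + c) = \<mu>" for c
  proof -
    have "distr \<mu> borel (\<lambda>x. x + c) = distr (distr lborel borel ((+) (L' c))) borel L"
      using \<open>linear L\<close> LL' by (simp add: \<mu>_def distr_distr comp_def linear_add add.commute)
    then show ?thesis
      by (simp add: lborel_distr_plus \<mu>_def)
  qed
  ultimately have eq: "(\<integral>\<^sup>+x. f x \<partial>\<mu>) * (\<integral>\<^sup>+y. indicator (ball 0 1) y \<partial>(lborel :: 'a measure))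
      = (\<integral>\<^sup>+y. f y \<partial>lborel) * (\<integral>\<^sup>+x. indicator (ball 0 1) (- x) \<partial>\<mu>)"
    if "f \<in> borel_measurable borel" for f
    using that by (intro translation_invariant_nn_integral borel_measurable_indicator) auto
  \<comment> \<open>The proportionality constant is found by testing on the unit ball. Both volumes
    are finite because the sets are bounded, and positive because they are open and
    nonempty.\<close>
  define a where "a = measure lborel (ball (0::'a) 1)"
  define d where "d = measure lborel (L -` ball (0::'a) 1)"
  have a: "emeasure lborel (ball (0::'a) 1) = ennreal a"
    unfolding a_def using emeasure_bounded_finite[of "ball (0::'a) 1"]
    by (intro emeasure_eq_ennreal_measure) auto
  have d: "emeasure lborel (L -` ball 0 1) = ennreal d"
    unfolding d_def using bounded_fin[of "ball 0 1"]
    by (intro emeasure_eq_ennreal_measure) auto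
  have pos: "emeasure lborel S > 0" if "open S" "S \<noteq> {}" for S :: "'a set"
  proof -
    have "S \<notin> null_sets lborel"
      using open_not_negligible[OF that] by (auto simp: negligible_iff_null_sets intro: null_sets_completionI)
    then show ?thesis
      using that by (auto simp: null_sets_def zero_less_iff_neq_zero)
  qed
  have "a > 0"
    using pos[of "ball 0 1"] a by simp
  have "open (L -` ball 0 1)"
    using cont(1) by (intro open_vimage) auto
  moreover have "L 0 = 0" using \<open>linear L\<close> by (rule linear_0)
  then have "0 \<in> L -` ball 0 1" by simp
  then have "L -` ball 0 1 \<noteq> {}" by blast
  ultimately have "d > 0"
    using pos[of "L -` ball 0 1"] d by simp
  show thesis
  proof (rule that[of "a / d"])
    show "a / d > 0" using \<open>a > 0\<close> \<open>d > 0\<close> by simp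
    fix f :: "'a \<Rightarrow> ennreal" assume f [measurable]: "f \<in> borel_measurable borel"
    have "(\<integral>\<^sup>+x. indicator (ball 0 1) (- x) \<partial>\<mu>) = (\<integral>\<^sup>+x. indicator (ball 0 1) x \<partial>\<mu>)"
      by (intro nn_integral_cong) (auto simp: indicator_def)
    also have "\<dots> = ennreal d"
      by (simp add: \<mu>_def emeasure_distr d)
    finally have "(\<integral>\<^sup>+y. f (L y) \<partial>lborel) * ennreal a = (\<integral>\<^sup>+y. f y \<partial>lborel) * ennreal d"
      using eq[OF f] by (simp add: \<mu>_def nn_integral_distr a)
    then have "ennreal (1 / d) * ((\<integral>\<^sup>+y. f (L y) \<partial>lborel) * ennreal a) = ennreal (1 / d) * ((\<integral>\<^sup>+y. f y \<partial>lborel) * ennreal d)"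
      by simp
    also have "\<dots> = (\<integral>\<^sup>+y. f y \<partial>lborel) * (ennreal (1 / d) * ennreal d)"
      by (simp add: mult_ac)
    also have "ennreal (1 / d) * ennreal d = 1"
      using \<open>d > 0\<close> by (simp flip: ennreal_mult)
    finally show "(\<integral>\<^sup>+z. f z \<partial>lborel) = ennreal (a / d) * (\<integral>\<^sup>+y. f (L y) \<partial>lborel)"
      using \<open>d > 0\<close> \<open>a > 0\<close> ennreal_mult[of "1/d" a] by (simp add: mult_ac)
  qed
qed

text \<open>Gram-Schmidt for the inner product that \<gamma> defines: a system orthonormal for it,
  of full size, supplies the rows of \<open>L\<close>.\<close>

lemma pos_def_whitening:
  fixes \<gamma> :: "real^'m^'m"
  assumes sym: "transpose \<gamma> = \<gamma>" and pos: "\<And>x. x \<noteq> 0 \<Longrightarrow> x \<bullet> (\<gamma> *v x) > 0"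
  obtains L :: "real^'m^'m" where "L ** \<gamma> ** transpose L = mat 1"
proof -
  have symi: "x \<bullet> (\<gamma> *v y) = y \<bullet> (\<gamma> *v x)" for x y
  proof -
    have "x \<bullet> (\<gamma> *v y) = (transpose \<gamma> *v x) \<bullet> y"
      by (simp add: dot_lmul_matrix)
    then show ?thesis by (simp only: sym inner_commute)
  qed
  have "\<exists>v :: nat \<Rightarrow> real^'m. \<forall>i<k. \<forall>j<k. v i \<bullet> (\<gamma> *v v j) = of_bool (i = j)" if "k \<le> CARD('m)" for k
    using that
  proof (induction k)
    case (Suc k)
    then obtain v where v: "\<And>i j. i < k \<Longrightarrow> j < k \<Longrightarrow> v i \<bullet> (\<gamma> *v v j) = of_bool (i = j)"
      by auto
    \<comment> \<open>Fewer than \<open>CARD('m)\<close> vectors span a proper subspace, so some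
      nonzero \<open>w\<close> is orthogonal to all \<open>\<gamma> *v v j\<close>. Scaling it to
      unit length in the new inner product extends the system.\<close>
    let ?S = "(\<lambda>j. \<gamma> *v v j) ` {..<k}"
    have "dim ?S \<le> card ?S"
      by (intro dim_le_card') auto
    also have "\<dots> \<le> k"
      using card_image_le[of "{..<k}"] by simp
    also have "\<dots> < DIM(real^'m)"
      using Suc.prems by simp
    finally obtain w where w: "w \<noteq> 0" "\<And>y. y \<in> span ?S \<Longrightarrow> orthogonal w y"
      using orthogonal_to_subspace_exists by blast
    have wv: "w \<bullet> (\<gamma> *v v j) = 0" if "j < k" for j
      using w(2)[of "\<gamma> *v v j"] that by (auto simp: orthogonal_def intro: span_base)
    have vw: "v j \<bullet> (\<gamma> *v w) = 0" if "j < k" for j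
      using wv[OF that] symi[of "v j" w] by simp
    define q where "q = w \<bullet> (\<gamma> *v w)"
    have q: "q > 0" using pos[OF w(1)] by (simp add: q_def)
    define v' where "v' = v(k := (1 / sqrt q) *\<^sub>R w)"
    have "v' i \<bullet> (\<gamma> *v v' j) = of_bool (i = j)" if "i < Suc k" "j < Suc k" for i j
    proof -
      have "(1 / sqrt q) *\<^sub>R w \<bullet> (\<gamma> *v ((1 / sqrt q) *\<^sub>R w)) = 1"
        using q by (simp add: matrix_vector_mult_scaleR q_def[symmetric] flip: real_sqrt_mult)
      then show ?thesis
        using that v[of i j] wv vw
        by (cases "i = k"; cases "j = k") (simp_all add: v'_def less_Suc_eq matrix_vector_mult_scaleR)
    qed
    then show ?case by blast
  qed simp
  from this[OF order_refl] obtain v :: "nat \<Rightarrow> real^'m"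
    where v: "\<And>i j. i < CARD('m) \<Longrightarrow> j < CARD('m) \<Longrightarrow> v i \<bullet> (\<gamma> *v v j) = of_bool (i = j)"
    by auto
  obtain h :: "'m \<Rightarrow> nat" where h: "bij_betw h UNIV {0..<CARD('m)}"
    using ex_bij_betw_finite_nat[of "UNIV :: 'm set"] by auto
  define L :: "real^'m^'m" where "L = (\<chi> i. v (h i))"
  have "(L ** \<gamma> ** transpose L) $ i $ j = v (h i) \<bullet> (\<gamma> *v v (h j))" for i j
  proof -
    have "(L ** \<gamma> ** transpose L) $ i $ j = ((L ** \<gamma>) *v v (h j)) $ i"
      by (simp add: L_def matrix_matrix_mult_def matrix_vector_mult_def transpose_def)
    also have "\<dots> = v (h i) \<bullet> (\<gamma> *v v (h j))"
      by (simp add: L_def matrix_vector_mul_component flip: matrix_vector_mul_assoc)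
    finally show ?thesis .
  qed
  moreover have "h i < CARD('m)" "h i = h j \<longleftrightarrow> i = j" for i j
    using h by (auto simp: bij_betw_def inj_on_def)
  ultimately have "L ** \<gamma> ** transpose L = mat 1"
    by (simp add: vec_eq_iff mat_def v)
  then show thesis by (rule that)
qed

section \<open>Conditional laws and Gaussian kernels\<close>

text \<open>Squaring \<open>1 + t^2 / 4 <= exp (t^2 / 4)\<close> bounds \<open>exp (t^2 / 2)\<close>
  below by \<open>(1 + t^2 / 4)^2\<close>, which dominates both \<open>t\<close> and
  \<open>t^2\<close>.\<close>

lemma exp_neg_half_sq_mult_le:
  fixes t :: real
  assumes "t \<ge> 0"
  shows "exp (- t\<^sup>2 / 2) * t \<le> 1" and "exp (- t\<^sup>2 / 2) * t\<^sup>2 \<le> 1"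
proof -
  have "1 + t\<^sup>2 / 4 \<le> exp (t\<^sup>2 / 4)"
    by (rule exp_ge_add_one_self)
  then have "(1 + t\<^sup>2 / 4)\<^sup>2 \<le> (exp (t\<^sup>2 / 4))\<^sup>2"
    by (intro power_mono) auto
  also have "(exp (t\<^sup>2 / 4))\<^sup>2 = exp (t\<^sup>2 / 2)"
    by (simp flip: exp_of_nat_mult)
  finally have ge: "(1 + t\<^sup>2 / 4)\<^sup>2 \<le> exp (t\<^sup>2 / 2)" .
  have "0 \<le> (1 - t\<^sup>2 / 4)\<^sup>2" by simp
  then have "t\<^sup>2 \<le> (1 + t\<^sup>2 / 4)\<^sup>2"
    by (simp add: power2_eq_square algebra_simps)
  with ge have sq: "t\<^sup>2 \<le> exp (t\<^sup>2 / 2)" by linarith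
  then show "exp (- t\<^sup>2 / 2) * t\<^sup>2 \<le> 1"
    by (simp add: exp_minus field_simps)
  have "0 \<le> (1 - t / 2)\<^sup>2" by simp
  then have "t \<le> 1 + t\<^sup>2 / 4"
    by (simp add: power2_eq_square algebra_simps)
  also have "\<dots> \<le> (1 + t\<^sup>2 / 4)\<^sup>2"
    by (intro self_le_power) auto
  also note ge
  finally show "exp (- t\<^sup>2 / 2) * t \<le> 1"
    by (simp add: exp_minus field_simps)
qed

text \<open>The bound does not depend on \<open>u\<close>, so it can be integrated over the base point.\<close>

lemma gauss_taylor:
  fixes u k :: "'a::real_inner"
  shows "\<bar>exp (- (norm (u + k))\<^sup>2 / 2) - exp (- (norm u)\<^sup>2 / 2) + exp (- (norm u)\<^sup>2 / 2) * (u \<bullet> k)\<bar>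
    \<le> (norm k)\<^sup>2"
proof -
  define E where "E = (\<lambda>t. exp (- (norm (u + t *\<^sub>R k))\<^sup>2 / 2))"
  define diff where "diff = (\<lambda>m::nat. if m = 0 then E else if m = 1 then (\<lambda>t. - E t * ((u + t *\<^sub>R k) \<bullet> k))
     else (\<lambda>t. E t * (((u + t *\<^sub>R k) \<bullet> k)\<^sup>2 - (norm k)\<^sup>2)))"
  have E': "(E has_real_derivative (- E t * ((u + t *\<^sub>R k) \<bullet> k))) (at t)" for t
  proof -
    have "E = (\<lambda>t. exp (- (u \<bullet> u + 2 * t * (u \<bullet> k) + t\<^sup>2 * (k \<bullet> k)) / 2))"
      unfolding E_def power2_norm_eq_inner by (simp add: algebra_simps inner_commute power2_eq_square)
    then show ?thesis
      by (auto intro!: derivative_eq_intros simp: field_simps inner_add_left)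
  qed
  have E'': "((\<lambda>t. - E t * ((u + t *\<^sub>R k) \<bullet> k)) has_real_derivative
      (E t * (((u + t *\<^sub>R k) \<bullet> k)\<^sup>2 - (norm k)\<^sup>2))) (at t)" for t
    unfolding inner_add_left inner_scaleR_left
    by (rule derivative_eq_intros E' | simp)+
      (simp add: dot_square_norm algebra_simps power2_eq_square)
  \<comment> \<open>Taylor's formula along the segment from \<open>u\<close> to
    \<open>u + k\<close>. The second derivative is at most \<open>2 * (norm k)\<^sup>2\<close> in
    absolute value, and the factorial halves it.\<close>
  have "\<exists>t>0. t < 1 \<and> E 1 = (\<Sum>m<2. diff m 0 / fact m * 1 ^ m) + diff 2 t / fact 2 * 1 ^ 2"
    by (rule Maclaurin) (auto simp: diff_def less_2_cases_iff E'[simplified] E''[simplified])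
  then obtain t where "E 1 = E 0 - E 0 * (u \<bullet> k) + E t * (((u + t *\<^sub>R k) \<bullet> k)\<^sup>2 - (norm k)\<^sup>2) / 2"
    by (auto simp: diff_def numeral_2_eq_2)
  moreover have "\<bar>E t * (((u + t *\<^sub>R k) \<bullet> k)\<^sup>2 - (norm k)\<^sup>2)\<bar> \<le> 2 * (norm k)\<^sup>2"
  proof -
    let ?w = "u + t *\<^sub>R k"
    have "E t * (?w \<bullet> k)\<^sup>2 \<le> E t * ((norm ?w)\<^sup>2 * (norm k)\<^sup>2)"
      using Cauchy_Schwarz_ineq[of ?w k] by (intro mult_left_mono) (auto simp: E_def power2_norm_eq_inner)
    also have "\<dots> = (E t * (norm ?w)\<^sup>2) * (norm k)\<^sup>2"
      by simp
    also have "\<dots> \<le> 1 * (norm k)\<^sup>2"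
      using exp_neg_half_sq_mult_le(2)[of "norm ?w"] by (intro mult_right_mono) (auto simp: E_def)
    finally have 1: "E t * (?w \<bullet> k)\<^sup>2 \<le> (norm k)\<^sup>2" by simp
    have "E t * (norm k)\<^sup>2 \<le> 1 * (norm k)\<^sup>2"
      by (intro mult_right_mono) (auto simp: E_def)
    moreover have "E t \<ge> 0" by (simp add: E_def)
    then have "0 \<le> E t * (?w \<bullet> k)\<^sup>2" "0 \<le> E t * (norm k)\<^sup>2" by auto
    ultimately show ?thesis
      using 1 unfolding right_diff_distrib by linarith
  qed
  ultimately show ?thesis
    by (simp add: E_def)
qed

lemma has_derivative_quadratic_bound:
  fixes f :: "'a::real_normed_vector \<Rightarrow> real"
  assumes "bounded_linear D" and le: "\<And>h. \<bar>f (x + h) - f x - D h\<bar> \<le> K * (norm h)\<^sup>2"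
  shows "(f has_derivative D) (at x)"
  unfolding has_derivative_at
proof (intro conjI assms)
  have "(\<lambda>h::'a. K * norm h) \<midarrow>0\<rightarrow> 0"
    by (intro tendsto_mult_right_zero tendsto_norm_zero tendsto_ident_at)
  then show "(\<lambda>h. norm (f (x + h) - f x - D h) / norm h) \<midarrow>0\<rightarrow> 0"
  proof (rule Lim_null_comparison[rotated])
    show "\<forall>\<^sub>F h in at 0. norm (norm (f (x + h) - f x - D h) / norm h) \<le> K * norm h"
      unfolding eventually_at_filter
      using le by (intro always_eventually allI impI) (simp add: divide_le_eq power2_eq_square mult.assoc)
  qed
qed

text \<open>The set where the functions differ is open, and a nonempty open set is not Lebesgue
  null.\<close>

lemma continuous_AE_eq:
  fixes f g :: "'a::euclidean_space \<Rightarrow> real"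
  assumes "continuous_on UNIV f" "continuous_on UNIV g" and AE: "AE x in lborel. f x = g x"
  shows "f = g"
proof (rule ccontr)
  assume "f \<noteq> g"
  then have "{x. f x \<noteq> g x} \<noteq> {}" by auto
  moreover have "open {x. f x \<noteq> g x}"
    using assms(1,2) by (intro open_Collect_neq)
  ultimately have "\<not> negligible {x. f x \<noteq> g x}"
    using open_not_negligible by blast
  moreover have "{x. f x \<noteq> g x} \<in> null_sets lborel"
    using AE \<open>open {x. f x \<noteq> g x}\<close> by (subst AE_iff_null_sets) auto
  ultimately show False
    by (auto simp: negligible_iff_null_sets intro: null_sets_completionI)
qed

text \<open>A countable generator reduces equality of two kernels to countably many null sets.\<close>

lemma conditional_law_unique:
  fixes M :: "'a measure" and Z V :: "'a \<Rightarrow> real^'m"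
  assumes "prob_space M" and V [measurable]: "V \<in> borel_measurable M"
    and 1: "is_conditional_law M Z V \<kappa>1" and 2: "is_conditional_law M Z V \<kappa>2"
  shows "AE y in distr M borel V. \<kappa>1 y = \<kappa>2 y"
proof -
  interpret prob_space M by fact
  interpret D: prob_space "distr M borel V"
    by (rule prob_space_distr) simp
  obtain BB :: "(real^'m) set set" where BB: "countable BB" "topological_basis BB"
    using ex_countable_basis by blast
  \<comment> \<open>Finite intersections of a countable basis: still countable, stable under
    intersection, and containing \<open>UNIV\<close> as the intersection of the empty
    family.\<close>
  define G where "G = Inter ` {F. finite F \<and> F \<subseteq> BB}"
  have G_count: "countable G"
    unfolding G_def by (intro countable_image countable_Collect_finite_subset BB(1))
  have BB_open: "open b" if "b \<in> BB" for b
    using BB(2) that by (rule topological_basis_open)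
  have G_borel: "S \<in> sets borel" if "S \<in> G" for S
    using that BB_open by (auto simp: G_def intro!: borel_open open_Inter)
  have G_Int: "Int_stable G"
  proof (rule Int_stableI)
    fix a b assume "a \<in> G" "b \<in> G"
    then obtain F F' where "a = \<Inter>F" "b = \<Inter>F'" "finite (F \<union> F')" "F \<union> F' \<subseteq> BB"
      by (auto simp: G_def)
    then show "a \<inter> b \<in> G"
      unfolding G_def by (intro image_eqI[of _ _ "F \<union> F'"]) auto
  qed
  have G_sigma: "sets borel = sigma_sets UNIV G"
  proof (rule antisym)
    have "BB \<subseteq> G"
      unfolding G_def by (auto intro!: image_eqI[of _ _ "{_}"])
    from sigma_sets_mono'[OF this] show "sets borel \<subseteq> sigma_sets UNIV G"
      unfolding borel_eq_countable_basis[OF BB] by (subst sets_measure_of) auto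
    show "sigma_sets UNIV G \<subseteq> sets borel"
      using G_borel sets.sigma_sets_subset[of G borel] by auto
  qed
  have UNIV_G: "UNIV \<in> G"
    unfolding G_def by (auto intro!: image_eqI[of _ _ "{}"])
  have kernel: "\<kappa> \<in> measurable borel (prob_algebra borel)" if "is_conditional_law M Z V \<kappa>" for \<kappa>
    using that by (simp add: is_conditional_law_def)
  have kernel': "prob_space (\<kappa> y)" "sets (\<kappa> y) = sets borel" if "is_conditional_law M Z V \<kappa>" for \<kappa> y
    using measurable_space[OF kernel[OF that], of y] by (auto simp: space_prob_algebra)
  have kernel_meas: "(\<lambda>y. emeasure (\<kappa> y) C) \<in> borel_measurable borel"
    if "is_conditional_law M Z V \<kappa>" "C \<in> sets borel" for \<kappa> C
    using measurable_prob_algebraD[OF kernel[OF that(1)]] that(2) by (rule measurable_emeasure_kernel)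
  have joint: "(\<integral>\<^sup>+y. emeasure (\<kappa> y) C * indicator A y \<partial>distr M borel V)
      = emeasure M {\<omega> \<in> space M. V \<omega> \<in> A \<and> Z \<omega> \<in> C}"
    if "is_conditional_law M Z V \<kappa>" "A \<in> sets borel" "C \<in> sets borel" for \<kappa> A C
    using that unfolding is_conditional_law_def by simp
  have "AE y in distr M borel V. \<forall>C\<in>G. emeasure (\<kappa>1 y) C = emeasure (\<kappa>2 y) C"
  proof (intro AE_ball_countable[THEN iffD2] ballI G_count)
    fix C assume "C \<in> G"
    then have C: "C \<in> sets borel" by (rule G_borel)
    show "AE y in distr M borel V. emeasure (\<kappa>1 y) C = emeasure (\<kappa>2 y) C"
    \<comment> \<open>For fixed \<open>C\<close>, both kernels are densities, with respect to the
      law of \<open>V\<close>, of the same measure that sends \<open>A\<close> to the probability of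
      \<open>V\<close> in \<open>A\<close> and \<open>Z\<close> in \<open>C\<close>.\<close>
    proof (rule D.density_unique_finite_measure)
      show "(\<integral>\<^sup>+y. emeasure (\<kappa>1 y) C * indicator A y \<partial>distr M borel V) = (\<integral>\<^sup>+y. emeasure (\<kappa>2 y) C * indicator A y \<partial>distr M borel V)"
        if "A \<in> sets (distr M borel V)" for A
        using joint[OF 1 _ C, of A] joint[OF 2 _ C, of A] that by simp
    qed (use kernel_meas[OF 1 C] kernel_meas[OF 2 C] in auto)
  qed
  then show ?thesis
  proof eventually_elim
    case (elim y)
    show ?case
    proof (rule measure_eqI_generator_eq[where E=G and \<Omega>=UNIV and A="\<lambda>_. UNIV"])
      show "emeasure (\<kappa>1 y) UNIV \<noteq> \<infinity>" for i :: nat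
        using finite_measure.emeasure_finite[OF prob_space.finite_measure[OF kernel'(1)[OF 1]]] by simp
    qed (use elim G_Int G_sigma kernel'(2)[OF 1] kernel'(2)[OF 2] UNIV_G in auto)
  qed
qed

section \<open>Mixtures of Gaussian densities and Tweedie's formula\<close>

locale gaussian_channel = prob_space M for M :: "'a measure" +
  fixes X0 V :: "'a \<Rightarrow> real^'m" and H L :: "real^'m^'m" and c :: real
  assumes X0 [measurable]: "X0 \<in> borel_measurable M" and V [measurable]: "V \<in> borel_measurable M"
    and H: "invertible H" and L: "invertible L" and c: "c > 0"
    and joint: "\<And>A C. A \<in> sets borel \<Longrightarrow> C \<in> sets borel \<Longrightarrow>
      emeasure M {\<omega> \<in> space M. V \<omega> \<in> A \<and> X0 \<omega> \<in> C}
        = (\<integral>\<^sup>+y\<in>A. (\<integral>\<^sup>+x\<in>C. ennreal (c * exp (- (norm (L *v (y - H *v x)))\<^sup>2 / 2)) \<partial>distr M borel X0) \<partial>lborel)"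
begin

abbreviation "P \<equiv> distr M borel X0"

text \<open>\<open>\<phi> x y\<close> is the density of \<open>V\<close> at \<open>y\<close> given
  \<open>X0 = x\<close>, \<open>\<kappa> y\<close> is the posterior of \<open>X0\<close>, and
  \<open>mom y\<close> is the posterior mean before division by \<open>p y\<close>.\<close>

definition "\<phi> x y = c * exp (- (norm (L *v (y - H *v x)))\<^sup>2 / 2)"
definition "p y = (\<integral>x. \<phi> x y \<partial>P)"
definition "\<kappa> y = density P (\<lambda>x. ennreal (\<phi> x y / p y))"
definition "mom y = (\<integral>x. \<phi> x y *\<^sub>R x \<partial>P)"

sublocale P: prob_space P
  by (rule prob_space_distr) simp

lemma \<phi>_pos: "0 < \<phi> x y" and \<phi>_le: "\<phi> x y \<le> c"
  using c by (auto simp: \<phi>_def mult_le_cancel_left1)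

lemma measurable_\<phi> [measurable]:
  assumes [measurable]: "f \<in> borel_measurable N" "g \<in> borel_measurable N"
  shows "(\<lambda>x. \<phi> (f x) (g x)) \<in> borel_measurable N"
  unfolding \<phi>_def by measurable

lemma integrable_\<phi>: "integrable P (\<lambda>x. \<phi> x y)"
  by (rule P.integrable_const_bound[where B=c]) (use \<phi>_pos \<phi>_le in \<open>auto simp: less_imp_le\<close>)

lemma p_pos: "0 < p y"
proof -
  have "p y \<noteq> 0"
  proof
    assume "p y = 0"
    then have "AE x in P. \<phi> x y = 0"
      using integral_nonneg_eq_0_iff_AE[OF integrable_\<phi>[of y]] \<phi>_pos by (auto simp: p_def less_imp_le)
    then have "AE x in P. False"
      by eventually_elim (use \<phi>_pos in \<open>auto simp: less_le\<close>)
    then show False by simp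
  qed
  moreover have "p y \<ge> 0"
    unfolding p_def using \<phi>_pos by (intro integral_nonneg_AE) (auto simp: less_imp_le)
  ultimately show ?thesis by simp
qed

lemma nn_integral_\<phi>: "(\<integral>\<^sup>+x. ennreal (\<phi> x y) \<partial>P) = ennreal (p y)"
  unfolding p_def using \<phi>_pos by (intro nn_integral_eq_integral integrable_\<phi>) (auto simp: less_imp_le)

lemma \<phi>_mult_le: "\<phi> x y * norm (L *v (y - H *v x)) \<le> c"
proof -
  have "\<phi> x y * norm (L *v (y - H *v x)) = c * (exp (- (norm (L *v (y - H *v x)))\<^sup>2 / 2) * norm (L *v (y - H *v x)))"
    by (simp add: \<phi>_def)
  also have "\<dots> \<le> c * 1"
    using c by (intro mult_left_mono exp_neg_half_sq_mult_le) auto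
  finally show ?thesis by simp
qed

text \<open>\<open>X0\<close> may have no mean, but \<open>x\<close> is an affine function of the
  whitened residual \<open>L *v (y - H *v x)\<close>, and \<phi> times the norm of that residual is
  bounded by \<open>c\<close>. Invertibility of \<open>H\<close> and \<open>L\<close> is what makes
  this inversion possible.\<close>

lemma integrable_mom: "integrable P (\<lambda>x. \<phi> x y *\<^sub>R x)"
proof (rule P.integrable_const_bound)
  let ?K = "norm (matrix_inv H)" and ?K' = "norm (matrix_inv L)"
  show "AE x in P. norm (\<phi> x y *\<^sub>R x) \<le> ?K * (c * norm y + ?K' * c)"
  proof (intro AE_I2)
    fix x
    let ?w = "L *v (y - H *v x)"
    have "x = matrix_inv H *v (y - matrix_inv L *v ?w)"
      by (simp add: matrix_vector_mul_assoc matrix_inv_left H L)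
    then have "norm x \<le> ?K * norm (y - matrix_inv L *v ?w)"
      by (metis norm_matrix_vector_le)
    also have "\<dots> \<le> ?K * (norm y + ?K' * norm ?w)"
      by (intro mult_left_mono order_trans[OF norm_triangle_ineq4] add_left_mono norm_matrix_vector_le) auto
    finally have "\<phi> x y * norm x \<le> \<phi> x y * (?K * (norm y + ?K' * norm ?w))"
      using \<phi>_pos[of x y] by (intro mult_left_mono) auto
    also have "\<dots> = ?K * (\<phi> x y * norm y + ?K' * (\<phi> x y * norm ?w))"
      by (simp add: algebra_simps)
    also have "\<dots> \<le> ?K * (c * norm y + ?K' * c)"
      using \<phi>_le[of x y] \<phi>_mult_le[of x y] by (intro mult_left_mono add_mono mult_right_mono) auto
    finally show "norm (\<phi> x y *\<^sub>R x) \<le> ?K * (c * norm y + ?K' * c)"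
      using \<phi>_pos[of x y] by simp
  qed
qed simp

lemma \<phi>_taylor:
  "\<bar>\<phi> x (y + h) - \<phi> x y + \<phi> x y * ((L *v (y - H *v x)) \<bullet> (L *v h))\<bar> \<le> c * (norm L)\<^sup>2 * (norm h)\<^sup>2"
proof -
  let ?u = "L *v (y - H *v x)" and ?k = "L *v h"
  have "L *v (y + h - H *v x) = ?u + ?k"
    by (simp add: algebra_simps flip: matrix_vector_right_distrib)
  then have "\<phi> x (y + h) - \<phi> x y + \<phi> x y * (?u \<bullet> ?k) =
    c * (exp (- (norm (?u + ?k))\<^sup>2 / 2) - exp (- (norm ?u)\<^sup>2 / 2) + exp (- (norm ?u)\<^sup>2 / 2) * (?u \<bullet> ?k))"
    by (simp add: \<phi>_def algebra_simps)
  then have "\<bar>\<phi> x (y + h) - \<phi> x y + \<phi> x y * (?u \<bullet> ?k)\<bar> =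
    c * \<bar>exp (- (norm (?u + ?k))\<^sup>2 / 2) - exp (- (norm ?u)\<^sup>2 / 2) + exp (- (norm ?u)\<^sup>2 / 2) * (?u \<bullet> ?k)\<bar>"
    using c by (simp add: abs_mult)
  also have "\<dots> \<le> c * (norm ?k)\<^sup>2"
    using c by (intro mult_left_mono gauss_taylor) auto
  also have "\<dots> \<le> c * (norm L * norm h)\<^sup>2"
    using c by (intro mult_left_mono power_mono norm_matrix_vector_le) auto
  finally show ?thesis by (simp add: power_mult_distrib)
qed

text \<open>The Taylor remainder of \<phi> is quadratic in \<open>h\<close> with a constant
  independent of \<open>x\<close>. Integrating it over the probability measure \<open>P\<close>
  gives the same bound for \<open>p\<close>, which justifies the derivative under the
  integral.\<close>

lemma p_has_derivative:
  "(p has_derivative (\<lambda>h. h \<bullet> - ((transpose L ** L) *v (p y *\<^sub>R y - H *v mom y)))) (at y)"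
proof (rule has_derivative_quadratic_bound[where K="c * (norm L)\<^sup>2"])
  let ?G = "(transpose L ** L) *v (p y *\<^sub>R y - H *v mom y)"
  show "bounded_linear (\<lambda>h. h \<bullet> - ?G)"
    by (intro bounded_linear_inner_left)
  fix h :: "real^'m"
  have inner: "(L *v v) \<bullet> (L *v h) = h \<bullet> ((transpose L ** L) *v v)" for v
    by (simp add: inner_matrix_vector inner_commute[of "L *v v"] flip: matrix_vector_mul_assoc)
      (simp add: inner_matrix_vector inner_commute)
  define D where "D = (\<lambda>x. \<phi> x y * ((L *v (y - H *v x)) \<bullet> (L *v h)))"
  have D_eq: "D x = h \<bullet> ((transpose L ** L) *v (\<phi> x y *\<^sub>R y - H *v (\<phi> x y *\<^sub>R x)))" for x
    by (simp add: D_def inner matrix_vector_mult_scaleR flip: scaleR_diff_right)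
  have vec: "integrable P (\<lambda>x. \<phi> x y *\<^sub>R y - H *v (\<phi> x y *\<^sub>R x))"
    "(\<integral>x. \<phi> x y *\<^sub>R y - H *v (\<phi> x y *\<^sub>R x) \<partial>P) = p y *\<^sub>R y - H *v mom y"
    using integrable_\<phi>[of y] integrable_mom[of y]
      integrable_bounded_linear[OF matrix_vector_mul_bounded_linear[of H] integrable_mom[of y]]
      integral_bounded_linear[OF matrix_vector_mul_bounded_linear[of H] integrable_mom[of y]]
    by (simp_all add: p_def mom_def)
  have bl: "bounded_linear (\<lambda>v. h \<bullet> ((transpose L ** L) *v v))"
    by (rule bounded_linear_compose[OF bounded_linear_inner_right matrix_vector_mul_bounded_linear])
  have D: "integrable P D" "(\<integral>x. D x \<partial>P) = h \<bullet> ?G"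
    using integrable_bounded_linear[OF bl vec(1)] integral_bounded_linear[OF bl vec(1)]
    by (simp_all add: D_eq[abs_def] vec(2))
  have "p (y + h) - p y - h \<bullet> - ?G = (\<integral>x. \<phi> x (y + h) - \<phi> x y + D x \<partial>P)"
    by (simp add: p_def D integrable_\<phi>)
  also have "\<bar>\<dots>\<bar> \<le> (\<integral>x. \<bar>\<phi> x (y + h) - \<phi> x y + D x\<bar> \<partial>P)"
    by (rule integral_abs_bound)
  also have "\<dots> \<le> (\<integral>x. c * (norm L)\<^sup>2 * (norm h)\<^sup>2 \<partial>P)"
    using \<phi>_taylor D(1) integrable_\<phi> by (intro integral_mono) (auto simp: D_def)
  finally show "\<bar>p (y + h) - p y - h \<bullet> - ?G\<bar> \<le> c * (norm L)\<^sup>2 * (norm h)\<^sup>2"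
    by (simp add: P.prob_space[simplified])
qed

lemma continuous_p: "continuous_on UNIV p"
  using p_has_derivative by (auto intro!: has_derivative_continuous continuous_at_imp_continuous_on)

lemma measurable_p [measurable]: "p \<in> borel_measurable borel"
  by (rule borel_measurable_continuous_onI[OF continuous_p])

lemma distributed_V: "distributed M lborel V (\<lambda>y. ennreal (p y))"
  unfolding distributed_def
proof (intro conjI)
  show "distr M lborel V = density lborel (\<lambda>y. ennreal (p y))"
  proof (rule measure_eqI)
    fix A assume "A \<in> sets (distr M lborel V)"
    then have A: "A \<in> sets borel" by simp
    have "emeasure (distr M lborel V) A = emeasure M {\<omega> \<in> space M. V \<omega> \<in> A \<and> X0 \<omega> \<in> UNIV}"
      using A by (subst emeasure_distr) (auto intro!: arg_cong[where f="emeasure M"])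
    also have "\<dots> = (\<integral>\<^sup>+y\<in>A. ennreal (p y) \<partial>lborel)"
      using joint[OF A, of UNIV, folded \<phi>_def] by (simp add: nn_integral_\<phi>)
    finally show "emeasure (distr M lborel V) A = emeasure (density lborel (\<lambda>y. ennreal (p y))) A"
      using A by (simp add: emeasure_density)
  qed simp
qed auto

lemma distr_V: "distr M borel V = density lborel (\<lambda>y. ennreal (p y))"
  using distributed_distr_eq_density[OF distributed_V] by (simp cong: distr_cong)

lemma AE_distr_V: "(AE y in distr M borel V. Q y) \<longleftrightarrow> (AE y in lborel. Q y)"
  unfolding distr_V by (subst AE_density) (auto simp: p_pos)

lemma is_continuous_density_p: "is_continuous_density M V p"
  using continuous_p p_pos distributed_V by (auto simp: is_continuous_density_def less_imp_le)

lemma continuous_density_unique: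
  assumes "is_continuous_density M V q"
  shows "q = p"
proof (rule continuous_AE_eq)
  have q: "continuous_on UNIV q" "\<And>y. 0 \<le> q y" "distributed M lborel V (\<lambda>y. ennreal (q y))"
    using assms by (auto simp: is_continuous_density_def)
  then have [measurable]: "q \<in> borel_measurable borel"
    by (intro borel_measurable_continuous_onI)
  have "density lborel (\<lambda>y. ennreal (q y)) = density lborel (\<lambda>y. ennreal (p y))"
    using distributed_distr_eq_density[OF q(3)] distributed_distr_eq_density[OF distributed_V] by simp
  then have "AE y in lborel. ennreal (q y) = ennreal (p y)"
    by (subst (asm) sigma_finite_measure.density_unique_iff[OF sigma_finite_lborel]) auto
  then show "AE y in lborel. q y = p y"
    by eventually_elim (use q(2) p_pos in \<open>auto simp: less_imp_le\<close>)
  show "continuous_on UNIV q" by fact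
qed (rule continuous_p)

lemma is_conditional_law_\<kappa>: "is_conditional_law M X0 V \<kappa>"
  unfolding is_conditional_law_def
proof (intro conjI ballI)
  have em: "emeasure (\<kappa> y) C = (\<integral>\<^sup>+x. ennreal (\<phi> x y / p y) * indicator C x \<partial>P)" if "C \<in> sets borel" for y C
    using that unfolding \<kappa>_def by (subst emeasure_density) auto
  have prob: "prob_space (\<kappa> y)" for y
  proof
    have "emeasure (\<kappa> y) (space (\<kappa> y)) = (\<integral>\<^sup>+x. ennreal (1 / p y) * ennreal (\<phi> x y) \<partial>P)"
      unfolding \<kappa>_def using p_pos \<phi>_pos
      by (subst emeasure_density) (auto intro!: nn_integral_cong simp: less_imp_le simp flip: ennreal_mult)
    also have "\<dots> = ennreal (1 / p y) * ennreal (p y)"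
      by (simp add: nn_integral_cmult nn_integral_\<phi>)
    also have "\<dots> = 1"
      using p_pos[of y] by (simp flip: ennreal_mult)
    finally show "emeasure (\<kappa> y) (space (\<kappa> y)) = 1" .
  qed
  show "\<kappa> \<in> measurable borel (prob_algebra borel)"
  proof (rule measurable_prob_algebraI)
    show "prob_space (\<kappa> y)" for y by (rule prob)
    show "\<kappa> \<in> measurable borel (subprob_algebra borel)"
    proof (rule measurable_subprob_algebra)
      show "subprob_space (\<kappa> y)" for y by (intro prob_space_imp_subprob_space prob)
      show "sets (\<kappa> y) = sets borel" for y by (simp add: \<kappa>_def)
      fix C :: "(real^'m) set" assume [measurable]: "C \<in> sets borel"
      show "(\<lambda>y. emeasure (\<kappa> y) C) \<in> borel_measurable borel"
        by (simp add: em) measurable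
    qed
  qed
  fix A C :: "(real^'m) set" assume A [measurable]: "A \<in> sets borel" and C [measurable]: "C \<in> sets borel"
  have "(\<integral>\<^sup>+y\<in>A. emeasure (\<kappa> y) C \<partial>distr M borel V)
      = (\<integral>\<^sup>+y. ennreal (p y) * (emeasure (\<kappa> y) C * indicator A y) \<partial>lborel)"
    unfolding distr_V em[OF C] by (subst nn_integral_density) auto
  also have "\<dots> = (\<integral>\<^sup>+y\<in>A. (\<integral>\<^sup>+x\<in>C. ennreal (\<phi> x y) \<partial>P) \<partial>lborel)"
  proof (intro nn_integral_cong)
    fix y
    have "ennreal (p y) * emeasure (\<kappa> y) C = (\<integral>\<^sup>+x. ennreal (p y) * (ennreal (\<phi> x y / p y) * indicator C x) \<partial>P)"
      unfolding em[OF C] by (subst nn_integral_cmult) auto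
    also have "\<dots> = (\<integral>\<^sup>+x\<in>C. ennreal (\<phi> x y) \<partial>P)"
    proof (intro nn_integral_cong)
      fix x
      have "ennreal (p y) * ennreal (\<phi> x y / p y) = ennreal (\<phi> x y)"
        using p_pos[of y] \<phi>_pos[of x y] by (simp flip: ennreal_mult)
      then show "ennreal (p y) * (ennreal (\<phi> x y / p y) * indicator C x) = ennreal (\<phi> x y) * indicator C x"
        by (simp flip: mult.assoc)
    qed
    finally show "ennreal (p y) * (emeasure (\<kappa> y) C * indicator A y) = (\<integral>\<^sup>+x\<in>C. ennreal (\<phi> x y) \<partial>P) * indicator A y"
      by (simp flip: mult.assoc)
  qed
  also have "\<dots> = emeasure M {\<omega> \<in> space M. V \<omega> \<in> A \<and> X0 \<omega> \<in> C}"
    unfolding \<phi>_def by (rule joint[OF A C, symmetric])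
  finally show "emeasure M {\<omega> \<in> space M. V \<omega> \<in> A \<and> X0 \<omega> \<in> C} = (\<integral>\<^sup>+y\<in>A. emeasure (\<kappa> y) C \<partial>distr M borel V)" ..
qed

lemma mean_\<kappa>: "integrable (\<kappa> y) (\<lambda>x. x)" "(LINT x|\<kappa> y. x) = (1 / p y) *\<^sub>R mom y"
proof -
  have eq: "(\<phi> x y / p y) *\<^sub>R x = (1 / p y) *\<^sub>R (\<phi> x y *\<^sub>R x)" for x
    by simp
  show "integrable (\<kappa> y) (\<lambda>x. x)"
    unfolding \<kappa>_def using p_pos[of y] \<phi>_pos integrable_mom[of y]
    by (subst integrable_density) (auto simp: eq less_imp_le simp del: scaleR_scaleR)
  show "(LINT x|\<kappa> y. x) = (1 / p y) *\<^sub>R mom y"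
    unfolding \<kappa>_def using p_pos[of y] \<phi>_pos
    by (subst integral_density) (auto simp: eq mom_def less_imp_le simp del: scaleR_scaleR)
qed

lemma gradient_ln_p:
  "GDERIV (\<lambda>z. ln (p z)) y :> - ((transpose L ** L) *v (y - H *v (LINT x|\<kappa> y. x)))"
proof -
  have "((\<lambda>z. ln (p z)) has_derivative (\<lambda>h. (h \<bullet> - ((transpose L ** L) *v (p y *\<^sub>R y - H *v mom y))) * (1 / p y))) (at y)"
    using has_derivative_ln[OF p_pos p_has_derivative] by (simp only: divide_inverse mult_1_left)
  moreover have "- ((transpose L ** L) *v (y - H *v (LINT x|\<kappa> y. x)))
      = (1 / p y) *\<^sub>R - ((transpose L ** L) *v (p y *\<^sub>R y - H *v mom y))"
    using p_pos[of y] unfolding mean_\<kappa>(2)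
    by (simp add: matrix_vector_mult_scaleR matrix_vector_mult_diff_distrib scaleR_diff_right)
  ultimately show ?thesis
    unfolding gderiv_def by (simp add: mult.commute)
qed

text \<open>For \<open>p\<close> and \<kappa> the formula holds at every \<open>y\<close>. A
  continuous density equals \<open>p\<close> everywhere, while \<kappa>' equals \<kappa> off a null
  set of the law of \<open>V\<close>, which is Lebesgue null because \<open>p\<close> is
  positive.\<close>

lemma tweedie:
  assumes "is_continuous_density M V q" and \<kappa>': "is_conditional_law M X0 V \<kappa>'"
  shows "AE y in lborel. integrable (\<kappa>' y) (\<lambda>x. x) \<and> 0 < q y \<and>
    GDERIV (\<lambda>z. ln (q z)) y :> - ((transpose L ** L) *v (y - H *v (LINT x|\<kappa>' y. x)))"
proof -
  have "AE y in lborel. \<kappa>' y = \<kappa> y"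
    using conditional_law_unique[OF prob_space_axioms V \<kappa>' is_conditional_law_\<kappa>] by (simp only: AE_distr_V)
  then show ?thesis
    unfolding continuous_density_unique[OF assms(1)]
    by eventually_elim (simp only: mean_\<kappa>(1) p_pos gradient_ln_p simp_thms)
qed

end

section \<open>From the characteristic function to the joint law\<close>

text \<open>For fixed \<open>C\<close> the law of \<open>N\<close> restricted to the event that
  \<open>X0\<close> lies in \<open>C\<close> is compared with a multiple of the Gaussian measure.
  These are finite measures of mass \<open>r\<close>, so there is no division by \<open>r\<close>
  and events of probability \<open>0\<close> need no separate case. Rectangles then determine the
  joint law.\<close>

lemma (in prob_space) joint_law_of_char:
  fixes X0 N :: "'a \<Rightarrow> real^'m"
  assumes [measurable]: "X0 \<in> borel_measurable M" "N \<in> borel_measurable M"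
    and char: "\<And>C \<theta>. C \<in> sets borel \<Longrightarrow> expectation (\<lambda>\<omega>. indicator C (X0 \<omega>) *\<^sub>R cis (\<theta> \<bullet> N \<omega>))
      = prob (X0 -` C \<inter> space M) *\<^sub>R complex_of_real (exp (- (norm \<theta>)\<^sup>2 / 2))"
  shows "distr M (borel \<Otimes>\<^sub>M borel) (\<lambda>\<omega>. (X0 \<omega>, N \<omega>)) = distr M borel X0 \<Otimes>\<^sub>M gauss_measure"
proof (rule pair_measure_eqI[symmetric])
  interpret G: prob_space "gauss_measure :: (real^'m) measure" by (rule prob_space_gauss_measure)
  interpret P: prob_space "distr M borel X0" by (rule prob_space_distr) simp
  show "sigma_finite_measure (distr M borel X0)" ..
  show "sigma_finite_measure (gauss_measure :: (real^'m) measure)" ..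
  show "sets (distr M borel X0 \<Otimes>\<^sub>M gauss_measure) = sets (distr M (borel \<Otimes>\<^sub>M borel) (\<lambda>\<omega>. (X0 \<omega>, N \<omega>)))"
    by (simp cong: sets_pair_measure_cong)
  fix C A assume "C \<in> sets (distr M borel X0)" "A \<in> sets (gauss_measure :: (real^'m) measure)"
  then have C [measurable]: "C \<in> sets borel" and A [measurable]: "A \<in> sets borel" by auto
  define r where "r = prob (X0 -` C \<inter> space M)"
  define \<mu> where "\<mu> = distr (density M (\<lambda>\<omega>. ennreal (indicator C (X0 \<omega>)))) borel N"
  define \<nu> where "\<nu> = density (gauss_measure :: (real^'m) measure) (\<lambda>_. ennreal r)"
  have r: "r \<ge> 0" by (simp add: r_def)
  have em\<mu>: "emeasure \<mu> S = emeasure M (X0 -` C \<inter> N -` S \<inter> space M)" if [measurable]: "S \<in> sets borel" for S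
  proof -
    have "emeasure \<mu> S = (\<integral>\<^sup>+\<omega>. ennreal (indicator C (X0 \<omega>)) * indicator (N -` S \<inter> space M) \<omega> \<partial>M)"
      unfolding \<mu>_def by (subst emeasure_distr) (simp_all add: emeasure_density)
    also have "\<dots> = (\<integral>\<^sup>+\<omega>. indicator (X0 -` C \<inter> N -` S \<inter> space M) \<omega> \<partial>M)"
      by (intro nn_integral_cong) (auto simp: indicator_def)
    also have "\<dots> = emeasure M (X0 -` C \<inter> N -` S \<inter> space M)"
      by (intro nn_integral_indicator) measurable
    finally show ?thesis .
  qed
  have "\<mu> = \<nu>"
  proof (rule char_uniqueness)
    show "finite_measure \<mu>"
      by standard (simp add: em\<mu>[of UNIV, simplified] \<mu>_def[THEN arg_cong[where f=space], simplified])
    show "finite_measure \<nu>"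
      by standard (simp add: \<nu>_def emeasure_density ennreal_mult_eq_top_iff)
    show "sets \<mu> = sets borel" "sets \<nu> = sets borel"
      by (simp_all add: \<mu>_def \<nu>_def)
    fix \<theta> :: "real^'m"
    have "(\<integral>x. cis (\<theta> \<bullet> x) \<partial>\<mu>) = expectation (\<lambda>\<omega>. indicator C (X0 \<omega>) *\<^sub>R cis (\<theta> \<bullet> N \<omega>))"
      unfolding \<mu>_def by (subst integral_distr) (simp_all add: integral_density)
    also have "\<dots> = r *\<^sub>R complex_of_real (exp (- (norm \<theta>)\<^sup>2 / 2))"
      unfolding r_def by (rule char[OF C])
    also have "\<dots> = (\<integral>x. cis (\<theta> \<bullet> x) \<partial>\<nu>)"
      unfolding \<nu>_def using r by (subst integral_density) (simp_all add: integral_gauss_measure_cis)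
    finally show "(\<integral>x. cis (\<theta> \<bullet> x) \<partial>\<mu>) = (\<integral>x. cis (\<theta> \<bullet> x) \<partial>\<nu>)" .
  qed
  have "emeasure (distr M borel X0) C * emeasure gauss_measure A = ennreal r * emeasure gauss_measure A"
    by (simp add: emeasure_distr r_def emeasure_eq_measure)
  also have "\<dots> = emeasure \<nu> A"
    unfolding \<nu>_def by (subst emeasure_density) (simp_all add: nn_integral_cmult)
  also have "\<dots> = emeasure M (X0 -` C \<inter> N -` A \<inter> space M)"
    unfolding \<open>\<mu> = \<nu>\<close>[symmetric] by (rule em\<mu>) simp
  also have "\<dots> = emeasure (distr M (borel \<Otimes>\<^sub>M borel) (\<lambda>\<omega>. (X0 \<omega>, N \<omega>))) (C \<times> A)"
    by (subst emeasure_distr) (auto intro!: arg_cong[where f="emeasure M"])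
  finally show "emeasure (distr M borel X0) C * emeasure gauss_measure A
      = emeasure (distr M (borel \<Otimes>\<^sub>M borel) (\<lambda>\<omega>. (X0 \<omega>, N \<omega>))) (C \<times> A)" .
qed

lemma (in prob_space) gaussian_channel_of_char:
  fixes X0 V :: "'a \<Rightarrow> real^'m" and H L :: "real^'m^'m"
  assumes X0 [measurable]: "X0 \<in> borel_measurable M" and V [measurable]: "V \<in> borel_measurable M"
    and H: "invertible H" and L: "invertible L"
    and char: "\<And>C \<theta>. C \<in> sets borel \<Longrightarrow>
      expectation (\<lambda>\<omega>. indicator C (X0 \<omega>) *\<^sub>R cis (\<theta> \<bullet> (L *v (V \<omega> - H *v X0 \<omega>))))
      = prob (X0 -` C \<inter> space M) *\<^sub>R complex_of_real (exp (- (norm \<theta>)\<^sup>2 / 2))"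
  obtains c where "gaussian_channel M X0 V H L c"
proof -
  interpret G: prob_space "gauss_measure :: (real^'m) measure" by (rule prob_space_gauss_measure)
  interpret P: prob_space "distr M borel X0" by (rule prob_space_distr) simp
  interpret PL: pair_sigma_finite "distr M borel X0" "lborel :: (real^'m) measure" ..
  define N where "N = (\<lambda>\<omega>. L *v (V \<omega> - H *v X0 \<omega>))"
  define J where "J = matrix_inv L"
  have JL: "J *v (L *v x) = x" and LJ: "L *v (J *v x) = x" for x
    by (simp_all add: J_def matrix_vector_mul_assoc matrix_inv_left matrix_inv_right L)
  have [measurable]: "N \<in> borel_measurable M"
    unfolding N_def by measurable
  have law: "distr M (borel \<Otimes>\<^sub>M borel) (\<lambda>\<omega>. (X0 \<omega>, N \<omega>)) = distr M borel X0 \<Otimes>\<^sub>M gauss_measure"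
    by (rule joint_law_of_char) (use char in \<open>simp_all add: N_def\<close>)
  obtain k :: real where k: "k > 0" "\<And>f. f \<in> borel_measurable borel \<Longrightarrow>
      (\<integral>\<^sup>+z. f z \<partial>lborel) = ennreal k * (\<integral>\<^sup>+y. f (L *v y) \<partial>(lborel :: (real^'m) measure))"
    using lborel_linear_substitution[of "(*v) L" "(*v) J"] JL LJ by auto
  \<comment> \<open>\<open>k\<close> is the absolute determinant of \<open>L\<close>, known only as
    the constant of the substitution; the other factor normalises the standard Gaussian
    density.\<close>
  define c where "c = k * (1 / sqrt (2 * pi)) ^ DIM(real^'m)"
  let ?\<phi> = "\<lambda>x y. c * exp (- (norm (L *v (y - H *v x)))\<^sup>2 / 2)"
  have inner: "(\<integral>\<^sup>+z. indicator A (H *v x + J *v z) \<partial>gauss_measure) = (\<integral>\<^sup>+y. ennreal (?\<phi> x y) * indicator A y \<partial>lborel)"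
    if [measurable]: "A \<in> sets borel" for A x
  proof -
    have "(\<integral>\<^sup>+z. indicator A (H *v x + J *v z) \<partial>gauss_measure)
        = (\<integral>\<^sup>+z. ennreal (gauss_density 1 z) * indicator A (H *v x + J *v z) \<partial>lborel)"
      unfolding gauss_measure_def by (subst nn_integral_density) auto
    also have "\<dots> = ennreal k * (\<integral>\<^sup>+y. ennreal (gauss_density 1 (L *v y)) * indicator A (H *v x + y) \<partial>lborel)"
      by (subst k(2)) (simp_all add: JL)
    also have "\<dots> = (\<integral>\<^sup>+y. ennreal k * (ennreal (gauss_density 1 (L *v y)) * indicator A (H *v x + y)) \<partial>lborel)"
      by (simp add: nn_integral_cmult)
    also have "\<dots> = (\<integral>\<^sup>+y. ennreal (?\<phi> x (H *v x + y)) * indicator A (H *v x + y) \<partial>lborel)"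
      using k(1) by (intro nn_integral_cong) (simp add: gauss_density_eq c_def ennreal_mult mult_ac)
    also have "\<dots> = (\<integral>\<^sup>+y. ennreal (?\<phi> x y) * indicator A y \<partial>distr lborel borel ((+) (H *v x)))"
      by (subst nn_integral_distr) simp_all
    finally show ?thesis
      by (simp only: lborel_distr_plus)
  qed
  have "gaussian_channel M X0 V H L c"
  proof
    show "c > 0" using k(1) by (simp add: c_def)
    fix A C :: "(real^'m) set" assume A [measurable]: "A \<in> sets borel" and C [measurable]: "C \<in> sets borel"
    have V_eq: "V \<omega> = H *v X0 \<omega> + J *v N \<omega>" for \<omega>
      by (simp add: N_def JL)
    let ?f = "\<lambda>(x, z). indicator C x * indicator A (H *v x + J *v z) :: ennreal"
    have "emeasure M {\<omega> \<in> space M. V \<omega> \<in> A \<and> X0 \<omega> \<in> C} = (\<integral>\<^sup>+\<omega>. indicator {\<omega> \<in> space M. V \<omega> \<in> A \<and> X0 \<omega> \<in> C} \<omega> \<partial>M)"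
      by (intro nn_integral_indicator[symmetric]) measurable
    also have "\<dots> = (\<integral>\<^sup>+\<omega>. ?f (X0 \<omega>, N \<omega>) \<partial>M)"
      by (intro nn_integral_cong) (auto simp: indicator_def simp flip: V_eq)
    also have "\<dots> = (\<integral>\<^sup>+w. ?f w \<partial>distr M (borel \<Otimes>\<^sub>M borel) (\<lambda>\<omega>. (X0 \<omega>, N \<omega>)))"
      by (rule nn_integral_distr[symmetric]) measurable
    also have "\<dots> = (\<integral>\<^sup>+x. (\<integral>\<^sup>+z. ?f (x, z) \<partial>gauss_measure) \<partial>distr M borel X0)"
      unfolding law by (rule G.nn_integral_fst[symmetric]) measurable
    also have "\<dots> = (\<integral>\<^sup>+x. (\<integral>\<^sup>+y. indicator C x * (ennreal (?\<phi> x y) * indicator A y) \<partial>lborel) \<partial>distr M borel X0)"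
      by (intro nn_integral_cong) (simp add: nn_integral_cmult inner)
    also have "\<dots> = (\<integral>\<^sup>+y. (\<integral>\<^sup>+x. indicator C x * (ennreal (?\<phi> x y) * indicator A y) \<partial>distr M borel X0) \<partial>lborel)"
      by (rule PL.Fubini'[symmetric]) measurable
    also have "\<dots> = (\<integral>\<^sup>+y. (\<integral>\<^sup>+x. (ennreal (?\<phi> x y) * indicator C x) * indicator A y \<partial>distr M borel X0) \<partial>lborel)"
      by (simp add: mult_ac)
    also have "\<dots> = (\<integral>\<^sup>+y\<in>A. (\<integral>\<^sup>+x\<in>C. ennreal (?\<phi> x y) \<partial>distr M borel X0) \<partial>lborel)"
      by (subst nn_integral_multc) simp_all
    finally show "emeasure M {\<omega> \<in> space M. V \<omega> \<in> A \<and> X0 \<omega> \<in> C}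
        = (\<integral>\<^sup>+y\<in>A. (\<integral>\<^sup>+x\<in>C. ennreal (?\<phi> x y) \<partial>distr M borel X0) \<partial>lborel)" .
  qed (use assms in auto)
  then show thesis by (rule that)
qed

text \<open>If the form vanished at \<open>x\<close>, moving from \<open>x\<close> in the direction
  \<open>- (\<gamma> *v x)\<close> would change it by a negative term of first order, which for
  small steps outweighs the second order.\<close>

lemma psd_invertible_pos:
  fixes \<gamma> :: "real^'m^'m"
  assumes sym: "transpose \<gamma> = \<gamma>" and psd: "\<And>x. x \<bullet> (\<gamma> *v x) \<ge> 0" and inv: "invertible \<gamma>" and x: "x \<noteq> 0"
  shows "x \<bullet> (\<gamma> *v x) > 0"
proof (rule ccontr)
  assume "\<not> ?thesis"
  then have 0: "x \<bullet> (\<gamma> *v x) = 0" using psd[of x] by simp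
  define w where "w = \<gamma> *v x"
  have "matrix_inv \<gamma> *v w = x"
    by (simp add: w_def matrix_vector_mul_assoc matrix_inv_left inv)
  then have w: "w \<noteq> 0" using x by auto
  define q r where "q = w \<bullet> (\<gamma> *v w)" and "r = w \<bullet> w"
  have r: "r > 0" using w by (simp add: r_def)
  have q: "q \<ge> 0" unfolding q_def by (rule psd)
  have xw: "x \<bullet> (\<gamma> *v w) = r"
    using inner_matrix_vector[of x \<gamma> w] by (simp add: sym r_def w_def)
  \<comment> \<open>Small enough that \<open>t * q\<close> is at least \<open>- r\<close>; the
    summand \<open>1\<close> covers \<open>q = 0\<close>.\<close>
  define t where "t = - r / (q + 1)"
  have "0 \<le> (x + t *\<^sub>R w) \<bullet> (\<gamma> *v (x + t *\<^sub>R w))" by (rule psd)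
  also have "\<dots> = 2 * t * r + t\<^sup>2 * q"
    using 0 xw by (simp add: matrix_vector_right_distrib matrix_vector_mult_scaleR inner_add_left inner_add_right
        r_def q_def power2_eq_square distrib_left flip: w_def)
  also have "\<dots> \<le> t * r"
  proof -
    have "- r \<le> t * q"
      using q r by (simp add: t_def pos_divide_le_eq algebra_simps)
    then have "t * (t * q) \<le> t * (- r)"
      using q r by (intro mult_left_mono_neg) (simp_all add: t_def)
    then show ?thesis
      by (simp add: power2_eq_square mult_ac)
  qed
  also have "\<dots> < 0"
    using r q by (simp add: t_def)
  finally show False by simp
qed

section \<open>The law of the solution\<close>

context linear_ode
begin

text \<open>The difference of indicators is the indicator of a half-open grid cell, and for
  \<open>s > 0\<close> exactly one cell contains \<open>s\<close>. The sum is thus the step function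
  with the values of \<open>g\<close> at right end points.\<close>

lemma sum_grid_eq:
  fixes g :: "real \<Rightarrow> 'b::real_vector"
  assumes s: "0 < s" "s \<le> T" and n: "n > 0"
  obtains r where "r \<in> {0..T}" "\<bar>r - s\<bar> \<le> T / real n"
    "(\<Sum>i<n. (indicator {0..grid n (Suc i)} s - indicator {0..grid n i} s) *\<^sub>R g (grid n (Suc i))) = g r"
proof -
  have mono: "grid n i \<le> grid n j" if "i \<le> j" for i j
    using that T by (simp add: divide_right_mono)
  define k where "k = (LEAST i. s \<le> grid n i)"
  have nn: "s \<le> grid n n" using s n by simp
  have k: "s \<le> grid n k" "k \<le> n"
    using LeastI[of "\<lambda>i. s \<le> grid n i" n] Least_le[of "\<lambda>i. s \<le> grid n i" n] nn
    by (simp_all add: k_def)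
  have "k \<noteq> 0" using k(1) s(1) by (cases k) auto
  then obtain l where l: "k = Suc l" by (cases k) auto
  have less: "grid n l < s"
    using not_less_Least[of l "\<lambda>i. s \<le> grid n i"] l by (simp add: k_def)
  show thesis
  proof (rule that[of "grid n k"])
    show "grid n k \<in> {0..T}" by (rule grid_mem[OF k(2)])
    show "\<bar>grid n k - s\<bar> \<le> T / real n"
      using less k(1) grid_Suc[of l n] unfolding l by linarith
    have "(indicator {0..grid n (Suc i)} s - indicator {0..grid n i} s) *\<^sub>R g (grid n (Suc i))
        = (if i = l then g (grid n k) else 0)" if "i < n" for i
    proof (cases i l rule: linorder_cases)
      case less
      then show ?thesis
        using mono[of i l] mono[of "Suc i" l] \<open>grid n l < s\<close> by (simp add: indicator_def del: of_nat_Suc)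
    next
      case equal
      then show ?thesis
        using k(1) less s by (simp add: indicator_def l del: of_nat_Suc)
    next
      case greater
      then show ?thesis
        using mono[of k i] mono[of k "Suc i"] k(1) s by (simp add: indicator_def l del: of_nat_Suc)
    qed
    then have "(\<Sum>i<n. (indicator {0..grid n (Suc i)} s - indicator {0..grid n i} s) *\<^sub>R g (grid n (Suc i)))
        = (\<Sum>i<n. if i = l then g (grid n k) else 0)"
      by (intro sum.cong refl) (simp only: lessThan_iff)
    then show "(\<Sum>i<n. (indicator {0..grid n (Suc i)} s - indicator {0..grid n i} s) *\<^sub>R g (grid n (Suc i))) = g (grid n k)"
      using k(2) l by (simp del: of_nat_Suc)
  qed
qed

lemma tendsto_sum_grid:
  fixes g :: "real \<Rightarrow> 'b::real_normed_vector"
  assumes s: "0 < s" "s \<le> T" and g: "continuous_on {0..T} g"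
  shows "(\<lambda>n. \<Sum>i<n. (indicator {0..grid n (Suc i)} s - indicator {0..grid n i} s) *\<^sub>R g (grid n (Suc i))) \<longlonglongrightarrow> g s"
proof -
  define Q where "Q n r \<longleftrightarrow> r \<in> {0..T} \<and> \<bar>r - s\<bar> \<le> T / real n \<and>
    (\<Sum>i<n. (indicator {0..grid n (Suc i)} s - indicator {0..grid n i} s) *\<^sub>R g (grid n (Suc i))) = g r" for n r
  have "\<exists>r. Q n r" if "n > 0" for n
    by (rule sum_grid_eq[OF s that, of g]) (auto simp only: Q_def)
  then obtain r where "\<And>n. n > 0 \<Longrightarrow> Q n (r n)"
    by metis
  then have r: "\<And>n. n > 0 \<Longrightarrow> r n \<in> {0..T}" "\<And>n. n > 0 \<Longrightarrow> \<bar>r n - s\<bar> \<le> T / real n"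
    "\<And>n. n > 0 \<Longrightarrow> (\<Sum>i<n. (indicator {0..grid n (Suc i)} s - indicator {0..grid n i} s) *\<^sub>R g (grid n (Suc i))) = g (r n)"
    unfolding Q_def by blast+
  have ev: "eventually (\<lambda>n::nat. n > 0) sequentially" by (rule eventually_gt_at_top)
  have "(\<lambda>n. T / real n) \<longlonglongrightarrow> 0"
    using tendsto_mult[OF tendsto_const lim_1_over_n, of T] by simp
  then have "(\<lambda>n. r n - s) \<longlonglongrightarrow> 0"
    by (rule Lim_null_comparison[rotated])
      (simp only: real_norm_def, rule eventually_mono[OF ev], rule r(2))
  then have "r \<longlonglongrightarrow> s"
    by (simp only: LIM_zero_iff)
  then have "(\<lambda>n. g (r n)) \<longlonglongrightarrow> g s"
    by (rule continuous_on_tendsto_compose[OF g]) (use s eventually_mono[OF ev r(1)] in auto)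
  then show ?thesis
    by (rule tendsto_cong[THEN iffD2, rotated]) (rule eventually_mono[OF ev], rule r(3))
qed

lemma norm_sum_grid_le:
  fixes g :: "real \<Rightarrow> 'b::real_normed_vector"
  assumes K: "\<And>r. r \<in> {0..T} \<Longrightarrow> norm (g r) \<le> K" and s: "s \<in> {0..T}"
  shows "norm (\<Sum>i<n. (indicator {0..grid n (Suc i)} s - indicator {0..grid n i} s) *\<^sub>R g (grid n (Suc i))) \<le> K"
\<comment> \<open>At \<open>s = 0\<close> every interval \<open>{0..grid n i}\<close> contains
  \<open>s\<close>, so all differences cancel; for \<open>n = 0\<close> the sum is empty.\<close>
proof (cases "s = 0 \<or> n = 0")
  case True
  have "K \<ge> 0"
    using order_trans[OF norm_ge_zero K[of 0]] T by simp
  then show ?thesis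
    using True T by (auto simp: indicator_def)
next
  case False
  show ?thesis
  proof (rule sum_grid_eq[of s n g])
    fix r assume "r \<in> {0..T}"
      "(\<Sum>i<n. (indicator {0..grid n (Suc i)} s - indicator {0..grid n i} s) *\<^sub>R g (grid n (Suc i))) = g r"
    then show ?thesis
      by (simp only: K)
  qed (use s False in auto)
qed

end

section \<open>The noise term of the linear equation and its law\<close>

locale linear_sde =
  linear_ode T b Y + brownian_with_initial M T B X0
  for M :: "'a measure" and T :: real and b :: "real \<Rightarrow> real^'m^'m" and \<sigma> :: "real \<Rightarrow> real^'d^'m"
    and B :: "real \<Rightarrow> 'a \<Rightarrow> real^'d" and X0 :: "'a \<Rightarrow> real^'m" and X :: "real \<Rightarrow> 'a \<Rightarrow> real^'m"
    and Y :: "real \<Rightarrow> real^'m^'m" +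
  assumes \<sigma> [measurable]: "\<sigma> \<in> borel_measurable (lebesgue_on {0..T})"
    and \<sigma>2: "integrable (lebesgue_on {0..T}) (\<lambda>t. (norm (\<sigma> t))\<^sup>2)"
    and sde: "solves_linear_sde M T b \<sigma> B X0 X"
begin

definition "cov_density r = R r ** \<sigma> r ** transpose (\<sigma> r) ** transpose (R r)"

text \<open>The covariance matrix of \<open>noise\<close>; applying \<open>Y T\<close> to the noise
  turns it into \<gamma>.\<close>

definition "\<Gamma> = (LINT r|lebesgue_on {0..T}. cov_density r)"

lemma measurable_R [measurable]: "R \<in> borel_measurable (lebesgue_on {0..T})"
  by (intro continuous_imp_measurable_on_sets_lebesgue continuous_R) simp

lemma R_bounded: obtains K where "K > 0" "\<And>t. t \<in> {0..T} \<Longrightarrow> norm (R t) \<le> K"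
  using bounded_on[OF continuous_R] that by blast

lemma integrable_cov_density: "integrable (lebesgue_on {0..T}) cov_density"
proof -
  obtain K where K: "K > 0" "\<And>t. t \<in> {0..T} \<Longrightarrow> norm (R t) \<le> K" using R_bounded by blast
  show ?thesis
  proof (rule Bochner_Integration.integrable_bound)
    show "integrable (lebesgue_on {0..T}) (\<lambda>t. K\<^sup>2 * (norm (\<sigma> t))\<^sup>2)"
      using \<sigma>2 by simp
    show "cov_density \<in> borel_measurable (lebesgue_on {0..T})"
      unfolding cov_density_def[abs_def] by measurable
    show "AE t in lebesgue_on {0..T}. norm (cov_density t) \<le> norm (K\<^sup>2 * (norm (\<sigma> t))\<^sup>2)"
    proof (intro AE_I2)
      fix t assume "t \<in> space (lebesgue_on {0..T})"
      then have Rt: "norm (R t) \<le> K" using K(2) by simp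
      have "norm (cov_density t) \<le> norm (R t) * norm (\<sigma> t) * norm (\<sigma> t) * norm (R t)"
        unfolding cov_density_def
        by (intro order_trans[OF norm_matrix_matrix_le mult_mono] order_trans[OF norm_matrix_matrix_le mult_right_mono]) auto
      also have "\<dots> \<le> K * norm (\<sigma> t) * norm (\<sigma> t) * K"
        using Rt K(1) by (intro mult_mono mult_right_mono) auto
      finally show "norm (cov_density t) \<le> norm (K\<^sup>2 * (norm (\<sigma> t))\<^sup>2)"
        by (simp add: power2_eq_square mult_ac)
    qed
  qed
qed

lemma \<Gamma>_form: "\<theta> \<bullet> (\<Gamma> *v \<theta>) = (LINT r|lebesgue_on {0..T}. (norm (transpose (\<sigma> r) *v (transpose (R r) *v \<theta>)))\<^sup>2)"
proof -
  have bl: "bounded_linear (\<lambda>A. \<theta> \<bullet> (A *v \<theta>))"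
    by (rule bounded_linear_compose[OF bounded_linear_inner_right
          bounded_bilinear.bounded_linear_left[OF bounded_bilinear_matrix_vector]])
  have "\<theta> \<bullet> (cov_density r *v \<theta>) = (norm (transpose (\<sigma> r) *v (transpose (R r) *v \<theta>)))\<^sup>2" for r
    by (simp add: cov_density_def inner_matrix_vector power2_norm_eq_inner flip: matrix_vector_mul_assoc)
  then show ?thesis
    using integral_bounded_linear[OF bl integrable_cov_density] by (simp add: \<Gamma>_def)
qed

lemma \<Gamma>_sym: "transpose \<Gamma> = \<Gamma>"
proof -
  have "transpose \<Gamma> = (LINT r|lebesgue_on {0..T}. transpose (cov_density r))"
    unfolding \<Gamma>_def by (rule integral_bounded_linear[OF bounded_linear_transpose integrable_cov_density, symmetric])
  also have "(\<lambda>r. transpose (cov_density r)) = cov_density"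
    by (simp add: cov_density_def matrix_transpose_mul matrix_mul_assoc fun_eq_iff)
  finally show ?thesis
    unfolding \<Gamma>_def .
qed

lemma measurable_X [measurable]: "t \<in> {0..T} \<Longrightarrow> X t \<in> borel_measurable M"
  using sde by (simp add: solves_linear_sde_def)

text \<open>By variation of constants this is the stochastic integral of
  \<open>R r ** \<sigma> r\<close> over \<open>{0..T}\<close>, expressed without such an
  integral.\<close>

definition "noise \<omega> = R T *v X T \<omega> - X0 \<omega>"

lemma measurable_noise [measurable]: "noise \<in> borel_measurable M"
  unfolding noise_def[abs_def] using T
  by (intro borel_measurable_diff measurable_matrix_vector borel_measurable_const measurable_X X0) auto

text \<open>A version is chosen for each \<open>t\<close> separately, with no path regularity in
  \<open>t\<close>. It is therefore evaluated only at grid points.\<close>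

definition "I t = (SOME I. has_stochastic_integral M B \<sigma> t I \<and>
   (AE \<omega> in M. X t \<omega> = X0 \<omega> + (LINT s|lebesgue_on {0..t}. b s *v X s \<omega>) + I \<omega>))"

lemma I:
  assumes "t \<in> {0..T}"
  shows "has_stochastic_integral M B \<sigma> t (I t)"
    "AE \<omega> in M. X t \<omega> = X0 \<omega> + (LINT s|lebesgue_on {0..t}. b s *v X s \<omega>) + I t \<omega>"
proof -
  have "\<exists>I. has_stochastic_integral M B \<sigma> t I \<and>
    (AE \<omega> in M. X t \<omega> = X0 \<omega> + (LINT s|lebesgue_on {0..t}. b s *v X s \<omega>) + I \<omega>)"
    using sde assms by (simp add: solves_linear_sde_def)
  from someI_ex[OF this] show "has_stochastic_integral M B \<sigma> t (I t)"
    "AE \<omega> in M. X t \<omega> = X0 \<omega> + (LINT s|lebesgue_on {0..t}. b s *v X s \<omega>) + I t \<omega>"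
    unfolding I_def by blast+
qed

definition "riemann_sum n \<omega> = (\<Sum>i<n. R (grid n (Suc i)) *v (I (grid n (Suc i)) \<omega> - I (grid n i) \<omega>))"

lemma riemann_sum_tendsto_noise: "AE \<omega> in M. (\<lambda>n. riemann_sum n \<omega>) \<longlonglongrightarrow> noise \<omega>"
proof -
  \<comment> \<open>All grids together have countably many points, so one null set serves the
    integral equation at all of them.\<close>
  have "AE \<omega> in M. \<forall>n. \<forall>i\<in>{..n}. X (grid n i) \<omega> = X0 \<omega> + (LINT s|lebesgue_on {0..grid n i}. b s *v X s \<omega>) + I (grid n i) \<omega>"
    unfolding AE_all_countable using I(2) grid_mem by (intro allI AE_ball_countable[THEN iffD2] ballI) auto
  moreover have "AE \<omega> in M. continuous_on {0..T} (\<lambda>t. X t \<omega>)" "AE \<omega> in M. X 0 \<omega> = X0 \<omega>"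
    "AE \<omega> in M. integrable (lebesgue_on {0..T}) (\<lambda>s. b s *v X s \<omega>)"
    using sde by (simp_all add: solves_linear_sde_def)
  ultimately show ?thesis
  proof eventually_elim
    case (elim \<omega>)
    have "I (grid n i) \<omega> = X (grid n i) \<omega> - X 0 \<omega> - (LINT s|lebesgue_on {0..grid n i}. b s *v X s \<omega>)" if "i \<le> n" for n i
      using elim(1,3) that by simp
    then have "riemann_sum n \<omega> = (\<Sum>i<n. R (grid n (Suc i)) *v
      ((X (grid n (Suc i)) \<omega> - X 0 \<omega> - (LINT s|lebesgue_on {0..grid n (Suc i)}. b s *v X s \<omega>)) -
       (X (grid n i) \<omega> - X 0 \<omega> - (LINT s|lebesgue_on {0..grid n i}. b s *v X s \<omega>))))" for n
      unfolding riemann_sum_def by (intro sum.cong refl) (simp del: of_nat_Suc)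
    then show ?case
      using discrete_variation_of_constants[OF elim(2,4)] elim(3) by (simp add: noise_def del: of_nat_Suc)
  qed
qed

lemma measurable_riemann_sum [measurable]: "riemann_sum n \<in> borel_measurable M"
proof -
  have I_meas: "I (grid n i) \<in> borel_measurable M" if "i \<le> n" for i
    using I(1)[OF grid_mem[OF that]] by (simp add: has_stochastic_integral_def)
  show ?thesis
    unfolding riemann_sum_def[abs_def]
    by (intro borel_measurable_sum measurable_matrix_vector borel_measurable_diff borel_measurable_const I_meas) auto
qed

lemma char_riemann_sum:
  assumes C: "C \<in> sets borel"
  shows "expectation (\<lambda>\<omega>. indicator C (X0 \<omega>) *\<^sub>R cis (\<theta> \<bullet> riemann_sum n \<omega>))
    = prob (X0 -` C \<inter> space M) *\<^sub>R complex_of_real (exp (- (LINT s|lebesgue_on {0..T}. (norm (transpose (\<sigma> s) *v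
      (\<Sum>i<n. (indicator {0..grid n (Suc i)} s - indicator {0..grid n i} s) *\<^sub>R (transpose (R (grid n (Suc i))) *v \<theta>))))\<^sup>2) / 2))"
proof -
  \<comment> \<open>Each increment of \<open>I\<close> is split into two values with opposite signs,
    the flag marking the right end point, because \<open>char_stochastic_integrals\<close> speaks of
    values at given times.\<close>
  define J where "J = {..<n} \<times> (UNIV :: bool set)"
  define t where "t = (\<lambda>(i, u). if u then grid n (Suc i) else grid n i)"
  define \<eta> where "\<eta> = (\<lambda>(i, u). (if u then 1 else - 1 :: real) *\<^sub>R (transpose (R (grid n (Suc i))) *v \<theta>))"
  have sum_J: "(\<Sum>j\<in>J. f j) = (\<Sum>i<n. f (i, True) + f (i, False))" for f :: "nat \<times> bool \<Rightarrow> 'v::comm_monoid_add"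
    unfolding J_def sum.cartesian_product' by (simp add: UNIV_bool add.commute)
  have t: "t j \<in> {0..T}" if "j \<in> J" for j
    using that grid_mem[of "fst j" n] grid_mem[of "Suc (fst j)" n] by (auto simp: J_def t_def simp del: of_nat_Suc)
  have "expectation (\<lambda>\<omega>. indicator C (X0 \<omega>) *\<^sub>R cis (\<Sum>j\<in>J. \<eta> j \<bullet> I (t j) \<omega>))
    = prob (X0 -` C \<inter> space M) *\<^sub>R complex_of_real (exp (- (LINT s|lebesgue_on {0..T}.
        (norm (\<Sum>j\<in>J. indicator {0..t j} s *\<^sub>R (transpose (\<sigma> s) *v \<eta> j)))\<^sup>2) / 2))"
    using t by (intro char_stochastic_integrals I(1) \<sigma> \<sigma>2 C) (auto simp: J_def)
  also have "(\<lambda>\<omega>. \<Sum>j\<in>J. \<eta> j \<bullet> I (t j) \<omega>) = (\<lambda>\<omega>. \<theta> \<bullet> riemann_sum n \<omega>)"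
    unfolding sum_J riemann_sum_def
    by (simp add: \<eta>_def t_def inner_sum_right inner_matrix_vector inner_diff_right del: of_nat_Suc)
  also have "(\<lambda>s. \<Sum>j\<in>J. indicator {0..t j} s *\<^sub>R (transpose (\<sigma> s) *v \<eta> j))
    = (\<lambda>s. transpose (\<sigma> s) *v (\<Sum>i<n. (indicator {0..grid n (Suc i)} s - indicator {0..grid n i} s) *\<^sub>R
        (transpose (R (grid n (Suc i))) *v \<theta>)))"
  proof
    fix s
    interpret bounded_linear "\<lambda>v. transpose (\<sigma> s) *v v" by (rule matrix_vector_mul_bounded_linear)
    show "(\<Sum>j\<in>J. indicator {0..t j} s *\<^sub>R (transpose (\<sigma> s) *v \<eta> j))
      = transpose (\<sigma> s) *v (\<Sum>i<n. (indicator {0..grid n (Suc i)} s - indicator {0..grid n i} s) *\<^sub>R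
        (transpose (R (grid n (Suc i))) *v \<theta>))"
      unfolding sum_J sum scaleR
      by (intro sum.cong refl) (simp only: \<eta>_def t_def case_prod_conv if_True if_False scaleR,
          simp add: scaleR_diff_left del: of_nat_Suc)
  qed
  finally show ?thesis .
qed

text \<open>Both sides of \<open>char_riemann_sum\<close> converge: the step approximations of
  \<open>R\<close> converge under a bound by its supremum, with the square-integrable \<sigma> as
  dominating factor, and the Riemann sums converge almost surely inside a bounded function.\<close>

lemma char_noise:
  assumes C [measurable]: "C \<in> sets borel"
  shows "expectation (\<lambda>\<omega>. indicator C (X0 \<omega>) *\<^sub>R cis (\<theta> \<bullet> noise \<omega>))
    = prob (X0 -` C \<inter> space M) *\<^sub>R complex_of_real (exp (- (\<theta> \<bullet> (\<Gamma> *v \<theta>)) / 2))"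
proof -
  let ?w = "\<lambda>n s. \<Sum>i<n. (indicator {0..grid n (Suc i)} s - indicator {0..grid n i} s) *\<^sub>R
      (transpose (R (grid n (Suc i))) *v \<theta>)"
  let ?w' = "\<lambda>s. transpose (R s) *v \<theta>"
  obtain K where K: "K > 0" "\<And>t. t \<in> {0..T} \<Longrightarrow> norm (R t) \<le> K" using R_bounded by blast
  have w'_le: "norm (?w' r) \<le> K * norm \<theta>" if "r \<in> {0..T}" for r
  proof -
    have "norm (?w' r) \<le> norm (transpose (R r)) * norm \<theta>"
      by (rule norm_matrix_vector_le)
    also have "\<dots> \<le> K * norm \<theta>"
      using K(2)[OF that] by (simp add: mult_right_mono)
    finally show ?thesis .
  qed
  have cont: "continuous_on {0..T} ?w'"
    by (intro continuous_intros continuous_R)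
  have [measurable]: "(\<lambda>s. indicator {0..r} s :: real) \<in> borel_measurable (lebesgue_on {0..T})" for r
    by (intro measurable_borel_lebesgue_on) measurable
  have "(\<lambda>n. LINT s|lebesgue_on {0..T}. (norm (transpose (\<sigma> s) *v ?w n s))\<^sup>2)
      \<longlonglongrightarrow> (LINT s|lebesgue_on {0..T}. (norm (transpose (\<sigma> s) *v ?w' s))\<^sup>2)"
  proof (rule integral_dominated_convergence[where w="\<lambda>s. (K * norm \<theta>)\<^sup>2 * (norm (\<sigma> s))\<^sup>2"])
    \<comment> \<open>The point \<open>0\<close> lies in none of the half-open grid cells, so the
      step approximation is \<open>0\<close> there.\<close>
    have "AE s in lebesgue_on {0..T}. s \<noteq> 0"
      by (subst AE_restrict_space_iff) (auto intro: AE_mp[OF AE_completion[OF AE_lborel_singleton[of 0]]])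
    then show "AE s in lebesgue_on {0..T}. (\<lambda>n. (norm (transpose (\<sigma> s) *v ?w n s))\<^sup>2)
        \<longlonglongrightarrow> (norm (transpose (\<sigma> s) *v ?w' s))\<^sup>2"
    proof (rule AE_mp, intro AE_I2 impI)
      fix s assume "s \<in> space (lebesgue_on {0..T})" "s \<noteq> 0"
      then have "(\<lambda>n. ?w n s) \<longlonglongrightarrow> ?w' s"
        by (intro tendsto_sum_grid[OF _ _ cont]) auto
      then show "(\<lambda>n. (norm (transpose (\<sigma> s) *v ?w n s))\<^sup>2) \<longlonglongrightarrow> (norm (transpose (\<sigma> s) *v ?w' s))\<^sup>2"
        by (intro tendsto_power tendsto_norm bounded_linear.tendsto[OF matrix_vector_mul_bounded_linear])
    qed
    show "AE s in lebesgue_on {0..T}. norm ((norm (transpose (\<sigma> s) *v ?w n s))\<^sup>2) \<le> (K * norm \<theta>)\<^sup>2 * (norm (\<sigma> s))\<^sup>2" for n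
    proof (intro AE_I2)
      fix s assume "s \<in> space (lebesgue_on {0..T})"
      then have "norm (?w n s) \<le> K * norm \<theta>"
        by (intro norm_sum_grid_le w'_le) auto
      then have "norm (transpose (\<sigma> s) *v ?w n s) \<le> norm (\<sigma> s) * (K * norm \<theta>)"
        by (intro order_trans[OF norm_matrix_vector_le]) (simp add: mult_left_mono)
      from power_mono[OF this norm_ge_zero, of 2]
      show "norm ((norm (transpose (\<sigma> s) *v ?w n s))\<^sup>2) \<le> (K * norm \<theta>)\<^sup>2 * (norm (\<sigma> s))\<^sup>2"
        by (simp add: power_mult_distrib mult_ac)
    qed
    show "(\<lambda>s. (norm (transpose (\<sigma> s) *v ?w' s))\<^sup>2) \<in> borel_measurable (lebesgue_on {0..T})"
      by measurable
    show "(\<lambda>s. (norm (transpose (\<sigma> s) *v ?w n s))\<^sup>2) \<in> borel_measurable (lebesgue_on {0..T})" for n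
      by measurable
  qed (use \<sigma>2 in simp)
  then have "(\<lambda>n. expectation (\<lambda>\<omega>. indicator C (X0 \<omega>) *\<^sub>R cis (\<theta> \<bullet> riemann_sum n \<omega>)))
    \<longlonglongrightarrow> prob (X0 -` C \<inter> space M) *\<^sub>R complex_of_real (exp (- (\<theta> \<bullet> (\<Gamma> *v \<theta>)) / 2))"
    unfolding char_riemann_sum[OF C] \<Gamma>_form by (intro tendsto_intros) auto
  moreover have "(\<lambda>n. expectation (\<lambda>\<omega>. indicator C (X0 \<omega>) *\<^sub>R cis (\<theta> \<bullet> riemann_sum n \<omega>)))
    \<longlonglongrightarrow> expectation (\<lambda>\<omega>. indicator C (X0 \<omega>) *\<^sub>R cis (\<theta> \<bullet> noise \<omega>))"
  proof (rule integral_dominated_convergence[where w="\<lambda>_. 1"])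
    show "AE \<omega> in M. (\<lambda>n. indicator C (X0 \<omega>) *\<^sub>R cis (\<theta> \<bullet> riemann_sum n \<omega>))
        \<longlonglongrightarrow> indicator C (X0 \<omega>) *\<^sub>R cis (\<theta> \<bullet> noise \<omega>)"
      using riemann_sum_tendsto_noise by eventually_elim (intro tendsto_intros)
  qed (auto simp: indicator_def)
  ultimately show ?thesis
    using LIMSEQ_unique by blast
qed

end

section \<open>The gradient of the log-density of the solution\<close>

theorem theorem3:
  fixes M :: "'a measure"
    and T :: real
    and b :: "real \<Rightarrow> real^'m^'m"
    and \<sigma> :: "real \<Rightarrow> real^'d^'m"
    and B :: "real \<Rightarrow> 'a \<Rightarrow> real^'d"
    and X0 :: "'a \<Rightarrow> real^'m"
    and p_data :: "(real^'m) measure"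
    and X :: "real \<Rightarrow> 'a \<Rightarrow> real^'m"
    and Y :: "real \<Rightarrow> real^'m^'m"
    and \<gamma> :: "real^'m^'m"
  assumes "prob_space M"
    and "T > 0"
    and "b \<in> borel_measurable (lebesgue_on {0..T})"
    and "integrable (lebesgue_on {0..T}) (\<lambda>t. norm (b t))"
    and "\<sigma> \<in> borel_measurable (lebesgue_on {0..T})"
    and "integrable (lebesgue_on {0..T}) (\<lambda>t. (norm (\<sigma> t))\<^sup>2)"
    and "brownian_motion_on M {0..T} B"
    and "X0 \<in> borel_measurable M"
    and "distr M borel X0 = p_data"
    and "indep_of_process M {0..T} X0 B"
    and "solves_linear_sde M T b \<sigma> B X0 X"
    and "solves_linear_matrix_ode T b Y"
    and "\<gamma> = Y T ** (LINT r|lebesgue_on {0..T}.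
               matrix_inv (Y r) ** \<sigma> r ** transpose (\<sigma> r) ** transpose (matrix_inv (Y r)))
             ** transpose (Y T)"
    and "invertible \<gamma>"
  shows "(\<exists>p. is_continuous_density M (X T) p) \<and>
         (\<exists>\<kappa>. is_conditional_law M X0 (X T) \<kappa>) \<and>
         (\<forall>p \<kappa>. is_continuous_density M (X T) p \<and> is_conditional_law M X0 (X T) \<kappa> \<longrightarrow>
            (AE y in lborel.
               integrable (\<kappa> y) (\<lambda>x. x) \<and> 0 < p y \<and>
               GDERIV (\<lambda>z. ln (p z)) y :>
                 - (matrix_inv \<gamma> *v (y - Y T *v (LINT x|\<kappa> y. x)))))"
proof -
  interpret prob_space M by fact
  interpret linear_sde M T b \<sigma> B X0 X Y
    by unfold_locales (fact assms)+
  have \<gamma>: "\<gamma> = Y T ** \<Gamma> ** transpose (Y T)"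
    using assms(13) by (simp add: \<Gamma>_def cov_density_def)
  have TT: "T \<in> {0..T}" using T by simp
  have \<gamma>_form: "x \<bullet> (\<gamma> *v z) = (transpose (Y T) *v x) \<bullet> (\<Gamma> *v (transpose (Y T) *v z))" for x z
    by (simp add: \<gamma> inner_matrix_vector flip: matrix_vector_mul_assoc)
  have \<gamma>_sym: "transpose \<gamma> = \<gamma>"
    by (simp add: \<gamma> matrix_transpose_mul \<Gamma>_sym matrix_mul_assoc)
  have "x \<bullet> (\<gamma> *v x) \<ge> 0" for x
    unfolding \<gamma>_form \<Gamma>_form by (rule integral_nonneg_AE) simp
  then obtain L :: "real^'m^'m" where L: "L ** \<gamma> ** transpose L = mat 1"
    using pos_def_whitening[OF \<gamma>_sym psd_invertible_pos[OF \<gamma>_sym _ \<open>invertible \<gamma>\<close>]] by blast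
  \<comment> \<open>For square matrices a right inverse is also a left inverse; this turns the
    whitening identity into \<open>transpose L ** L ** \<gamma> = mat 1\<close>.\<close>
  then have "transpose L ** (L ** \<gamma>) = mat 1"
    by (simp only: matrix_left_right_inverse[of "L ** \<gamma>" "transpose L"])
  then have "(transpose L ** L) ** (\<gamma> ** matrix_inv \<gamma>) = matrix_inv \<gamma>"
    by (simp add: matrix_mul_assoc)
  then have inv_\<gamma>: "matrix_inv \<gamma> = transpose L ** L"
    by (simp add: matrix_inv_right \<open>invertible \<gamma>\<close>)
  have invL: "invertible L"
    unfolding invertible_right_inverse
    by (rule exI[of _ "\<gamma> ** transpose L"]) (simp only: matrix_mul_assoc L)
  have "expectation (\<lambda>\<omega>. indicator C (X0 \<omega>) *\<^sub>R cis (\<theta> \<bullet> (L *v (X T \<omega> - Y T *v X0 \<omega>))))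
      = prob (X0 -` C \<inter> space M) *\<^sub>R complex_of_real (exp (- (norm \<theta>)\<^sup>2 / 2))" if "C \<in> sets borel" for C \<theta>
  proof -
    \<comment> \<open>The frequency is moved through \<open>L\<close> and \<open>Y T\<close> by
      transposition, so the quadratic form of \<Gamma> at the new frequency is the whitened form of
      \<gamma>, which is the squared norm.\<close>
    let ?\<theta> = "transpose (Y T) *v (transpose L *v \<theta>)"
    have "X T \<omega> - Y T *v X0 \<omega> = Y T *v noise \<omega>" for \<omega>
      using YR[OF TT] by (simp add: noise_def matrix_vector_mult_diff_distrib)
    then have "\<theta> \<bullet> (L *v (X T \<omega> - Y T *v X0 \<omega>)) = ?\<theta> \<bullet> noise \<omega>" for \<omega>
      by (simp add: inner_matrix_vector)
    moreover have "?\<theta> \<bullet> (\<Gamma> *v ?\<theta>) = \<theta> \<bullet> ((L ** \<gamma> ** transpose L) *v \<theta>)"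
      by (simp only: inner_matrix_vector[of \<theta> L] \<gamma>_form flip: matrix_vector_mul_assoc)
    then have "?\<theta> \<bullet> (\<Gamma> *v ?\<theta>) = (norm \<theta>)\<^sup>2"
      by (simp add: L power2_norm_eq_inner)
    ultimately show ?thesis
      using char_noise[OF that, of ?\<theta>] by simp
  qed
  then obtain c where "gaussian_channel M X0 (X T) (Y T) L c"
    using gaussian_channel_of_char[OF X0 measurable_X[OF TT] invertible_Y[OF TT] invL] by blast
  then interpret gaussian_channel M X0 "X T" "Y T" L c .
  show ?thesis
    using is_continuous_density_p is_conditional_law_\<kappa> tweedie unfolding inv_\<gamma> by blast
qed

end
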